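(* Let $(\zeta_t)_{t\ge0}$ be the free process (the Markov process on $\mathcal X_0$ with generator $\mathcal L_0$) started from the flat configuration $\zeta_0(x)=x\pmod 2\in\{0,1\}$, $x\in\mathbb Z$. Then, with $\mathbb V$ denoting variance, $$\lim_{t\to\infty}\frac{\mathbb V\,\zeta_t(0)}{\sqrt t}=\frac1{\sqrt\pi},\qquad \sup_{t\ge0}\mathbb E\bigl(e^{|\zeta_t(0)/t^{1/4}|}\bigr)<\infty,$$ and for all $K>0$ and all $t$ large enough $$\mathbb P\bigl(|\zeta_t(0)|>K t^{1/4}\log t\bigr)\le c\,t^{-K},$$ where $c$ is a constant.
   Context: Let $\mathcal X_0=\{\zeta\in\mathbb Z^{\mathbb Z}:|\zeta(x)-\zeta(x+1)|=1\text{ for all }x\in\mathbb Z,\ \zeta(0)\text{ even}\}$. The discrete Laplacian is $\Delta\zeta(x)=\zeta(x+1)-2\zeta(x)+\zeta(x-1)$, and $\delta_x$ is the configuration equal to $1$ at $x$ and $0$ elsewhere. The free process is the continuous-time Markov process on $\mathcal X_0$ with generator $$\mathcal L_0f(\zeta)=\frac12\sum_{x\in\mathbb Z}[f(\zeta+\Delta\zeta(x)\,\delta_x)-f(\zeta)].$$ Equivalently, it is built from independent Poisson processes of rate $\frac12$ attached to the sites $x\in\mathbb Z$: at each event attached to $x$ the height at $x$ is replaced by $\zeta(x)+\Delta\zeta(x)$.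
   Formalization: The supremum over t≥0 is replaced by the supremum over t≥t0 for every t0>0: as t→0+, P(ζ_t(0)=2)~t/2, so the expectation is at least about (t/2)exp(2t^{-1/4})→∞, and the expression is undefined at t=0. *)

theory Defs
  imports "HOL-Probability.Probability"
begin

type_synonym config = "int \<Rightarrow> int"

definition X0 :: "config set" where
  "X0 = {\<zeta>. (\<forall>x. \<bar>\<zeta> x - \<zeta> (x + 1)\<bar> = 1) \<and> even (\<zeta> 0)}"

definition X0_space :: "config measure" where
  "X0_space = restrict_space (\<Pi>\<^sub>M x\<in>(UNIV :: int set). count_space (UNIV :: int set)) X0"

definition laplacian :: "config \<Rightarrow> int \<Rightarrow> int" where
  "laplacian \<zeta> x = \<zeta> (x + 1) - 2 * \<zeta> x + \<zeta> (x - 1)"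

definition site_update :: "config \<Rightarrow> int \<Rightarrow> config" where
  "site_update \<zeta> x = \<zeta>(x := \<zeta> x + laplacian \<zeta> x)"

definition bounded_local :: "(config \<Rightarrow> real) \<Rightarrow> bool" where
  "bounded_local f \<longleftrightarrow>
     bounded (f ` X0) \<and>
     (\<exists>A. finite A \<and> (\<forall>\<zeta>\<in>X0. \<forall>\<xi>\<in>X0. (\<forall>x\<in>A. \<zeta> x = \<xi> x) \<longrightarrow> f \<zeta> = f \<xi>))"

text \<open>For a local function \<open>f\<close> only finitely many terms of the following sum are nonzero.\<close>

definition free_generator :: "(config \<Rightarrow> real) \<Rightarrow> config \<Rightarrow> real" where
  "free_generator f \<zeta> = (1 / 2) * (\<Sum>\<^sub>\<infinity>x. f (site_update \<zeta> x) - f \<zeta>)"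

definition transition_semigroup ::
    "'s measure \<Rightarrow> (real \<Rightarrow> 's \<Rightarrow> 's measure) \<Rightarrow> bool" where
  "transition_semigroup S P \<longleftrightarrow>
     (\<forall>t\<ge>0. P t \<in> S \<rightarrow>\<^sub>M prob_algebra S) \<and>
     (\<forall>\<zeta>\<in>space S. P 0 \<zeta> = return S \<zeta>) \<and>
     (\<forall>s\<ge>0. \<forall>t\<ge>0. \<forall>\<zeta>\<in>space S. P (s + t) \<zeta> = P s \<zeta> \<bind> P t)"

definition past :: "'a measure \<Rightarrow> 's measure \<Rightarrow> (real \<Rightarrow> 'a \<Rightarrow> 's) \<Rightarrow> real \<Rightarrow> 'a measure" where
  "past M S Z s = sigma (space M) (\<Union>r\<in>{0..s}. {Z r -` B \<inter> space M | B. B \<in> sets S})"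

definition markov_process ::
    "'a measure \<Rightarrow> 's measure \<Rightarrow> (real \<Rightarrow> 's \<Rightarrow> 's measure) \<Rightarrow> (real \<Rightarrow> 'a \<Rightarrow> 's) \<Rightarrow> bool" where
  "markov_process M S P Z \<longleftrightarrow>
     prob_space M \<and>
     transition_semigroup S P \<and>
     (\<forall>t\<ge>0. Z t \<in> M \<rightarrow>\<^sub>M S) \<and>
     (\<forall>s\<ge>0. \<forall>t\<ge>0. \<forall>B\<in>sets S. AE \<omega> in M.
        real_cond_exp M (past M S Z s) (indicat_real (Z (s + t) -` B \<inter> space M)) \<omega>
          = measure (P t (Z s \<omega>)) B)"

text \<open>The infinitesimal generator is the derivative at time \<open>0\<close> of the semigroup with respect to
  the supremum norm on \<open>X0\<close>. Bounded local functions are mapped to bounded local functions and the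
  semigroup is determined by its generator on them, as the iterates of the generator grow at
  most like \<open>C\<^sup>n n!\<close>, up to a polynomial factor.\<close>

definition has_free_generator :: "(real \<Rightarrow> config \<Rightarrow> config measure) \<Rightarrow> bool" where
  "has_free_generator P \<longleftrightarrow>
     (\<forall>f. bounded_local f \<longrightarrow>
        uniform_limit X0 (\<lambda>t \<zeta>. ((\<integral>\<xi>. f \<xi> \<partial>P t \<zeta>) - f \<zeta>) / t) (free_generator f) (at_right 0))"

definition free_process :: "'a measure \<Rightarrow> (real \<Rightarrow> 'a \<Rightarrow> config) \<Rightarrow> bool" where
  "free_process M Z \<longleftrightarrow> (\<exists>P. markov_process M X0_space P Z \<and> has_free_generator P)"

definition flat_config :: config where
  "flat_config = (\<lambda>x. x mod 2)"

end

theory Submission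
  imports Defs "HOL-Real_Asymp.Real_Asymp"
begin

text \<open>The obstacle is that the generator is given only as a derivative of the semigroup at
  time 0, on bounded local functions, whereas heights, their squares and exponentials are unbounded.
  A crude exponential moment bound, obtained by truncation, extends the forward equation to local
  functions of exponential growth; the sharp estimates are derived from that equation. Each moment
  equation is an infinite linear system over sites or pairs of sites. It is not solved: an explicit
  candidate is written down and compared with the expectation through one weighted uniqueness lemma,
  which also identifies the heat kernel with its Fourier integral. Why two consecutive distances are
  added: exchanging two adjacent slopes does not change their product, so the correlation at
  distance k + 1 obeys the heat equation with an even reflection about -1/2 in k. The flat start
  makes these correlations alternate in sign for all k; adding neighbours cancels the alternation
  except at the reflection point. The scale t^(1/4) comes from the singularity 1 / sqrt (t - s): it
  is integrable, with integral 2 sqrt t, so \<lambda>^2 sqrt t must stay bounded.\<close>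

text \<open>Let \<open>p\<close> be the heat kernel of the simple random walk on the integers with jump rate 1 and let
  \<open>\<eta>(x) = \<zeta>(x + 1) - \<zeta>(x)\<close>. The generator maps \<open>\<zeta>(x)\<^sup>2\<close> to half of its discrete Laplacian minus
  \<open>\<eta>(x - 1) \<eta>(x)\<close>. The correlations \<open>E \<eta>(x) \<eta>(y)\<close> solve a closed linear system, the heat equation in
  \<open>y - x\<close> reflected at distance 1; for the flat initial configuration the sums over two consecutive
  distances solve the unreflected heat equation started from a point mass, so that
  \<open>E \<eta>\<^sub>t(x - 1) \<eta>\<^sub>t(x) = - p\<^sub>2\<^sub>t(0)\<close>. Hence \<open>E \<zeta>\<^sub>t(x)\<^sup>2\<close> is \<open>E \<zeta>\<^sub>t(x)\<close> plus the integral of \<open>p\<^sub>2\<^sub>s(0)\<close>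
  over \<open>0 \<le> s \<le> t\<close>, and the variance asymptotics follow from the Fourier representation of \<open>p\<close>.

  For exponential moments, \<open>\<Sum>\<^sub>x p\<^sub>t\<^sub>-\<^sub>s(x) \<zeta>\<^sub>s(x)\<close> is a martingale in \<open>s\<close> ending in \<open>\<zeta>\<^sub>t(0)\<close>. The logarithmic
  growth rate of its exponential moment with parameter \<open>\<lambda>\<close> is of order
  \<open>\<lambda>\<^sup>2 \<Sum>\<^sub>x p\<^sub>t\<^sub>-\<^sub>s(x)\<^sup>2\<close>, which is at most a constant times \<open>\<lambda>\<^sup>2 / sqrt (t - s)\<close>. With
  \<open>\<lambda> = t powr (- 1/4)\<close> and its negative this gives the uniform bound, and Markov's inequality gives the tail.\<close>

section \<open>ODE comparison and the heat kernel\<close>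

lemma nondecreasing_of_deriv_within:
  fixes f f' :: "real \<Rightarrow> real"
  assumes "a \<le> b"
    and "\<And>s. s \<in> {a..b} \<Longrightarrow> (f has_real_derivative f' s) (at s within {a..b})"
    and "\<And>s. s \<in> {a<..<b} \<Longrightarrow> 0 \<le> f' s"
  shows "f a \<le> f b"
proof (rule DERIV_nonneg_imp_increasing_open[OF assms(1)])
  fix x assume "a < x" "x < b"
  then show "\<exists>y. DERIV f x :> y \<and> 0 \<le> y"
    using assms(2)[of x] assms(3)[of x] by (auto simp: at_within_Icc_at)
next
  show "continuous_on {a..b} f"
    by (rule DERIV_continuous_on[OF assms(2)])
qed

text \<open>Discounting \<open>u\<close> by \<open>exp (K 0 - K s)\<close> and subtracting
  \<open>e * s\<close> gives a decreasing function. The rate \<open>k\<close> is required only in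
  the open interval, with \<open>K\<close> continuous up to the ends, because it will be applied to
  \<open>k s = c / sqrt (t - s)\<close>, which blows up at the right end.\<close>

lemma gronwall:
  fixes u k K :: "real \<Rightarrow> real"
  assumes "0 \<le> T" "0 \<le> e"
    and u: "\<And>s. s \<in> {0..T} \<Longrightarrow> (u has_real_derivative u' s) (at s within {0..T})"
    and K: "\<And>s. s \<in> {0<..<T} \<Longrightarrow> (K has_real_derivative k s) (at s)"
    and K_cont: "continuous_on {0..T} K"
    and k: "\<And>s. s \<in> {0<..<T} \<Longrightarrow> 0 \<le> k s"
    and le: "\<And>s. s \<in> {0<..<T} \<Longrightarrow> u' s \<le> k s * u s + e"
  shows "u T \<le> exp (K T - K 0) * (u 0 + e * T)"
proof -
  have K_mono: "K 0 \<le> K x" if x: "0 \<le> x" "x \<le> T" for x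
  proof -
    have "continuous_on {0..x} K" using K_cont by (rule continuous_on_subset) (use x in auto)
    moreover have "\<exists>z. (K has_real_derivative z) (at y) \<and> 0 \<le> z" if "0 < y" "y < x" for y
      using K[of y] k[of y] that x by auto
    ultimately show ?thesis using DERIV_nonneg_imp_increasing_open[of 0 x K] x by blast
  qed
  define v where "v s = u s * exp (K 0 - K s) - e * s" for s
  have "v 0 \<ge> v T"
  proof (rule DERIV_nonpos_imp_decreasing_open[where f = v])
    show "continuous_on {0..T} v"
      unfolding v_def by (intro continuous_intros K_cont DERIV_continuous_on[OF u])
    show "\<exists>y. (v has_real_derivative y) (at s) \<and> y \<le> 0" if "0 < s" "s < T" for s
    proof (intro exI conjI)
      have du: "(u has_real_derivative u' s) (at s)" using u[of s] that by (auto simp: at_within_Icc_at)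
      have dK: "(K has_real_derivative k s) (at s)" using K[of s] that by auto
      show "(v has_real_derivative (u' s - k s * u s) * exp (K 0 - K s) - e) (at s)"
        unfolding v_def by (auto intro!: derivative_eq_intros du dK simp: algebra_simps)
      have "(u' s - k s * u s) * exp (K 0 - K s) \<le> e * exp (K 0 - K s)"
        using le[of s] that by (intro mult_right_mono) auto
      also have "\<dots> \<le> e * 1" using K_mono[of s] that assms by (intro mult_left_mono) auto
      finally show "(u' s - k s * u s) * exp (K 0 - K s) - e \<le> 0" by simp
    qed
  qed fact
  then have "u T * exp (K 0 - K T) \<le> u 0 + e * T" by (simp add: v_def)
  then have "u T * exp (K 0 - K T) * exp (K T - K 0) \<le> (u 0 + e * T) * exp (K T - K 0)"
    by (intro mult_right_mono) auto
  then show ?thesis by (simp add: mult.assoc exp_add[symmetric]) (simp add: mult.commute)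
qed

text \<open>Integrating the linear bound \<open>n\<close> times shows that the solution is at most \<open>B (C s)\<^sup>n / n!\<close> times
  the weight.\<close>

lemma linear_system_unique:
  fixes D D' :: "real \<Rightarrow> 'i \<Rightarrow> real" and w :: "'i \<Rightarrow> real"
  assumes "0 \<le> T" "0 \<le> B" "0 \<le> C"
    and D: "\<And>s i. s \<in> {0..T} \<Longrightarrow> i \<in> I \<Longrightarrow> ((\<lambda>s. D s i) has_real_derivative D' s i) (at s within {0..T})"
    and D0: "\<And>i. i \<in> I \<Longrightarrow> D 0 i = 0"
    and bound: "\<And>s i. s \<in> {0..T} \<Longrightarrow> i \<in> I \<Longrightarrow> \<bar>D s i\<bar> \<le> B * w i"
    and lin: "\<And>s b i. s \<in> {0..T} \<Longrightarrow> 0 \<le> b \<Longrightarrow> (\<And>j. j \<in> I \<Longrightarrow> \<bar>D s j\<bar> \<le> b * w j) \<Longrightarrow> i \<in> I \<Longrightarrow>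
                \<bar>D' s i\<bar> \<le> C * b * w i"
    and "s \<in> {0..T}" "i \<in> I"
  shows "D s i = 0"
proof -
  have step: "\<bar>D s i\<bar> \<le> B * (C * s) ^ n / fact n * w i" if "s \<in> {0..T}" "i \<in> I" for n s i
    using that
  proof (induction n arbitrary: s i)
    case 0
    then show ?case using bound by simp
  next
    case (Suc n)
    define F where "F r = B * (C * r) ^ Suc n / fact (Suc n) * w i" for r
    have dF: "(F has_real_derivative C * (B * (C * r) ^ n / fact n) * w i) (at r within S)" for r S
    proof -
      have "(F has_real_derivative B * (real (Suc n) * (C * r) ^ n * C) / fact (Suc n) * w i) (at r within S)"
        unfolding F_def by (auto intro!: derivative_eq_intros simp del: power_Suc of_nat_Suc fact_Suc)
      moreover have "B * (real (Suc n) * a * C) / fact (Suc n) * w i = C * (B * a / fact n) * w i" for a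
        by (simp add: divide_simps del: of_nat_Suc)
      ultimately show ?thesis by (simp only:)
    qed
    have dD: "((\<lambda>s. D s i) has_real_derivative D' r i) (at r within {0..s})" if "r \<in> {0..s}" for r
      using D[of r i] Suc.prems that by (auto intro: DERIV_subset)
    have b: "\<bar>D' r i\<bar> \<le> C * (B * (C * r) ^ n / fact n) * w i" if r: "r \<in> {0..s}" for r
    proof (rule lin)
      show "r \<in> {0..T}" using r Suc.prems by auto
      then show "\<bar>D r j\<bar> \<le> B * (C * r) ^ n / fact n * w j" if "j \<in> I" for j
        using that by (rule Suc.IH)
      show "0 \<le> B * (C * r) ^ n / fact n" using assms r by simp
    qed (rule Suc.prems)
    have nonneg: "0 \<le> C * (B * (C * r) ^ n / fact n) * w i - D' r i"
        "0 \<le> C * (B * (C * r) ^ n / fact n) * w i + D' r i" if "r \<in> {0<..<s}" for r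
      using b[of r] that unfolding abs_le_iff by auto
    have "F 0 - D 0 i \<le> F s - D s i"
      by (rule nondecreasing_of_deriv_within[OF _ DERIV_diff[OF dF dD] nonneg(1)]) (use Suc.prems in auto)
    moreover have "F 0 + D 0 i \<le> F s + D s i"
      by (rule nondecreasing_of_deriv_within[OF _ DERIV_add[OF dF dD] nonneg(2)]) (use Suc.prems in auto)
    ultimately have "\<bar>D s i\<bar> \<le> F s" using D0[OF Suc.prems(2)] by (simp add: F_def abs_le_iff)
    then show ?case by (simp add: F_def)
  qed
  have "(\<lambda>n. B * (inverse (fact n) * (C * s) ^ n) * w i) \<longlonglongrightarrow> B * 0 * w i"
    by (intro tendsto_intros summable_LIMSEQ_zero[OF summable_exp])
  then have "(\<lambda>n. B * (C * s) ^ n / fact n * w i) \<longlonglongrightarrow> B * 0 * w i"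
    by (simp add: field_simps)
  then have "\<bar>D s i\<bar> \<le> 0"
    using step[OF assms(8,9)] by (intro LIMSEQ_le_const) auto
  then show ?thesis by simp
qed

section \<open>Simple random walk and its Poissonization, the heat kernel\<close>

primrec srw :: "nat \<Rightarrow> int \<Rightarrow> real" where
  "srw 0 x = (if x = 0 then 1 else 0)"
| "srw (Suc n) x = (srw n (x - 1) + srw n (x + 1)) / 2"

lemma srw_nonneg: "0 \<le> srw n x"
  by (induction n arbitrary: x) auto

lemma srw_le_1: "srw n x \<le> 1"
proof (induction n arbitrary: x)
  case (Suc n)
  show ?case using Suc[of "x - 1"] Suc[of "x + 1"] by simp
qed auto

text \<open>One step of the walk costs at most a factor \<open>c\<close> in the weight. Working with
  finite windows avoids infinite sums over sites; shifting by one site is absorbed by enlarging the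
  window, so \<open>N\<close> must stay arbitrary in the induction.\<close>

lemma srw_weighted_sum:
  fixes w :: "int \<Rightarrow> real"
  assumes "\<And>x. 0 \<le> w x" "0 \<le> c" and w: "\<And>x y. \<bar>x - y\<bar> = 1 \<Longrightarrow> w y \<le> c * w x"
  shows "(\<Sum>x\<in>{-int N..int N}. srw n x * w x) \<le> c ^ n * w 0"
proof (induction n arbitrary: N)
  case 0
  have "(\<Sum>x\<in>{-int N..int N}. srw 0 x * w x) = (\<Sum>x\<in>{-int N..int N}. if x = 0 then w 0 else 0)"
    by (intro sum.cong) auto
  then show ?case using assms by simp
next
  case (Suc n)
  let ?I = "\<lambda>N. {-int N..int N}"
  have aux: "(\<Sum>x\<in>?I N. srw n (x + d) * w x) \<le> c * (c ^ n * w 0)" if "\<bar>d\<bar> = 1" for d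
  proof -
    have "(\<Sum>x\<in>?I N. srw n (x + d) * w x) = (\<Sum>x\<in>(\<lambda>x. x + d) ` ?I N. srw n x * w (x - d))"
      by (subst sum.reindex) (auto simp: inj_on_def)
    also have "\<dots> \<le> (\<Sum>x\<in>?I (N + 1). srw n x * w (x - d))"
      using that assms(1) by (intro sum_mono2) (auto simp: srw_nonneg)
    also have "\<dots> \<le> (\<Sum>x\<in>?I (N + 1). c * (srw n x * w x))"
    proof (rule sum_mono)
      fix x
      have "srw n x * w (x - d) \<le> srw n x * (c * w x)"
        using that by (intro mult_left_mono w srw_nonneg) auto
      then show "srw n x * w (x - d) \<le> c * (srw n x * w x)" by (simp add: algebra_simps)
    qed
    also have "\<dots> \<le> c * (c ^ n * w 0)"
      unfolding sum_distrib_left[symmetric] using Suc.IH[of "N + 1"] assms by (intro mult_left_mono) auto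
    finally show ?thesis .
  qed
  have "(\<Sum>x\<in>?I N. srw (Suc n) x * w x) =
      ((\<Sum>x\<in>?I N. srw n (x + (-1)) * w x) + (\<Sum>x\<in>?I N. srw n (x + 1) * w x)) / 2"
    by (simp add: sum.distrib[symmetric] sum_divide_distrib algebra_simps add_divide_distrib)
  also have "\<dots> \<le> (c * (c ^ n * w 0) + c * (c ^ n * w 0)) / 2"
    using aux[of "-1"] aux[of 1] by (intro divide_right_mono add_mono) auto
  also have "\<dots> = c ^ Suc n * w 0" by simp
  finally show ?case .
qed

text \<open>The law of the walk after a Poisson number of steps with mean \<open>s\<close>. In this
  power series form positivity and termwise differentiation are immediate; decay in \<open>s\<close>
  is read off from the Fourier form instead.\<close>

definition heat :: "real \<Rightarrow> int \<Rightarrow> real" where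
  "heat s x = exp (- s) * (\<Sum>n. srw n x / fact n * s ^ n)"

lemma summable_heat: "summable (\<lambda>n. srw n x / fact n * s ^ n)"
proof (rule summable_comparison_test')
  show "summable (\<lambda>n. \<bar>s\<bar> ^ n / fact n)" using summable_exp[of "\<bar>s\<bar>"] by (simp add: field_simps)
  show "norm (srw n x / fact n * s ^ n) \<le> \<bar>s\<bar> ^ n / fact n" for n
    using srw_nonneg[of n x] srw_le_1[of n x]
    by (simp add: abs_mult power_abs divide_right_mono mult_left_le_one_le)
qed

lemma heat_deriv:
  "((\<lambda>s. heat s x) has_real_derivative (heat s (x + 1) + heat s (x - 1)) / 2 - heat s x) (at s within S)"
proof -
  define F where "F x s = (\<Sum>n. srw n x / fact n * s ^ n)" for x and s :: real
  have "diffs (\<lambda>n. srw n x / fact n) = (\<lambda>n. srw (Suc n) x / fact n)"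
    by (auto simp: diffs_def fun_eq_iff)
  then have "(F x has_real_derivative (\<Sum>n. srw (Suc n) x / fact n * s ^ n)) (at s)"
    unfolding F_def using termdiffs_strong_converges_everywhere[OF summable_heat, of x s] by simp
  also have "(\<lambda>n. srw (Suc n) x / fact n * s ^ n) =
     (\<lambda>n. (srw n (x - 1) / fact n * s ^ n + srw n (x + 1) / fact n * s ^ n) / 2)"
    by (auto simp: fun_eq_iff field_simps)
  also have "(\<Sum>n. (srw n (x - 1) / fact n * s ^ n + srw n (x + 1) / fact n * s ^ n) / 2) = (F (x - 1) s + F (x + 1) s) / 2"
    unfolding F_def by (subst suminf_divide[OF summable_add[OF summable_heat summable_heat]])
      (simp only: suminf_add[OF summable_heat summable_heat])
  finally have F: "(F x has_real_derivative (F (x - 1) s + F (x + 1) s) / 2) (at s within S)"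
    by (rule has_field_derivative_at_within)
  have "((\<lambda>s. exp (- s) * F x s) has_real_derivative
      exp (- s) * ((F (x - 1) s + F (x + 1) s) / 2) - exp (- s) * F x s) (at s within S)"
    by (rule derivative_eq_intros F refl)+ simp
  moreover have "exp (- s) * ((F (x - 1) s + F (x + 1) s) / 2) - exp (- s) * F x s
      = (heat s (x + 1) + heat s (x - 1)) / 2 - heat s x"
    unfolding heat_def F_def by (simp add: field_simps)
  ultimately show ?thesis unfolding heat_def F_def by simp
qed

lemma heat_0: "heat 0 x = (if x = 0 then 1 else 0)"
  unfolding heat_def using suminf_finite[of "{0}" "\<lambda>n. srw n x / fact n * 0 ^ n"] by auto

lemma heat_nonneg: "0 \<le> s \<Longrightarrow> 0 \<le> heat s x"
  unfolding heat_def by (intro mult_nonneg_nonneg suminf_nonneg summable_heat) (auto simp: srw_nonneg)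

text \<open>The Poisson average of \<open>c ^ n\<close> is \<open>exp ((c - 1) * s)\<close>. Weight
  1 with \<open>c = 1\<close> bounds the total mass; weight \<open>exp \<bar>x\<bar>\<close> with
  \<open>c = exp 1\<close> gives exponential tails, where \<open>exp 1 - 1 \<le> 2\<close> produces
  the rate 2 seen below.\<close>

lemma heat_weighted_sum:
  fixes w :: "int \<Rightarrow> real"
  assumes "0 \<le> s" "\<And>x. 0 \<le> w x" "0 \<le> c" "\<And>x y. \<bar>x - y\<bar> = 1 \<Longrightarrow> w y \<le> c * w x"
  shows "(\<Sum>x\<in>{-int N..int N}. heat s x * w x) \<le> exp ((c - 1) * s) * w 0"
proof -
  let ?I = "{-int N..int N}"
  have eq: "(\<lambda>n. \<Sum>x\<in>?I. w x * (srw n x / fact n * s ^ n)) = (\<lambda>n. (\<Sum>x\<in>?I. srw n x * w x) * (s ^ n / fact n))"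
    by (intro ext, subst sum_distrib_right) (auto intro!: sum.cong)
  have "(\<Sum>x\<in>?I. heat s x * w x) = exp (- s) * (\<Sum>x\<in>?I. \<Sum>n. w x * (srw n x / fact n * s ^ n))"
    unfolding heat_def by (subst suminf_mult[OF summable_heat]) (simp add: sum_distrib_left algebra_simps)
  also have "(\<Sum>x\<in>?I. \<Sum>n. w x * (srw n x / fact n * s ^ n)) = (\<Sum>n. \<Sum>x\<in>?I. w x * (srw n x / fact n * s ^ n))"
    by (rule suminf_sum[symmetric]) (intro summable_mult summable_heat)
  also note eq
  also have "(\<Sum>n. (\<Sum>x\<in>?I. srw n x * w x) * (s ^ n / fact n)) \<le> (\<Sum>n. w 0 * ((c * s) ^ n / fact n))"
  proof (rule suminf_le)
    show "(\<Sum>x\<in>?I. srw n x * w x) * (s ^ n / fact n) \<le> w 0 * ((c * s) ^ n / fact n)" for n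
      using mult_right_mono[OF srw_weighted_sum[where w = w and c = c and n = n and N = N, OF assms(2-4)], of "s ^ n / fact n"] assms(1)
      by (simp add: power_mult_distrib field_simps)
    show "summable (\<lambda>n. (\<Sum>x\<in>?I. srw n x * w x) * (s ^ n / fact n))"
      unfolding eq[symmetric] by (intro summable_sum summable_mult summable_heat)
    show "summable (\<lambda>n. w 0 * ((c * s) ^ n / fact n))"
      using summable_exp[of "c * s"] by (intro summable_mult) (simp add: field_simps)
  qed
  also have "\<dots> = w 0 * exp (c * s)"
    using exp_converges[of "c * s"] by (subst suminf_mult) (auto simp: sums_iff field_simps)
  finally have "(\<Sum>x\<in>?I. heat s x * w x) \<le> exp (- s) * (w 0 * exp (c * s))"
    using mult_left_mono[of _ _ "exp (- s)"] by simp
  also have "\<dots> = exp (- s + c * s) * w 0" by (simp only: exp_add ac_simps)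
  also have "- s + c * s = (c - 1) * s" by (simp add: algebra_simps)
  finally show ?thesis .
qed

lemma heat_sum_le_1: "0 \<le> s \<Longrightarrow> (\<Sum>x\<in>{-int N..int N}. heat s x) \<le> 1"
  using heat_weighted_sum[of s "\<lambda>_. 1" 1 N] by simp

lemma heat_exp_sum:
  assumes "0 \<le> s"
  shows "(\<Sum>x\<in>{-int N..int N}. heat s x * exp \<bar>real_of_int x\<bar>) \<le> exp (2 * s)"
proof -
  have "(\<Sum>x\<in>{-int N..int N}. heat s x * exp \<bar>real_of_int x\<bar>) \<le> exp ((exp 1 - 1) * s) * exp \<bar>real_of_int 0\<bar>"
    using assms by (intro heat_weighted_sum) (auto simp: exp_add[symmetric])
  also have "\<dots> \<le> exp (2 * s)" using assms exp_le by (simp add: mult_right_mono)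
  finally show ?thesis .
qed

lemma heat_le_exp:
  assumes "0 \<le> s"
  shows "heat s x \<le> exp (2 * s) * exp (- \<bar>real_of_int x\<bar>)"
proof -
  have "heat s x * exp \<bar>real_of_int x\<bar> \<le> (\<Sum>y\<in>{-int (nat \<bar>x\<bar>)..int (nat \<bar>x\<bar>)}. heat s y * exp \<bar>real_of_int y\<bar>)"
    using assms by (intro member_le_sum) (auto simp: heat_nonneg)
  also have "\<dots> \<le> exp (2 * s)" by (rule heat_exp_sum[OF assms])
  finally show ?thesis by (simp add: exp_minus field_simps)
qed

lemma heat_le_1:
  assumes "0 \<le> s"
  shows "heat s x \<le> 1"
proof -
  have "heat s x \<le> (\<Sum>y\<in>{-int (nat \<bar>x\<bar>)..int (nat \<bar>x\<bar>)}. heat s y)"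
    using assms by (intro member_le_sum) (auto simp: heat_nonneg)
  also have "\<dots> \<le> 1" by (rule heat_sum_le_1[OF assms])
  finally show ?thesis .
qed

section \<open>Fourier representation and decay of the heat kernel\<close>

text \<open>Both sides are bounded by 1, start from a point mass at 0 and solve the same heat
  equation, so their difference falls under \<open>linear_system_unique\<close> with constant
  weight. On the Fourier side the equation is the product formula for
  \<open>cos (x * \<theta>) * cos \<theta>\<close>.\<close>

lemma heat_fourier:
  assumes "0 \<le> s"
  shows "heat s x = integral {0..pi} (\<lambda>\<theta>. cos (x * \<theta>) * exp (- s * (1 - cos \<theta>))) / pi"
proof -
  define f where "f s x \<theta> = cos (real_of_int x * \<theta>) * exp (- s * (1 - cos \<theta>))" for s and x :: int and \<theta> :: real
  define F where "F s x = integral {0..pi} (f s x) / pi" for s x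
  have integrable: "f s x integrable_on {0..pi}" for s x
    unfolding f_def by (intro integrable_continuous_interval continuous_intros)
  have F_bound: "\<bar>F s x\<bar> \<le> 1" if "0 \<le> s" for s x
  proof -
    have "norm (integral {0..pi} (f s x)) \<le> integral {0..pi} (\<lambda>\<theta>. 1)"
    proof (rule integral_norm_bound_integral[OF integrable])
      show "norm (f s x \<theta>) \<le> 1" for \<theta>
        unfolding f_def using that by (auto simp: abs_mult intro!: mult_le_one)
    qed auto
    then show ?thesis unfolding F_def by (simp add: field_simps)
  qed
  have F_deriv: "((\<lambda>s. F s x) has_real_derivative (F s (x + 1) + F s (x - 1)) / 2 - F s x) (at s within S)" for s x S
  proof -
    have "((\<lambda>s. integral (cbox 0 pi) (f s x)) has_field_derivative
            integral (cbox 0 pi) (\<lambda>\<theta>. f s x \<theta> * (cos \<theta> - 1))) (at s within UNIV)"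
    proof (rule leibniz_rule_field_derivative)
      show "((\<lambda>s. f s x \<theta>) has_real_derivative f s x \<theta> * (cos \<theta> - 1)) (at s within UNIV)" for s \<theta>
        unfolding f_def by (auto intro!: derivative_eq_intros simp: algebra_simps)
      show "continuous_on (UNIV \<times> cbox 0 pi) (\<lambda>(s, \<theta>). f s x \<theta> * (cos \<theta> - 1))"
        unfolding f_def case_prod_beta by (intro continuous_intros)
    qed (use integrable in auto)
    also have "(\<lambda>\<theta>. f s x \<theta> * (cos \<theta> - 1)) = (\<lambda>\<theta>. (f s (x + 1) \<theta> + f s (x - 1) \<theta>) / 2 - f s x \<theta>)"
    proof
      fix \<theta>
      have "cos (real_of_int (x + 1) * \<theta>) + cos (real_of_int (x - 1) * \<theta>) = 2 * cos (real_of_int x * \<theta>) * cos \<theta>"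
        by (simp add: distrib_right left_diff_distrib cos_add cos_diff)
      then have "f s (x + 1) \<theta> + f s (x - 1) \<theta> = 2 * (cos (real_of_int x * \<theta>) * cos \<theta>) * exp (- s * (1 - cos \<theta>))"
        unfolding f_def by (simp only: distrib_right[symmetric] mult.assoc)
      then show "f s x \<theta> * (cos \<theta> - 1) = (f s (x + 1) \<theta> + f s (x - 1) \<theta>) / 2 - f s x \<theta>"
        by (simp add: f_def algebra_simps)
    qed
    also have "integral (cbox 0 pi) \<dots> = (integral {0..pi} (f s (x + 1)) + integral {0..pi} (f s (x - 1))) / 2 - integral {0..pi} (f s x)"
      by (simp add: integral_diff integral_add integrable integrable_add integrable_diff)
    finally have I: "((\<lambda>s. integral {0..pi} (f s x)) has_real_derivative
         (integral {0..pi} (f s (x + 1)) + integral {0..pi} (f s (x - 1))) / 2 - integral {0..pi} (f s x)) (at s)"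
      by simp
    show ?thesis unfolding F_def
      by (rule DERIV_cong[OF DERIV_cdivide[OF has_field_derivative_at_within[OF I]]]) (simp add: field_simps)
  qed
  have F_0: "F 0 x = (if x = 0 then 1 else 0)" for x
  proof (cases "x = 0")
    case False
    have "((\<lambda>\<theta>. cos (real_of_int x * \<theta>)) has_integral (sin (real_of_int x * pi) / real_of_int x - sin (real_of_int x * 0) / real_of_int x)) {0..pi}"
      by (rule fundamental_theorem_of_calculus)
         (auto intro!: derivative_eq_intros simp: has_real_derivative_iff_has_vector_derivative[symmetric] False)
    moreover have "sin (real_of_int x * pi) = 0" by (simp add: sin_zero_iff_int2)
    moreover have "f 0 x = (\<lambda>\<theta>. cos (real_of_int x * \<theta>))" by (intro ext) (simp add: f_def)
    ultimately show ?thesis using False by (simp add: F_def integral_unique)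
  next
    case True
    have "f 0 0 = (\<lambda>_. 1)" by (intro ext) (simp add: f_def)
    then show ?thesis using True by (simp add: F_def)
  qed
  have "heat s x - F s x = 0"
  proof (rule linear_system_unique[where D = "\<lambda>s x. heat s x - F s x" and T = s and B = 2 and C = 2
        and w = "\<lambda>_. 1" and I = UNIV
        and D' = "\<lambda>s x. ((heat s (x + 1) + heat s (x - 1)) / 2 - heat s x) - ((F s (x + 1) + F s (x - 1)) / 2 - F s x)"])
    fix r b i assume r: "r \<in> {0..s}"
    show "\<bar>heat r i - F r i\<bar> \<le> 2 * 1"
      using heat_nonneg[of r i] heat_le_1[of r i] F_bound[of r i] r by simp
    assume "\<And>j. j \<in> UNIV \<Longrightarrow> \<bar>heat r j - F r j\<bar> \<le> b * 1"
    from this[of "i + 1"] this[of "i - 1"] this[of i]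
    show "\<bar>(heat r (i + 1) + heat r (i - 1)) / 2 - heat r i - ((F r (i + 1) + F r (i - 1)) / 2 - F r i)\<bar> \<le> 2 * b * 1"
      by (simp add: abs_le_iff field_simps)
  qed (use assms in \<open>auto intro!: DERIV_diff heat_deriv F_deriv simp: F_0 heat_0\<close>)
  then show ?thesis unfolding F_def f_def by simp
qed

lemma heat_le_heat_origin:
  assumes "0 \<le> s"
  shows "heat s x \<le> heat s 0"
  unfolding heat_fourier[OF assms]
  by (intro divide_right_mono integral_le integrable_continuous_interval continuous_intros)
     (auto intro: mult_left_le_one_le)

text \<open>Since 1 - cos \<theta> = 2 sin(\<theta>/2)^2, it suffices that sin y \<ge> y/2 on
  [0, pi/2]. Up to pi/3 the difference has derivative cos y - 1/2 \<ge> 0; beyond, sin y \<ge> sqrt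
  3 / 2 \<ge> 0.8 while y/2 \<le> pi/4. This supplies the Gaussian majorant for the Laplace
  method.\<close>

lemma one_minus_cos_ge:
  fixes \<theta> :: real
  assumes "0 \<le> \<theta>" "\<theta> \<le> pi"
  shows "\<theta>\<^sup>2 / 8 \<le> 1 - cos \<theta>"
proof -
  define y where "y = \<theta> / 2"
  have y: "0 \<le> y" "y \<le> pi / 2" using assms by (auto simp: y_def)
  have "y / 2 \<le> sin y"
  proof (cases "y \<le> pi / 3")
    case True
    have "(\<lambda>y. sin y - y / 2) 0 \<le> (\<lambda>y. sin y - y / 2) y"
    proof (rule nondecreasing_of_deriv_within[OF y(1)])
      show "((\<lambda>y. sin y - y / 2) has_real_derivative cos z - 1 / 2) (at z within {0..y})" for z
        by (auto intro!: derivative_eq_intros)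
      show "0 \<le> cos z - 1 / 2" if "z \<in> {0<..<y}" for z
        using cos_monotone_0_pi_le[of z "pi / 3"] that True by (auto simp: cos_60)
    qed
    then show ?thesis by simp
  next
    case False
    have "sqrt 3 / 2 \<le> sin y"
      using sin_monotone_2pi_le[of "pi / 3" y] False y by (simp add: sin_60)
    moreover have "y / 2 \<le> 0.8" using y pi_approx by simp
    moreover have "1.6 \<le> sqrt 3" by (rule real_le_rsqrt) (simp add: power2_eq_square)
    ultimately show ?thesis by simp
  qed
  then have "(y / 2)\<^sup>2 \<le> (sin y)\<^sup>2" using y by (intro power_mono) auto
  then show ?thesis using cos_double_sin[of y] by (simp add: y_def power2_eq_square field_simps)
qed

text \<open>Laplace's method: the substitution \<theta> = u / sqrt s in the Fourier integral turns
  the exponent 2s(1 - cos \<theta>) into one converging to u^2, and the half-line Gaussian integral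
  sqrt pi / 2 is divided by pi.\<close>

lemma heat_origin_asymptotics:
  "((\<lambda>s. sqrt s * heat (2 * s) 0) \<longlongrightarrow> 1 / (2 * sqrt pi)) at_top"
proof -
  define h where "h s u = indicator {0..pi} (u / sqrt s) * exp (- 2 * s * (1 - cos (u / sqrt s)))" for s u :: real
  define g where "g u = indicator {0..} u *\<^sub>R exp (- u\<^sup>2)" for u :: real
  have "((\<lambda>s. \<integral>u. h s u \<partial>lborel) \<longlongrightarrow> (\<integral>u. g u \<partial>lborel)) at_top"
  proof (rule integral_dominated_convergence_at_top)
    show "g \<in> borel_measurable lborel" "\<And>s. h s \<in> borel_measurable lborel"
      unfolding g_def h_def by measurable
    show "integrable lborel (\<lambda>u::real. exp (- (u\<^sup>2 / 4)))"
    proof -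
      \<comment> \<open>The majorant is a centred normal density of variance 2 without its
        normalization \<open>1 / sqrt (4 * pi)\<close>.\<close>
      have "integrable lborel (\<lambda>x. (normal_density 0 (sqrt 2) x) * sqrt (4 * pi))"
        by (intro integrable_mult_left integrable_normal_density) simp
      then show ?thesis by (simp add: normal_density_def)
    qed
    show "\<forall>\<^sub>F s in at_top. AE u in lborel. norm (h s u) \<le> exp (- (u\<^sup>2 / 4))"
      using eventually_gt_at_top[of 0]
    proof eventually_elim
      case (elim s)
      have "norm (h s u) \<le> exp (- (u\<^sup>2 / 4))" for u
      proof (cases "u / sqrt s \<in> {0..pi}")
        case True
        have "u\<^sup>2 / 4 = 2 * s * ((u / sqrt s)\<^sup>2 / 8)" using elim by (simp add: power_divide)
        also have "\<dots> \<le> 2 * s * (1 - cos (u / sqrt s))"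
          using one_minus_cos_ge[of "u / sqrt s"] True elim by (intro mult_left_mono) auto
        finally show ?thesis using True by (simp add: h_def)
      qed (simp add: h_def)
      then show ?case by simp
    qed
    show "AE u in lborel. ((\<lambda>s. h s u) \<longlongrightarrow> g u) at_top"
    proof (rule AE_I2)
      fix u :: real
      consider "u < 0" | "u = 0" | "u > 0" by linarith
      then show "((\<lambda>s. h s u) \<longlongrightarrow> g u) at_top"
      proof cases
        case 1
        have "\<forall>\<^sub>F s in at_top. h s u = 0"
          using eventually_gt_at_top[of 0]
          by eventually_elim (use 1 in \<open>auto simp: h_def indicator_def zero_le_divide_iff\<close>)
        then show ?thesis using 1 by (simp add: g_def tendsto_eventually)
      next
        case 2
        then show ?thesis by (simp add: g_def h_def)
      next
        case 3
        have "((\<lambda>s. exp (- 2 * s * (1 - cos (u / sqrt s)))) \<longlongrightarrow> exp (- u\<^sup>2)) at_top"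
          using 3 by (intro tendsto_intros) (real_asymp simp: power2_eq_square)
        moreover have "\<forall>\<^sub>F s in at_top. u / sqrt s \<le> pi"
        proof -
          have "((\<lambda>s. u / sqrt s) \<longlongrightarrow> 0) at_top" by real_asymp
          then have "\<forall>\<^sub>F s in at_top. u / sqrt s < pi" by (rule order_tendstoD) simp
          then show ?thesis by eventually_elim simp
        qed
        then have "\<forall>\<^sub>F s in at_top. h s u = exp (- 2 * s * (1 - cos (u / sqrt s)))"
          using eventually_gt_at_top[of 0] by eventually_elim (use 3 in \<open>auto simp: h_def\<close>)
        ultimately show ?thesis using 3 by (simp add: g_def tendsto_cong)
      qed
    qed
  qed
  moreover have "(\<integral>u. g u \<partial>lborel) = sqrt pi / 2"
    unfolding g_def by (rule has_bochner_integral_integral_eq[OF gaussian_moment_0])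
  ultimately have "((\<lambda>s. \<integral>u. h s u \<partial>lborel) \<longlongrightarrow> sqrt pi / 2) at_top" by (simp only:)
  then have lim: "((\<lambda>s. (\<integral>u. h s u \<partial>lborel) / pi) \<longlongrightarrow> (sqrt pi / 2) / pi) at_top"
    by (intro tendsto_intros) auto
  have "sqrt s * heat (2 * s) 0 = (\<integral>u. h s u \<partial>lborel) / pi" if "0 < s" for s
  proof -
    let ?f = "\<lambda>\<theta>. exp (- (2 * s) * (1 - cos \<theta>))"
    have "integral {0..pi} ?f = (LINT \<theta>:{0..pi}|lborel. ?f \<theta>)"
      by (intro set_borel_integral_eq_integral(2)[symmetric] borel_integrable_compact[unfolded set_integrable_def[symmetric]] )
         (auto intro!: continuous_intros)
    also have "\<dots> = \<bar>1 / sqrt s\<bar> *\<^sub>R (\<integral>u. indicator {0..pi} (0 + 1 / sqrt s * u) *\<^sub>R ?f (0 + 1 / sqrt s * u) \<partial>lborel)"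
      unfolding set_lebesgue_integral_def using that by (intro lborel_integral_real_affine) auto
    also have "\<dots> = (\<integral>u. h s u \<partial>lborel) / sqrt s" using that by (simp add: h_def)
    finally show ?thesis using that by (simp add: heat_fourier)
  qed
  then have "\<forall>\<^sub>F s in at_top. (\<integral>u. h s u \<partial>lborel) / pi = sqrt s * heat (2 * s) 0"
    by (intro eventually_mono[OF eventually_gt_at_top[of 0]]) simp
  moreover have "(sqrt pi / 2) / pi = 1 / (2 * sqrt pi)" by (simp add: field_simps)
  ultimately show ?thesis using lim by (simp add: tendsto_cong)
qed

lemma heat_continuous: "continuous_on S (\<lambda>s. heat s x)"
  by (rule DERIV_continuous_on[OF heat_deriv])

text \<open>The maximum over sites is at the origin; there large times are covered by the
  asymptotics and small times by the trivial bound 1.\<close>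

lemma heat_le_inverse_sqrt: "\<exists>C\<ge>0. \<forall>s>0. \<forall>x. heat s x \<le> C / sqrt s"
proof -
  have "\<forall>\<^sub>F s in at_top. sqrt s * heat (2 * s) 0 < 1 / (2 * sqrt pi) + 1"
    by (rule order_tendstoD[OF heat_origin_asymptotics]) simp
  then obtain S where S: "\<And>s. s \<ge> S \<Longrightarrow> sqrt s * heat (2 * s) 0 < 1 / (2 * sqrt pi) + 1"
    by (auto simp: eventually_at_top_linorder)
  \<comment> \<open>The factor \<open>sqrt 2\<close> undoes the time change from \<open>s\<close> to
    \<open>s / 2\<close>; the term \<open>sqrt \<bar>S\<bar>\<close> covers
    \<open>s / 2 < S\<close>, where only \<open>heat \<le> 1\<close> is used.\<close>
  define C where "C = sqrt 2 * (1 / (2 * sqrt pi) + 1 + sqrt \<bar>S\<bar>)"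
  have "heat s x \<le> C / sqrt s" if s: "s > 0" for s x
  proof -
    have "sqrt (s / 2) * heat (2 * (s / 2)) 0 \<le> 1 / (2 * sqrt pi) + 1 + sqrt \<bar>S\<bar>"
    proof (cases "S \<le> s / 2")
      case True
      then show ?thesis using S[OF True] real_sqrt_ge_zero[of "\<bar>S\<bar>"] by linarith
    next
      case False
      have "sqrt (s / 2) * heat (2 * (s / 2)) 0 \<le> sqrt \<bar>S\<bar> * 1"
        using s False heat_le_1[of s 0] by (intro mult_mono) (auto simp: heat_nonneg)
      also have "\<dots> \<le> 1 / (2 * sqrt pi) + 1 + sqrt \<bar>S\<bar>" by simp
      finally show ?thesis .
    qed
    then have "sqrt s * heat s 0 \<le> C" by (simp add: C_def real_sqrt_divide field_simps)
    then have "heat s 0 \<le> C / sqrt s" using s by (simp add: field_simps)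
    then show ?thesis using heat_le_heat_origin[of s x] s by linarith
  qed
  moreover have "0 \<le> C" by (simp add: C_def)
  ultimately show ?thesis by blast
qed

definition heat_integral :: "real \<Rightarrow> real" where
  "heat_integral t = integral {0..t} (\<lambda>s. heat (2 * s) 0)"

lemma heat_integral_deriv:
  assumes "s \<in> {0..T}"
  shows "(heat_integral has_real_derivative heat (2 * s) 0) (at s within {0..T})"
  unfolding heat_integral_def
  by (rule integral_has_real_derivative[OF _ assms])
     (intro continuous_on_compose2[OF heat_continuous[of UNIV]] continuous_intros, auto)

text \<open>L'Hospital: the quotient of the derivatives is
  \<open>2 * sqrt t * heat (2 * t) 0\<close>, whose limit is twice
  \<open>1 / (2 * sqrt pi)\<close>.\<close>

lemma heat_integral_asymptotics: "((\<lambda>t. heat_integral t / sqrt t) \<longlongrightarrow> 1 / sqrt pi) at_top"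
proof (rule lhospital_at_top_at_top)
  show "LIM t at_top. sqrt t :> at_top" by real_asymp
  show "\<forall>\<^sub>F t in at_top. (sqrt has_real_derivative inverse (sqrt t) / 2) (at t)"
    using eventually_gt_at_top[of 0] by eventually_elim (auto intro!: derivative_eq_intros)
  show "\<forall>\<^sub>F t in at_top. inverse (sqrt t) / 2 \<noteq> 0"
    using eventually_gt_at_top[of 0] by eventually_elim simp
  show "\<forall>\<^sub>F t in at_top. (heat_integral has_real_derivative heat (2 * t) 0) (at t)"
    using eventually_gt_at_top[of 0]
  proof eventually_elim
    case (elim t)
    then show ?case using heat_integral_deriv[of t "t + 1"] by (simp add: at_within_Icc_at)
  qed
  have "((\<lambda>t. 2 * (sqrt t * heat (2 * t) 0)) \<longlongrightarrow> 2 * (1 / (2 * sqrt pi))) at_top"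
    by (intro tendsto_intros heat_origin_asymptotics)
  then show "((\<lambda>t. heat (2 * t) 0 / (inverse (sqrt t) / 2)) \<longlongrightarrow> 1 / sqrt pi) at_top"
    by (simp add: field_simps)
qed

section \<open>Configurations and bounded local functions\<close>

lemma space_X0_space: "space X0_space = X0"
  by (simp add: X0_space_def space_restrict_space space_PiM)

lemma flat_config_X0: "flat_config \<in> X0"
proof -
  have "\<bar>x mod 2 - (x + 1) mod 2\<bar> = 1" for x :: int by presburger
  then show ?thesis by (simp add: X0_def flat_config_def)
qed

lemma X0_step: "\<zeta> \<in> X0 \<Longrightarrow> \<bar>\<zeta> x - \<zeta> (x + 1)\<bar> = 1"
  by (simp add: X0_def)

lemma X0_laplacian: "\<zeta> \<in> X0 \<Longrightarrow> laplacian \<zeta> x \<in> {-2, 0, 2}"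
  using X0_step[of \<zeta> x] X0_step[of \<zeta> "x - 1"] by (auto simp: laplacian_def)

text \<open>The update exchanges the two increments adjacent to the site, so they stay of modulus 1,
  and it moves the height by -2, 0 or 2, which preserves parity at the origin.\<close>

lemma site_update_X0:
  assumes "\<zeta> \<in> X0"
  shows "site_update \<zeta> x \<in> X0"
proof -
  have "\<bar>site_update \<zeta> x y - site_update \<zeta> x (y + 1)\<bar> = 1" for y
  proof -
    consider "y = x" | "y + 1 = x" | "y \<noteq> x" "y + 1 \<noteq> x" by blast
    then show ?thesis
      using X0_step[OF assms, of y] X0_step[OF assms, of "y + 1"] X0_step[OF assms, of "y - 1"]
      by cases (auto simp: site_update_def laplacian_def)
  qed
  moreover have "even (site_update \<zeta> x 0)"
    using X0_laplacian[OF assms, of x] assms by (auto simp: site_update_def X0_def)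
  ultimately show ?thesis by (simp add: X0_def)
qed

lemma X0_height_le:
  assumes "\<zeta> \<in> X0"
  shows "\<bar>\<zeta> x\<bar> \<le> \<bar>\<zeta> 0\<bar> + \<bar>x\<bar>"
proof -
  have "\<bar>\<zeta> (int n)\<bar> \<le> \<bar>\<zeta> 0\<bar> + int n \<and> \<bar>\<zeta> (- int n)\<bar> \<le> \<bar>\<zeta> 0\<bar> + int n" for n
  proof (induction n)
    case (Suc n)
    have "int (Suc n) = int n + 1" "- int (Suc n) = - int n - 1" by auto
    moreover have "\<bar>\<zeta> (int n) - \<zeta> (int n + 1)\<bar> = 1" "\<bar>\<zeta> (- int n - 1) - \<zeta> (- int n)\<bar> = 1"
      using X0_step[OF assms, of "int n"] X0_step[OF assms, of "- int n - 1"] by auto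
    ultimately show ?case using Suc by (simp only:) linarith
  qed simp
  from this[of "nat \<bar>x\<bar>"] show ?thesis by (cases "0 \<le> x") simp_all
qed

lemma site_update_height_le:
  assumes "\<zeta> \<in> X0"
  shows "\<bar>site_update \<zeta> y x\<bar> \<le> \<bar>\<zeta> x\<bar> + 2"
  using X0_laplacian[OF assms, of y] by (auto simp: site_update_def)

text \<open>Locality is separated from the boundedness in \<open>bounded_local\<close> and carries
  its support explicitly: unbounded local functions are needed later, and the support decides which
  terms of the generator survive.\<close>

definition local_on :: "int set \<Rightarrow> (config \<Rightarrow> real) \<Rightarrow> bool" where
  "local_on A f \<longleftrightarrow> (\<forall>\<zeta>\<in>X0. \<forall>\<xi>\<in>X0. (\<forall>x\<in>A. \<zeta> x = \<xi> x) \<longrightarrow> f \<zeta> = f \<xi>)"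

lemma local_onD: "local_on A f \<Longrightarrow> \<zeta> \<in> X0 \<Longrightarrow> \<xi> \<in> X0 \<Longrightarrow> (\<And>x. x \<in> A \<Longrightarrow> \<zeta> x = \<xi> x) \<Longrightarrow> f \<zeta> = f \<xi>"
  unfolding local_on_def by blast

lemma local_on_mono: "local_on A f \<Longrightarrow> A \<subseteq> B \<Longrightarrow> local_on B f"
  unfolding local_on_def by blast

text \<open>On \<open>X0\<close> such a function factors through the restriction to the finite set
  \<open>A\<close>. A finite product of countable discrete spaces is discrete, so every function of
  the restriction is measurable; \<open>F\<close> is obtained by choosing a representative in
  \<open>X0\<close>.\<close>

lemma local_on_measurable:
  assumes "finite A" "local_on A f"
  shows "f \<in> borel_measurable X0_space"
proof -
  define F where "F g = f (SOME \<zeta>. \<zeta> \<in> X0 \<and> (\<forall>x\<in>A. \<zeta> x = g x))" for g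
  have eq: "f \<zeta> = F (restrict \<zeta> A)" if "\<zeta> \<in> X0" for \<zeta>
  proof -
    have "(SOME \<xi>. \<xi> \<in> X0 \<and> (\<forall>x\<in>A. \<xi> x = restrict \<zeta> A x)) \<in> X0 \<and>
        (\<forall>x\<in>A. (SOME \<xi>. \<xi> \<in> X0 \<and> (\<forall>x\<in>A. \<xi> x = restrict \<zeta> A x)) x = restrict \<zeta> A x)"
      by (rule someI[of _ \<zeta>]) (use that in auto)
    then show ?thesis unfolding F_def using that by (intro local_onD[OF assms(2)]) auto
  qed
  have "(\<lambda>\<zeta>. restrict \<zeta> A) \<in> measurable X0_space (\<Pi>\<^sub>M x\<in>A. count_space (UNIV :: int set))"
    unfolding X0_space_def by (intro measurable_restrict_space1 measurable_restrict_subset) auto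
  then have "(\<lambda>\<zeta>. restrict \<zeta> A) \<in> measurable X0_space (count_space (PiE A (\<lambda>_. UNIV :: int set)))"
    using assms(1) by (simp add: count_space_PiM_finite)
  then have "(\<lambda>\<zeta>. F (restrict \<zeta> A)) \<in> borel_measurable X0_space"
    by (rule measurable_compose) simp
  then show ?thesis
    by (subst measurable_cong[where g = "\<lambda>\<zeta>. F (restrict \<zeta> A)"]) (auto simp: space_X0_space eq)
qed

lemma site_update_outside:
  assumes "local_on A f" "\<zeta> \<in> X0" "x \<notin> A"
  shows "f (site_update \<zeta> x) = f \<zeta>"
  by (rule local_onD[OF assms(1) site_update_X0[OF assms(2)] assms(2)]) (use assms in \<open>auto simp: site_update_def\<close>)

lemma free_generator_local:
  assumes "finite A" "local_on A f" "\<zeta> \<in> X0"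
  shows "free_generator f \<zeta> = (\<Sum>x\<in>A. f (site_update \<zeta> x) - f \<zeta>) / 2"
proof -
  have "(\<Sum>\<^sub>\<infinity>x. f (site_update \<zeta> x) - f \<zeta>) = (\<Sum>\<^sub>\<infinity>x\<in>A. f (site_update \<zeta> x) - f \<zeta>)"
    by (rule infsum_cong_neutral) (use site_update_outside[OF assms(2,3)] in auto)
  then show ?thesis using assms(1) by (simp add: free_generator_def)
qed

lemma local_on_free_generator:
  assumes "finite A" "local_on A f"
  shows "local_on (\<Union>x\<in>A. {x - 1, x, x + 1}) (free_generator f)"
  unfolding local_on_def
proof (intro ballI impI)
  fix \<zeta> \<xi> assume X0: "\<zeta> \<in> X0" "\<xi> \<in> X0" and eq: "\<forall>x\<in>\<Union>x\<in>A. {x - 1, x, x + 1}. \<zeta> x = \<xi> x"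
  have "f (site_update \<zeta> x) = f (site_update \<xi> x)" if "x \<in> A" for x
    by (rule local_onD[OF assms(2) site_update_X0[OF X0(1)] site_update_X0[OF X0(2)]])
      (use eq that in \<open>auto simp: site_update_def laplacian_def\<close>)
  moreover have "f \<zeta> = f \<xi>" by (rule local_onD[OF assms(2)]) (use X0 eq in auto)
  ultimately show "free_generator f \<zeta> = free_generator f \<xi>"
    by (simp add: free_generator_local[OF assms] X0)
qed

lemma bounded_local_iff:
  "bounded_local f \<longleftrightarrow> (\<exists>B. \<forall>\<zeta>\<in>X0. \<bar>f \<zeta>\<bar> \<le> B) \<and> (\<exists>A. finite A \<and> local_on A f)"
  unfolding bounded_local_def local_on_def bounded_iff by auto

lemma bounded_local_measurable: "bounded_local f \<Longrightarrow> f \<in> borel_measurable X0_space"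
  unfolding bounded_local_iff by (blast intro: local_on_measurable)

lemma bounded_local_free_generator:
  assumes "bounded_local f"
  shows "bounded_local (free_generator f)"
proof -
  obtain A B where A: "finite A" "local_on A f" and B: "\<And>\<zeta>. \<zeta> \<in> X0 \<Longrightarrow> \<bar>f \<zeta>\<bar> \<le> B"
    using assms unfolding bounded_local_iff by blast
  have "\<bar>free_generator f \<zeta>\<bar> \<le> (\<Sum>x\<in>A. 2 * B)" if "\<zeta> \<in> X0" for \<zeta>
  proof -
    have "\<bar>f (site_update \<zeta> x) - f \<zeta>\<bar> \<le> 2 * B" for x
      using B[OF that] B[OF site_update_X0[OF that, of x]] by linarith
    then have "\<bar>\<Sum>x\<in>A. f (site_update \<zeta> x) - f \<zeta>\<bar> \<le> (\<Sum>x\<in>A. 2 * B)"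
      by (intro order.trans[OF sum_abs] sum_mono)
    then show ?thesis unfolding free_generator_local[OF A that] by linarith
  qed
  moreover have "finite (\<Union>x\<in>A. {x - 1, x, x + 1})" using A(1) by auto
  ultimately show ?thesis unfolding bounded_local_iff using local_on_free_generator[OF A] by blast
qed

section \<open>Forward equation for bounded local functions\<close>

locale free_semigroup =
  fixes P :: "real \<Rightarrow> config \<Rightarrow> config measure"
  assumes semigroup: "transition_semigroup X0_space P"
    and generator: "has_free_generator P"
begin

text \<open>Every claim of the theorem concerns one-time marginals from the flat start, so all
  estimates are made for this functional and the path space returns only at the end. As a Bochner
  integral it is 0 for non-integrable functions.\<close>

definition E :: "real \<Rightarrow> (config \<Rightarrow> real) \<Rightarrow> real" where
  "E t f = (\<integral>\<zeta>. f \<zeta> \<partial>P t flat_config)"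

lemma kernel: "0 \<le> t \<Longrightarrow> P t \<in> X0_space \<rightarrow>\<^sub>M prob_algebra X0_space"
  using semigroup by (auto simp: transition_semigroup_def)

lemma kernel_prob: "0 \<le> t \<Longrightarrow> \<zeta> \<in> X0 \<Longrightarrow> prob_space (P t \<zeta>)"
  and kernel_sets: "0 \<le> t \<Longrightarrow> \<zeta> \<in> X0 \<Longrightarrow> sets (P t \<zeta>) = sets X0_space"
  using measurable_space[OF kernel, of t \<zeta>] by (auto simp: space_X0_space space_prob_algebra)

lemma kernel_space: "0 \<le> t \<Longrightarrow> \<zeta> \<in> X0 \<Longrightarrow> space (P t \<zeta>) = X0"
  using sets_eq_imp_space_eq[OF kernel_sets[of t \<zeta>]] by (simp add: space_X0_space)

lemma local_measurable:
  "0 \<le> t \<Longrightarrow> \<zeta> \<in> X0 \<Longrightarrow> finite A \<Longrightarrow> local_on A f \<Longrightarrow> f \<in> borel_measurable (P t \<zeta>)"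
  by (simp add: measurable_cong_sets[OF kernel_sets refl] local_on_measurable)

lemma bounded_local_integrable:
  assumes "0 \<le> t" "\<zeta> \<in> X0" "bounded_local f"
  shows "integrable (P t \<zeta>) f"
proof -
  interpret prob_space "P t \<zeta>" by (rule kernel_prob[OF assms(1,2)])
  obtain A B where "finite A" "local_on A f" and B: "\<And>\<xi>. \<xi> \<in> X0 \<Longrightarrow> \<bar>f \<xi>\<bar> \<le> B"
    using assms(3) unfolding bounded_local_iff by blast
  then show ?thesis
    using kernel_space[OF assms(1,2)] local_measurable[OF assms(1,2)]
    by (intro integrable_const_bound[where B = B] AE_I2) auto
qed

lemma kernel_integral_measurable:
  assumes "0 \<le> t" "bounded_local f"
  shows "(\<lambda>\<zeta>. \<integral>\<xi>. f \<xi> \<partial>P t \<zeta>) \<in> borel_measurable X0_space"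
  by (rule measurable_compose[OF measurable_prob_algebraD[OF kernel[OF assms(1)]]
        integral_measurable_subprob_algebra[OF bounded_local_measurable[OF assms(2)]]])

text \<open>No integrability has to be checked by users of this bound: in the non-integrable case
  the integral is 0, and \<open>B\<close> is nonnegative because \<open>X0\<close> contains
  \<open>\<zeta>\<close>.\<close>

lemma kernel_integral_bound:
  fixes g :: "config \<Rightarrow> real"
  assumes "0 \<le> t" "\<zeta> \<in> X0" "\<And>\<xi>. \<xi> \<in> X0 \<Longrightarrow> \<bar>g \<xi>\<bar> \<le> B"
  shows "\<bar>\<integral>\<xi>. g \<xi> \<partial>P t \<zeta>\<bar> \<le> B"
proof -
  interpret prob_space "P t \<zeta>" by (rule kernel_prob[OF assms(1,2)])
  have "0 \<le> B" using assms(3)[OF assms(2)] abs_ge_zero[of "g \<zeta>"] by linarith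
  show ?thesis
  proof (cases "integrable (P t \<zeta>) g")
    case True
    have "norm (\<integral>\<xi>. g \<xi> \<partial>P t \<zeta>) \<le> (\<integral>\<xi>. norm (g \<xi>) \<partial>P t \<zeta>)" by simp
    also have "\<dots> \<le> (\<integral>\<xi>. B \<partial>P t \<zeta>)"
      using True assms kernel_space[OF assms(1,2)] by (intro integral_mono) auto
    finally show ?thesis by (simp add: prob_space)
  qed (use \<open>0 \<le> B\<close> in \<open>simp add: not_integrable_integral_eq\<close>)
qed

lemma E_semigroup:
  assumes "0 \<le> s" "0 \<le> t" "bounded_local f"
  shows "E (s + t) f = E s (\<lambda>\<zeta>. \<integral>\<xi>. f \<xi> \<partial>P t \<zeta>)"
proof -
  obtain B where B: "\<And>\<zeta>. \<zeta> \<in> X0 \<Longrightarrow> \<bar>f \<zeta>\<bar> \<le> B" using assms by (auto simp: bounded_local_iff)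
  interpret prob_space "P s flat_config" by (rule kernel_prob[OF assms(1) flat_config_X0])
  have "P (s + t) flat_config = P s flat_config \<bind> P t"
    using semigroup assms flat_config_X0 by (auto simp: transition_semigroup_def space_X0_space)
  moreover have "integral\<^sup>L (P s flat_config \<bind> P t) f = (\<integral>\<zeta>. \<integral>\<xi>. f \<xi> \<partial>P t \<zeta> \<partial>P s flat_config)"
  proof (rule integral_bind[where K = X0_space and B' = 1 and B = B])
    show "f \<in> borel_measurable X0_space" by (rule bounded_local_measurable[OF assms(3)])
    show "P t \<in> measurable (P s flat_config) (subprob_algebra X0_space)"
      using measurable_prob_algebraD[OF kernel[OF assms(2)]] kernel_sets[OF assms(1) flat_config_X0]
      by (simp cong: measurable_cong_sets)
    show "AE x in P s flat_config. emeasure (P t x) (space (P t x)) \<le> ennreal 1"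
    proof (rule AE_I2)
      fix x assume "x \<in> space (P s flat_config)"
      then have "prob_space (P t x)"
        using kernel_space[OF assms(1) flat_config_X0] kernel_prob[OF assms(2)] by simp
      then show "emeasure (P t x) (space (P t x)) \<le> ennreal 1" by (simp add: prob_space.emeasure_space_1)
    qed
    show "\<bar>f x\<bar> \<le> B" if "x \<in> space X0_space" for x
      using that B by (simp add: space_X0_space)
    show "finite_measure (P s flat_config)" by unfold_locales
  qed
  ultimately show ?thesis by (simp add: E_def)
qed

text \<open>The convergence defining the generator is uniform over \<open>X0\<close>, so integrating
  it against the law at time \<open>t\<close> gives a step size \<open>d\<close> that does not
  depend on \<open>t\<close>. This uniformity is what makes left difference quotients
  accessible.\<close>

lemma E_difference_quotient:
  assumes "bounded_local f" "0 < e"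
  obtains d where "0 < d"
    "\<And>t h. 0 \<le> t \<Longrightarrow> 0 < h \<Longrightarrow> h < d \<Longrightarrow> \<bar>(E (t + h) f - E t f) / h - E t (free_generator f)\<bar> \<le> e"
proof -
  have "\<forall>\<^sub>F h in at_right 0. \<forall>\<zeta>\<in>X0. dist (((\<integral>\<xi>. f \<xi> \<partial>P h \<zeta>) - f \<zeta>) / h) (free_generator f \<zeta>) < e"
    using generator assms unfolding has_free_generator_def uniform_limit_iff by blast
  then obtain d where d: "0 < d" and *: "\<And>h \<zeta>. 0 < h \<Longrightarrow> h < d \<Longrightarrow> \<zeta> \<in> X0 \<Longrightarrow>
      \<bar>((\<integral>\<xi>. f \<xi> \<partial>P h \<zeta>) - f \<zeta>) / h - free_generator f \<zeta>\<bar> < e"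
    by (auto simp: eventually_at_right_field dist_real_def)
  have "\<bar>(E (t + h) f - E t f) / h - E t (free_generator f)\<bar> \<le> e" if th: "0 \<le> t" "0 < h" "h < d" for t h
  proof -
    interpret prob_space "P t flat_config" by (rule kernel_prob[OF th(1) flat_config_X0])
    obtain B where B: "\<And>\<zeta>. \<zeta> \<in> X0 \<Longrightarrow> \<bar>f \<zeta>\<bar> \<le> B" using assms by (auto simp: bounded_local_iff)
    have int1: "integrable (P t flat_config) (\<lambda>\<zeta>. \<integral>\<xi>. f \<xi> \<partial>P h \<zeta>)"
    proof (rule integrable_const_bound[where B = B])
      show "(\<lambda>\<zeta>. \<integral>\<xi>. f \<xi> \<partial>P h \<zeta>) \<in> borel_measurable (P t flat_config)"
        using kernel_integral_measurable[of h f] assms th kernel_sets[OF th(1) flat_config_X0]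
        by (simp cong: measurable_cong_sets)
      have "\<bar>\<integral>\<xi>. f \<xi> \<partial>P h \<zeta>\<bar> \<le> B" if "\<zeta> \<in> X0" for \<zeta>
        by (rule kernel_integral_bound[OF less_imp_le[OF th(2)] that B])
      then show "AE \<zeta> in P t flat_config. norm (\<integral>\<xi>. f \<xi> \<partial>P h \<zeta>) \<le> B"
        using kernel_space[OF th(1) flat_config_X0] by (intro AE_I2) simp
    qed
    note int = int1 bounded_local_integrable[OF th(1) flat_config_X0 assms(1)]
      bounded_local_integrable[OF th(1) flat_config_X0 bounded_local_free_generator[OF assms(1)]]
    have "(E (t + h) f - E t f) / h - E t (free_generator f) =
        E t (\<lambda>\<zeta>. ((\<integral>\<xi>. f \<xi> \<partial>P h \<zeta>) - f \<zeta>) / h - free_generator f \<zeta>)"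
      using th int by (subst E_semigroup) (auto simp: assms E_def)
    also have "\<bar>\<dots>\<bar> \<le> e"
      unfolding E_def by (rule kernel_integral_bound[OF th(1) flat_config_X0]) (use * th in \<open>auto intro: less_imp_le\<close>)
    finally show ?thesis .
  qed
  then show thesis by (rule that[OF d])
qed

text \<open>A left quotient at \<open>t\<close> is a right quotient at an earlier time
  \<open>s\<close>, hence close to \<open>E s (free_generator f)\<close>. This lemma, applied to the
  again bounded local \<open>free_generator f\<close>, moves that value from \<open>s\<close> to
  \<open>t\<close>.\<close>

lemma E_bounded_lipschitz:
  assumes "bounded_local f"
  obtains d C where "0 < d" "0 \<le> C"
    "\<And>s t. 0 \<le> s \<Longrightarrow> 0 \<le> t \<Longrightarrow> \<bar>s - t\<bar> < d \<Longrightarrow> \<bar>E s f - E t f\<bar> \<le> C * \<bar>s - t\<bar>"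
proof -
  obtain d where d: "0 < d" "\<And>t h. 0 \<le> t \<Longrightarrow> 0 < h \<Longrightarrow> h < d \<Longrightarrow>
      \<bar>(E (t + h) f - E t f) / h - E t (free_generator f)\<bar> \<le> 1"
    using E_difference_quotient[OF assms, of 1] by auto
  obtain B where B: "\<And>\<zeta>. \<zeta> \<in> X0 \<Longrightarrow> \<bar>free_generator f \<zeta>\<bar> \<le> B"
    using bounded_local_free_generator[OF assms] by (auto simp: bounded_local_iff)
  have B0: "0 \<le> B" using B[OF flat_config_X0] by linarith
  have step: "\<bar>E (t + h) f - E t f\<bar> \<le> (1 + B) * h" if "0 \<le> t" "0 < h" "h < d" for t h
  proof -
    have "\<bar>E t (free_generator f)\<bar> \<le> B"
      unfolding E_def by (rule kernel_integral_bound[OF that(1) flat_config_X0 B])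
    then have "\<bar>(E (t + h) f - E t f) / h\<bar> \<le> 1 + B" using d(2)[OF that] by linarith
    then show ?thesis using that by (simp add: abs_divide divide_le_eq)
  qed
  show thesis
  proof (rule that[of d "1 + B"])
    have ordered: "\<bar>E s f - E t f\<bar> \<le> (1 + B) * \<bar>s - t\<bar>" if st: "0 \<le> t" "t < s" "\<bar>s - t\<bar> < d" for s t
    proof -
      have "\<bar>E (t + (s - t)) f - E t f\<bar> \<le> (1 + B) * (s - t)" by (rule step) (use st in auto)
      then show ?thesis using st by simp
    qed
    show "\<bar>E s f - E t f\<bar> \<le> (1 + B) * \<bar>s - t\<bar>" if st: "0 \<le> s" "0 \<le> t" "\<bar>s - t\<bar> < d" for s t
    proof (cases s t rule: linorder_cases)
      case less
      have "\<bar>E t f - E s f\<bar> \<le> (1 + B) * \<bar>t - s\<bar>" by (rule ordered) (use less st in auto)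
      then show ?thesis unfolding abs_minus_commute[of s t] abs_minus_commute[of "E s f"] .
    next
      case equal
      then show ?thesis by simp
    next
      case greater
      then show ?thesis by (intro ordered) (use st in auto)
    qed
  qed (use d(1) B0 in simp_all)
qed

lemma E_deriv_bounded_local:
  assumes "bounded_local f" "0 \<le> t"
  shows "((\<lambda>t. E t f) has_real_derivative E t (free_generator f)) (at t within {0..})"
  unfolding has_field_derivative_iff
proof (rule tendstoI)
  fix e :: real assume "0 < e"
  then obtain d1 where d1: "0 < d1" "\<And>t h. 0 \<le> t \<Longrightarrow> 0 < h \<Longrightarrow> h < d1 \<Longrightarrow>
      \<bar>(E (t + h) f - E t f) / h - E t (free_generator f)\<bar> \<le> e / 3"
    using E_difference_quotient[OF assms(1), of "e / 3"] by auto
  obtain d2 C where d2: "0 < d2" "0 \<le> C" "\<And>s t. 0 \<le> s \<Longrightarrow> 0 \<le> t \<Longrightarrow> \<bar>s - t\<bar> < d2 \<Longrightarrow>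
      \<bar>E s (free_generator f) - E t (free_generator f)\<bar> \<le> C * \<bar>s - t\<bar>"
    using E_bounded_lipschitz[OF bounded_local_free_generator[OF assms(1)]] by metis
  \<comment> \<open>The last entry keeps the Lipschitz error below \<open>e / 3\<close>;
    \<open>C + 1\<close> instead of \<open>C\<close> avoids division by zero.\<close>
  define d where "d = min (min d1 d2) (e / (3 * (C + 1)))"
  have "0 < d" using d1 d2 \<open>0 < e\<close> by (simp add: d_def)
  moreover have "\<bar>(E s f - E t f) / (s - t) - E t (free_generator f)\<bar> < e"
    if s: "0 \<le> s" "s \<noteq> t" "\<bar>s - t\<bar> < d" for s
  proof (cases "t < s")
    case True
    then show ?thesis using d1(2)[of t "s - t"] assms s \<open>0 < e\<close> by (auto simp: d_def)
  next
    \<comment> \<open>To the left of \<open>t\<close> the quotient is based at \<open>s\<close>; two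
      errors of \<open>e / 3\<close> each arise, one from the quotient and one from moving the
      generator term to \<open>t\<close>.\<close>
    case False
    then have "\<bar>(E t f - E s f) / (t - s) - E s (free_generator f)\<bar> \<le> e / 3"
      using d1(2)[of s "t - s"] s by (auto simp: d_def)
    moreover have "(E t f - E s f) / (t - s) = (E s f - E t f) / (s - t)"
      using s(2) by (simp add: field_simps)
    moreover have "\<bar>E s (free_generator f) - E t (free_generator f)\<bar> \<le> C * \<bar>s - t\<bar>"
      using d2(3)[of s t] s assms by (simp add: d_def)
    moreover have "C * \<bar>s - t\<bar> \<le> e / 3"
    proof -
      have "C * \<bar>s - t\<bar> \<le> (C + 1) * (e / (3 * (C + 1)))"
        using s(3) d2(2) \<open>0 < e\<close> by (intro mult_mono) (auto simp: d_def)
      also have "\<dots> = e / 3" using d2(2) by (simp add: field_simps)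
      finally show ?thesis .
    qed
    ultimately show ?thesis using \<open>0 < e\<close> by linarith
  qed
  ultimately show "\<forall>\<^sub>F s in at t within {0..}. dist ((E s f - E t f) / (s - t)) (E t (free_generator f)) < e"
    unfolding eventually_at dist_real_def by (intro exI[of _ d]) auto
qed

end

section \<open>Local functions of exponential growth\<close>

lemma exp_update_le:
  assumes "\<zeta> \<in> X0" "0 \<le> a"
  shows "exp (a * \<bar>real_of_int (site_update \<zeta> y x)\<bar>) \<le> exp (2 * a) * exp (a * \<bar>real_of_int (\<zeta> x)\<bar>)"
proof -
  have "\<bar>real_of_int (site_update \<zeta> y x)\<bar> \<le> 2 + \<bar>real_of_int (\<zeta> x)\<bar>"
    using site_update_height_le[OF assms(1), of y x] by linarith
  then have "a * \<bar>real_of_int (site_update \<zeta> y x)\<bar> \<le> a * (2 + \<bar>real_of_int (\<zeta> x)\<bar>)"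
    using assms(2) by (rule mult_left_mono)
  then show ?thesis by (simp add: exp_add[symmetric] algebra_simps)
qed

lemma free_generator_diff:
  assumes "finite A" "local_on A f" "local_on A g" "\<zeta> \<in> X0"
  shows "free_generator (\<lambda>\<zeta>. f \<zeta> - g \<zeta>) \<zeta> = free_generator f \<zeta> - free_generator g \<zeta>"
proof -
  have "local_on A (\<lambda>\<zeta>. f \<zeta> - g \<zeta>)"
    using assms(2,3) unfolding local_on_def by metis
  then show ?thesis
    using assms by (simp add: free_generator_local[of A] sum_subtractf[symmetric] diff_divide_distrib[symmetric] algebra_simps)
qed

lemma free_generator_growth:
  assumes "finite A" "local_on A f" "0 \<le> a"
    and f: "\<And>\<xi>. \<xi> \<in> X0 \<Longrightarrow> \<bar>f \<xi>\<bar> \<le> b * exp (a * \<bar>real_of_int (\<xi> 0)\<bar>)"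
    and "\<zeta> \<in> X0"
  shows "\<bar>free_generator f \<zeta>\<bar> \<le> real (card A) * b * exp (2 * a) * exp (a * \<bar>real_of_int (\<zeta> 0)\<bar>)"
proof -
  let ?e = "exp (a * \<bar>real_of_int (\<zeta> 0)\<bar>)"
  have "0 \<le> b * ?e" using f[OF assms(5)] by linarith
  then have b: "0 \<le> b" by (simp add: zero_le_mult_iff)
  have "\<bar>f (site_update \<zeta> x) - f \<zeta>\<bar> \<le> 2 * (b * exp (2 * a) * ?e)" for x
  proof -
    have "\<bar>f (site_update \<zeta> x)\<bar> \<le> b * (exp (2 * a) * ?e)"
      using f[OF site_update_X0[OF assms(5), of x]] mult_left_mono[OF exp_update_le[OF assms(5,3), of x 0], of b] b
      by linarith
    moreover have "\<bar>f \<zeta>\<bar> \<le> b * (exp (2 * a) * ?e)"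
    proof -
      have "1 * ?e \<le> exp (2 * a) * ?e" using assms(3) by (intro mult_right_mono) auto
      then have "b * ?e \<le> b * (exp (2 * a) * ?e)" using b by (intro mult_left_mono) auto
      then show ?thesis using f[OF assms(5)] by linarith
    qed
    ultimately show ?thesis by (simp add: mult.assoc)
  qed
  then have "\<bar>\<Sum>x\<in>A. f (site_update \<zeta> x) - f \<zeta>\<bar> \<le> (\<Sum>x\<in>A. 2 * (b * exp (2 * a) * ?e))"
    by (intro order.trans[OF sum_abs] sum_mono)
  then show ?thesis unfolding free_generator_local[OF assms(1,2,5)] by (simp add: mult.assoc)
qed

text \<open>Growth is measured at the origin alone, since on \<open>X0\<close> the height at another
  site differs by at most the distance. One constant serves as factor and as rate to save a
  quantifier; \<open>tameI\<close> allows them to differ. The class is an algebra stable under the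
  generator.\<close>

definition tame :: "(config \<Rightarrow> real) \<Rightarrow> bool" where
  "tame f \<longleftrightarrow> (\<exists>A. finite A \<and> local_on A f) \<and>
     (\<exists>c\<ge>0. \<forall>\<zeta>\<in>X0. \<bar>f \<zeta>\<bar> \<le> c * exp (c * \<bar>real_of_int (\<zeta> 0)\<bar>))"

lemma tameI:
  assumes "finite A" "local_on A f" "\<And>\<zeta>. \<zeta> \<in> X0 \<Longrightarrow> \<bar>f \<zeta>\<bar> \<le> b * exp (a * \<bar>real_of_int (\<zeta> 0)\<bar>)"
  shows "tame f"
proof -
  have "\<bar>f \<zeta>\<bar> \<le> (max 0 (max a b)) * exp (max 0 (max a b) * \<bar>real_of_int (\<zeta> 0)\<bar>)" if "\<zeta> \<in> X0" for \<zeta>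
    by (rule order.trans[OF assms(3)[OF that]]) (auto intro!: mult_mono mult_right_mono)
  then show ?thesis unfolding tame_def using assms(1,2) by (metis max.cobounded1)
qed

lemma local_on_binop:
  assumes "local_on A f" "local_on B g"
  shows "local_on (A \<union> B) (\<lambda>\<zeta>. h (f \<zeta>) (g \<zeta>))"
  using assms unfolding local_on_def by (metis UnCI)

lemma tame_const: "tame (\<lambda>_. k)"
  by (rule tameI[of "{}" _ "\<bar>k\<bar>" 0]) (auto simp: local_on_def)

lemma tame_height: "tame (\<lambda>\<zeta>. real_of_int (\<zeta> x))"
proof (rule tameI[of "{x}" _ "1 + \<bar>real_of_int x\<bar>" 1])
  fix \<zeta> assume "\<zeta> \<in> X0"
  then have "\<bar>real_of_int (\<zeta> x)\<bar> \<le> \<bar>real_of_int (\<zeta> 0)\<bar> + \<bar>real_of_int x\<bar>"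
    using X0_height_le[of \<zeta> x] by linarith
  also have "\<dots> \<le> (1 + \<bar>real_of_int x\<bar>) * (1 + \<bar>real_of_int (\<zeta> 0)\<bar>)" by (simp add: algebra_simps)
  also have "\<dots> \<le> (1 + \<bar>real_of_int x\<bar>) * exp (1 * \<bar>real_of_int (\<zeta> 0)\<bar>)"
    by (intro mult_left_mono) (auto simp: exp_ge_add_one_self)
  finally show "\<bar>real_of_int (\<zeta> x)\<bar> \<le> (1 + \<bar>real_of_int x\<bar>) * exp (1 * \<bar>real_of_int (\<zeta> 0)\<bar>)" .
qed (auto simp: local_on_def)

lemma tame_add:
  assumes "tame f" "tame g"
  shows "tame (\<lambda>\<zeta>. f \<zeta> + g \<zeta>)"
proof -
  obtain A c where f: "finite A" "local_on A f" "0 \<le> c" "\<And>\<zeta>. \<zeta> \<in> X0 \<Longrightarrow> \<bar>f \<zeta>\<bar> \<le> c * exp (c * \<bar>real_of_int (\<zeta> 0)\<bar>)"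
    using assms(1) unfolding tame_def by blast
  obtain B d where g: "finite B" "local_on B g" "0 \<le> d" "\<And>\<zeta>. \<zeta> \<in> X0 \<Longrightarrow> \<bar>g \<zeta>\<bar> \<le> d * exp (d * \<bar>real_of_int (\<zeta> 0)\<bar>)"
    using assms(2) unfolding tame_def by blast
  show ?thesis
  proof (rule tameI[of "A \<union> B" _ "c + d" "c + d"])
    fix \<zeta> assume z: "\<zeta> \<in> X0"
    let ?h = "\<bar>real_of_int (\<zeta> 0)\<bar>"
    have "c * exp (c * ?h) \<le> c * exp ((c + d) * ?h)" "d * exp (d * ?h) \<le> d * exp ((c + d) * ?h)"
      using f(3) g(3) by (auto intro!: mult_left_mono mult_right_mono)
    then show "\<bar>f \<zeta> + g \<zeta>\<bar> \<le> (c + d) * exp ((c + d) * ?h)"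
      using f(4)[OF z] g(4)[OF z] abs_triangle_ineq[of "f \<zeta>" "g \<zeta>"] unfolding distrib_right[of c d "exp _"] by linarith
  qed (use f(1) g(1) local_on_binop[OF f(2) g(2)] in auto)
qed

lemma tame_mult:
  assumes "tame f" "tame g"
  shows "tame (\<lambda>\<zeta>. f \<zeta> * g \<zeta>)"
proof -
  obtain A c where f: "finite A" "local_on A f" "0 \<le> c" "\<And>\<zeta>. \<zeta> \<in> X0 \<Longrightarrow> \<bar>f \<zeta>\<bar> \<le> c * exp (c * \<bar>real_of_int (\<zeta> 0)\<bar>)"
    using assms(1) unfolding tame_def by blast
  obtain B d where g: "finite B" "local_on B g" "0 \<le> d" "\<And>\<zeta>. \<zeta> \<in> X0 \<Longrightarrow> \<bar>g \<zeta>\<bar> \<le> d * exp (d * \<bar>real_of_int (\<zeta> 0)\<bar>)"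
    using assms(2) unfolding tame_def by blast
  show ?thesis
  proof (rule tameI[of "A \<union> B" _ "c * d" "c + d"])
    fix \<zeta> assume z: "\<zeta> \<in> X0"
    let ?h = "\<bar>real_of_int (\<zeta> 0)\<bar>"
    have "\<bar>f \<zeta>\<bar> * \<bar>g \<zeta>\<bar> \<le> (c * exp (c * ?h)) * (d * exp (d * ?h))"
      using f(4)[OF z] g(4)[OF z] f(3) by (intro mult_mono) auto
    then show "\<bar>f \<zeta> * g \<zeta>\<bar> \<le> c * d * exp ((c + d) * ?h)"
      by (simp add: abs_mult distrib_right exp_add ac_simps)
  qed (use f(1) g(1) local_on_binop[OF f(2) g(2)] in auto)
qed

lemma tame_cmult: "tame f \<Longrightarrow> tame (\<lambda>\<zeta>. k * f \<zeta>)"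
  by (rule tame_mult[OF tame_const])

lemma tame_diff: "tame f \<Longrightarrow> tame g \<Longrightarrow> tame (\<lambda>\<zeta>. f \<zeta> - g \<zeta>)"
  using tame_add[OF _ tame_cmult[of g "-1"]] by simp

lemma tame_sum: "finite I \<Longrightarrow> (\<And>i. i \<in> I \<Longrightarrow> tame (f i)) \<Longrightarrow> tame (\<lambda>\<zeta>. \<Sum>i\<in>I. f i \<zeta>)"
  by (induction I rule: finite_induct) (auto intro!: tame_const tame_add)

lemma tame_free_generator:
  assumes "tame f"
  shows "tame (free_generator f)"
proof -
  obtain A c where f: "finite A" "local_on A f" "0 \<le> c" "\<And>\<zeta>. \<zeta> \<in> X0 \<Longrightarrow> \<bar>f \<zeta>\<bar> \<le> c * exp (c * \<bar>real_of_int (\<zeta> 0)\<bar>)"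
    using assms unfolding tame_def by blast
  show ?thesis
    by (rule tameI[OF _ local_on_free_generator[OF f(1,2)] free_generator_growth[OF f(1,2,3,4)]]) (use f(1) in auto)
qed

lemma has_zero_derivative_of_quadratic_bound:
  fixes R :: "real \<Rightarrow> real"
  assumes "s \<in> S" "\<And>r. r \<in> S \<Longrightarrow> \<bar>R r\<bar> \<le> c * (r - s)\<^sup>2"
  shows "(R has_real_derivative 0) (at s within S)"
  unfolding has_field_derivative_iff
proof (rule Lim_null_comparison)
  have "R s = 0" using assms(2)[OF assms(1)] by simp
  have "\<forall>\<^sub>F r in at s within S. r \<in> S \<and> r \<noteq> s"
    by (simp add: eventually_at_filter)
  then show "\<forall>\<^sub>F r in at s within S. norm ((R r - R s) / (r - s)) \<le> c * \<bar>r - s\<bar>"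
  proof eventually_elim
    case (elim r)
    then have "\<bar>R r\<bar> \<le> c * \<bar>r - s\<bar> * \<bar>r - s\<bar>" using assms(2)[of r] by (simp add: power2_eq_square mult.assoc power2_abs)
    then show ?case using elim \<open>R s = 0\<close> by (simp add: abs_divide divide_le_eq)
  qed
  have "((\<lambda>r. c * \<bar>r - s\<bar>) \<longlongrightarrow> c * \<bar>s - s\<bar>) (at s within S)" by (intro tendsto_intros)
  then show "((\<lambda>r. c * \<bar>r - s\<bar>) \<longlongrightarrow> 0) (at s within S)" by simp
qed

context free_semigroup
begin

lemma E_0:
  assumes "finite A" "local_on A f"
  shows "E 0 f = f flat_config"
proof -
  have "P 0 flat_config = return X0_space flat_config"
    using semigroup flat_config_X0 by (auto simp: transition_semigroup_def space_X0_space)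
  then show ?thesis unfolding E_def
    using integral_return[of flat_config X0_space f] local_on_measurable[OF assms]
    by (simp add: space_X0_space flat_config_X0)
qed

text \<open>Only updates at \<open>x\<close>, of rate 1/2 and size at most 2, change the height
  there, which gives the growth rate \<open>(exp (2 * l) - 1) / 2\<close>; the summand
  \<open>l\<close> is the flat height, at most 1. The bound is exponential in time, hence far from
  sharp, but it yields all integrability needed.\<close>

lemma exp_moment_truncated:
  assumes "0 \<le> l" "0 \<le> t" "0 \<le> R"
  shows "E t (\<lambda>\<zeta>. min (exp (l * \<bar>real_of_int (\<zeta> x)\<bar>)) R) \<le> exp ((exp (2 * l) - 1) / 2 * t + l)"
proof -
  define f where "f \<zeta> = min (exp (l * \<bar>real_of_int (\<zeta> x)\<bar>)) R" for \<zeta> :: config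
  define C where "C = (exp (2 * l) - 1) / 2"
  have C: "0 \<le> C" using assms by (simp add: C_def)
  have loc: "local_on {x} f" by (simp add: local_on_def f_def)
  have f_bounds: "0 \<le> f \<zeta>" "f \<zeta> \<le> R" for \<zeta> using assms by (auto simp: f_def)
  have bl: "bounded_local f"
    unfolding bounded_local_iff using loc f_bounds by (metis abs_of_nonneg finite.emptyI finite_insert)
  have gen: "free_generator f \<zeta> \<le> C * f \<zeta>" if "\<zeta> \<in> X0" for \<zeta>
  proof -
    have "f (site_update \<zeta> x) \<le> exp (2 * l) * f \<zeta>"
    proof -
      \<comment> \<open>Truncation by \<open>min\<close> respects the one-step factor
        \<open>exp (2 * l)\<close>, so the differential inequality survives the cutoff.\<close>
      have "R \<le> exp (2 * l) * R" using assms by (simp add: mult_le_cancel_right1)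
      moreover have "exp (2 * l) * min p R = min (exp (2 * l) * p) (exp (2 * l) * R)" for p
        by (simp add: min_mult_distrib_left)
      ultimately show ?thesis
        using exp_update_le[OF that assms(1), of x x] unfolding f_def by linarith
    qed
    then have "f (site_update \<zeta> x) - f \<zeta> \<le> (exp (2 * l) - 1) * f \<zeta>" by (simp add: left_diff_distrib)
    then show ?thesis by (simp add: free_generator_local[OF _ loc that] C_def)
  qed
  have "E t f \<le> exp (C * t - C * 0) * (E 0 f + 0 * t)"
  proof (rule gronwall[where u = "\<lambda>s. E s f" and K = "\<lambda>s. C * s" and k = "\<lambda>_. C"])
    show "((\<lambda>s. E s f) has_real_derivative E s (free_generator f)) (at s within {0..t})" if "s \<in> {0..t}" for s
      by (rule DERIV_subset[OF E_deriv_bounded_local[OF bl]]) (use that in auto)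
    show "E s (free_generator f) \<le> C * E s f + 0" if "s \<in> {0<..<t}" for s
    proof -
      have s: "0 \<le> s" using that by simp
      have "E s (free_generator f) \<le> E s (\<lambda>\<zeta>. C * f \<zeta>)"
        unfolding E_def using gen kernel_space[OF s flat_config_X0]
        by (intro integral_mono bounded_local_integrable s flat_config_X0 bounded_local_free_generator bl
              integrable_mult_right) auto
      then show ?thesis by (simp add: E_def)
    qed
    show "((\<lambda>s. C * s) has_real_derivative C) (at s)" for s by (auto intro!: derivative_eq_intros)
  qed (use assms C in \<open>auto intro!: continuous_intros\<close>)
  also have "\<dots> \<le> exp (C * t) * exp l"
  proof -
    have "f flat_config \<le> exp (l * 1)"
      unfolding f_def by (rule min.coboundedI1) (use assms in \<open>auto simp: flat_config_def intro!: mult_left_le\<close>)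
    then show ?thesis using E_0[OF _ loc] by simp
  qed
  finally show ?thesis by (simp add: f_def[abs_def] C_def exp_add)
qed

lemma exp_moment:
  assumes "0 \<le> l" "0 \<le> t"
  shows "integrable (P t flat_config) (\<lambda>\<zeta>. exp (l * \<bar>real_of_int (\<zeta> x)\<bar>))"
    and "E t (\<lambda>\<zeta>. exp (l * \<bar>real_of_int (\<zeta> x)\<bar>)) \<le> exp ((exp (2 * l) - 1) / 2 * t + l)"
proof -
  define f where "f n \<zeta> = min (exp (l * \<bar>real_of_int (\<zeta> x)\<bar>)) (real n)" for n and \<zeta> :: config
  have loc: "local_on {x} (f n)" "local_on {x} (\<lambda>\<zeta>. exp (l * \<bar>real_of_int (\<zeta> x)\<bar>))" for n
    by (auto simp: local_on_def f_def)
  have int: "integrable (P t flat_config) (f n)" for n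
  proof -
    have "\<bar>f n \<zeta>\<bar> \<le> real n" for \<zeta> by (auto simp: f_def)
    then have "bounded_local (f n)" unfolding bounded_local_iff using loc(1) by blast
    then show ?thesis by (rule bounded_local_integrable[OF assms(2) flat_config_X0])
  qed
  have bound: "E t (f n) \<le> exp ((exp (2 * l) - 1) / 2 * t + l)" for n
    unfolding f_def by (rule exp_moment_truncated) (use assms in auto)
  have mono: "incseq (\<lambda>n. E t (f n))"
    unfolding E_def by (intro incseq_SucI integral_mono int) (auto simp: f_def)
  obtain L where L: "(\<lambda>n. E t (f n)) \<longlonglongrightarrow> L"
    using incseq_convergent[OF mono] bound by blast
  have lim: "(\<lambda>n. f n \<zeta>) \<longlonglongrightarrow> exp (l * \<bar>real_of_int (\<zeta> x)\<bar>)" for \<zeta>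
  proof (rule tendsto_eventually)
    obtain m where "exp (l * \<bar>real_of_int (\<zeta> x)\<bar>) \<le> real m" using real_arch_simple by blast
    then show "\<forall>\<^sub>F n in sequentially. f n \<zeta> = exp (l * \<bar>real_of_int (\<zeta> x)\<bar>)"
      unfolding eventually_sequentially f_def by (intro exI[of _ m]) auto
  qed
  have AE_mono: "AE \<zeta> in P t flat_config. mono (\<lambda>n. f n \<zeta>)"
    by (intro AE_I2 monoI) (auto simp: f_def)
  have AE_lim: "AE \<zeta> in P t flat_config. (\<lambda>n. f n \<zeta>) \<longlonglongrightarrow> exp (l * \<bar>real_of_int (\<zeta> x)\<bar>)"
    by (intro AE_I2 lim)
  have meas: "(\<lambda>\<zeta>. exp (l * \<bar>real_of_int (\<zeta> x)\<bar>)) \<in> borel_measurable (P t flat_config)"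
    by (rule local_measurable[OF assms(2) flat_config_X0 _ loc(2)]) simp
  note mct = int AE_mono AE_lim L[unfolded E_def] meas
  show "integrable (P t flat_config) (\<lambda>\<zeta>. exp (l * \<bar>real_of_int (\<zeta> x)\<bar>))"
    by (rule integrable_monotone_convergence[OF mct])
  have "E t (\<lambda>\<zeta>. exp (l * \<bar>real_of_int (\<zeta> x)\<bar>)) = L"
    unfolding E_def by (rule integral_monotone_convergence[OF mct])
  then show "E t (\<lambda>\<zeta>. exp (l * \<bar>real_of_int (\<zeta> x)\<bar>)) \<le> exp ((exp (2 * l) - 1) / 2 * t + l)"
    using LIMSEQ_le_const2[OF L] bound by blast
qed

lemma tame_integrable:
  assumes "tame f" "0 \<le> t"
  shows "integrable (P t flat_config) f"
proof -
  obtain A c where f: "finite A" "local_on A f" "0 \<le> c" "\<And>\<zeta>. \<zeta> \<in> X0 \<Longrightarrow> \<bar>f \<zeta>\<bar> \<le> c * exp (c * \<bar>real_of_int (\<zeta> 0)\<bar>)"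
    using assms(1) unfolding tame_def by blast
  show ?thesis
  proof (rule Bochner_Integration.integrable_bound)
    show "integrable (P t flat_config) (\<lambda>\<zeta>. c * exp (c * \<bar>real_of_int (\<zeta> 0)\<bar>))"
      by (intro integrable_mult_right exp_moment(1) f(3) assms(2))
    show "f \<in> borel_measurable (P t flat_config)"
      by (rule local_measurable[OF assms(2) flat_config_X0 f(1,2)])
    show "AE \<zeta> in P t flat_config. norm (f \<zeta>) \<le> norm (c * exp (c * \<bar>real_of_int (\<zeta> 0)\<bar>))"
      by (intro AE_I2) (use f(3,4) kernel_space[OF assms(2) flat_config_X0] in \<open>auto simp: abs_mult\<close>)
  qed
qed

lemma E_cong: "0 \<le> t \<Longrightarrow> (\<And>\<zeta>. \<zeta> \<in> X0 \<Longrightarrow> f \<zeta> = g \<zeta>) \<Longrightarrow> E t f = E t g"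
  unfolding E_def using kernel_space[OF _ flat_config_X0] by (intro Bochner_Integration.integral_cong) auto

lemma E_mono: "0 \<le> t \<Longrightarrow> tame f \<Longrightarrow> tame g \<Longrightarrow> (\<And>\<zeta>. \<zeta> \<in> X0 \<Longrightarrow> f \<zeta> \<le> g \<zeta>) \<Longrightarrow> E t f \<le> E t g"
  unfolding E_def using kernel_space[OF _ flat_config_X0] by (intro integral_mono tame_integrable) auto

lemma E_add: "0 \<le> t \<Longrightarrow> tame f \<Longrightarrow> tame g \<Longrightarrow> E t (\<lambda>\<zeta>. f \<zeta> + g \<zeta>) = E t f + E t g"
  and E_diff: "0 \<le> t \<Longrightarrow> tame f \<Longrightarrow> tame g \<Longrightarrow> E t (\<lambda>\<zeta>. f \<zeta> - g \<zeta>) = E t f - E t g"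
  and E_cmult: "E t (\<lambda>\<zeta>. k * f \<zeta>) = k * E t f"
  unfolding E_def using tame_integrable by auto

lemma E_growth:
  assumes "0 \<le> t" "0 \<le> a" "\<And>\<zeta>. \<zeta> \<in> X0 \<Longrightarrow> \<bar>f \<zeta>\<bar> \<le> b * exp (a * \<bar>real_of_int (\<zeta> x)\<bar>)"
  shows "\<bar>E t f\<bar> \<le> b * exp ((exp (2 * a) - 1) / 2 * t + a)"
proof -
  have "0 \<le> b * exp (a * \<bar>real_of_int (flat_config x)\<bar>)"
    using assms(3)[OF flat_config_X0] by linarith
  then have b: "0 \<le> b" by (simp add: zero_le_mult_iff)
  show ?thesis
  proof (cases "integrable (P t flat_config) f")
    case True
    have "norm (E t f) \<le> E t (\<lambda>\<zeta>. norm (f \<zeta>))" unfolding E_def by simp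
    also have "\<dots> \<le> E t (\<lambda>\<zeta>. b * exp (a * \<bar>real_of_int (\<zeta> x)\<bar>))"
      unfolding E_def using True assms(3) kernel_space[OF assms(1) flat_config_X0]
      by (intro integral_mono integrable_mult_right exp_moment assms(1,2)) auto
    also have "\<dots> \<le> b * exp ((exp (2 * a) - 1) / 2 * t + a)"
      unfolding E_cmult by (intro mult_left_mono exp_moment(2) assms(1,2) b)
    finally show ?thesis by simp
  qed (use b in \<open>simp add: E_def not_integrable_integral_eq\<close>)
qed

text \<open>Setting \<open>f\<close> to 0 where the height at the origin exceeds \<open>n\<close>
  gives bounded local functions. Their expectations, and those of their generators, converge
  uniformly on \<open>{0..T}\<close>, so the derivative passes to the limit.\<close>

lemma E_deriv:
  assumes "tame f" "t \<in> {0..T}"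
  shows "((\<lambda>t. E t f) has_real_derivative E t (free_generator f)) (at t within {0..T})"
proof -
  obtain A c where f: "finite A" "local_on A f" "0 \<le> c" "\<And>\<zeta>. \<zeta> \<in> X0 \<Longrightarrow> \<bar>f \<zeta>\<bar> \<le> c * exp (c * \<bar>real_of_int (\<zeta> 0)\<bar>)"
    using assms(1) unfolding tame_def by blast
  \<comment> \<open>One extra unit in the rate pays for the factor \<open>exp (- real n)\<close>,
    because \<open>f\<close> and its cutoff differ only where the height exceeds
    \<open>n\<close>.\<close>
  define a where "a = c + 1"
  have a: "0 \<le> a" using f(3) by (simp add: a_def)
  \<comment> \<open>The cutoff reads the height at 0, so the origin joins the support.\<close>
  define B where "B = insert 0 A"
  have B: "finite B" "local_on B f" using f(1) local_on_mono[OF f(2)] by (auto simp: B_def)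
  define g where "g n \<zeta> = (if \<bar>real_of_int (\<zeta> 0)\<bar> \<le> real n then f \<zeta> else 0)" for n \<zeta>
  have g_local: "local_on B (g n)" for n
    unfolding local_on_def
  proof (intro ballI impI)
    fix \<zeta> \<xi> assume "\<zeta> \<in> X0" "\<xi> \<in> X0" and eq: "\<forall>x\<in>B. \<zeta> x = \<xi> x"
    then have "f \<zeta> = f \<xi>" by (intro local_onD[OF B(2)]) auto
    then show "g n \<zeta> = g n \<xi>" using eq by (simp add: g_def B_def)
  qed
  have g_bl: "bounded_local (g n)" for n
  proof -
    have "\<bar>g n \<zeta>\<bar> \<le> c * exp (c * real n)" if "\<zeta> \<in> X0" for \<zeta>
    proof (cases "\<bar>real_of_int (\<zeta> 0)\<bar> \<le> real n")
      case True
      then have "c * exp (c * \<bar>real_of_int (\<zeta> 0)\<bar>) \<le> c * exp (c * real n)"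
        using f(3) by (auto intro!: mult_left_mono)
      then show ?thesis using f(4)[OF that] True by (simp add: g_def)
    qed (use f(3) in \<open>simp add: g_def\<close>)
    then show ?thesis unfolding bounded_local_iff using B(1) g_local by blast
  qed
  have g_tame: "tame (g n)" for n
  proof (rule tameI[OF B(1) g_local])
    show "\<bar>g n \<zeta>\<bar> \<le> c * exp (c * \<bar>real_of_int (\<zeta> 0)\<bar>)" if "\<zeta> \<in> X0" for \<zeta>
      using f(3) f(4)[OF that] by (simp add: g_def)
  qed
  have diff: "\<bar>f \<zeta> - g n \<zeta>\<bar> \<le> c * exp (- real n) * exp (a * \<bar>real_of_int (\<zeta> 0)\<bar>)" if "\<zeta> \<in> X0" for n \<zeta>
  proof (cases "\<bar>real_of_int (\<zeta> 0)\<bar> \<le> real n")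
    case False
    have "c * exp (c * \<bar>real_of_int (\<zeta> 0)\<bar>) \<le> c * (exp (- real n) * exp (a * \<bar>real_of_int (\<zeta> 0)\<bar>))"
      using f(3) False by (intro mult_left_mono) (auto simp: exp_add[symmetric] a_def algebra_simps)
    then show ?thesis using f(4)[OF that] False by (simp add: g_def)
  qed (use f(3) in \<open>simp add: g_def\<close>)
  define M where "M = exp ((exp (2 * a) - 1) / 2 * T + a)"
  have M: "exp ((exp (2 * a) - 1) / 2 * s + a) \<le> M" if "s \<in> {0..T}" for s
    unfolding M_def using that a by (auto intro!: mult_left_mono)
  have conv: "\<bar>E s f - E s (g n)\<bar> \<le> c * exp (- real n) * M" if s: "s \<in> {0..T}" for s n
  proof -
    have "\<bar>E s (\<lambda>\<zeta>. f \<zeta> - g n \<zeta>)\<bar> \<le> c * exp (- real n) * exp ((exp (2 * a) - 1) / 2 * s + a)"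
      by (rule E_growth[OF _ a diff]) (use s in auto)
    also have "\<dots> \<le> c * exp (- real n) * M" using M[OF s] f(3) by (intro mult_left_mono) auto
    finally show ?thesis using s by (simp add: E_diff assms(1) g_tame)
  qed
  have conv': "\<bar>E s (free_generator (g n)) - E s (free_generator f)\<bar> \<le> real (card B) * (c * exp (- real n)) * exp (2 * a) * M"
    if s: "s \<in> {0..T}" for s n
  proof -
    have loc: "local_on B (\<lambda>\<zeta>. f \<zeta> - g n \<zeta>)" using local_on_binop[OF B(2) g_local, of "(-)" n] by simp
    have "\<bar>E s (free_generator (\<lambda>\<zeta>. f \<zeta> - g n \<zeta>))\<bar> \<le>
        real (card B) * (c * exp (- real n)) * exp (2 * a) * exp ((exp (2 * a) - 1) / 2 * s + a)"
      by (rule E_growth[OF _ a free_generator_growth[OF B(1) loc a diff]]) (use s in auto)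
    also have "\<dots> \<le> real (card B) * (c * exp (- real n)) * exp (2 * a) * M"
      using M[OF s] f(3) by (intro mult_left_mono) auto
    also have "E s (free_generator (\<lambda>\<zeta>. f \<zeta> - g n \<zeta>)) = E s (\<lambda>\<zeta>. free_generator f \<zeta> - free_generator (g n) \<zeta>)"
      using s by (intro E_cong free_generator_diff[OF B g_local]) auto
    also have "\<dots> = E s (free_generator f) - E s (free_generator (g n))"
      using s by (intro E_diff tame_free_generator assms(1) g_tame) auto
    finally show ?thesis by (simp add: abs_minus_commute)
  qed
  have lim: "(\<lambda>n. E s (g n)) \<longlonglongrightarrow> E s f" if s: "s \<in> {0..T}" for s
  proof -
    have "(\<lambda>n. E s (g n) - E s f) \<longlonglongrightarrow> 0"
    proof (rule Lim_null_comparison)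
      show "\<forall>\<^sub>F n in sequentially. norm (E s (g n) - E s f) \<le> c * exp (- real n) * M"
        using conv[OF s] by (simp add: abs_minus_commute)
      show "(\<lambda>n. c * exp (- real n) * M) \<longlonglongrightarrow> 0" by real_asymp
    qed
    then show ?thesis by (simp add: LIM_zero_iff)
  qed
  have "\<exists>h. \<forall>s\<in>{0..T}. (\<lambda>n. E s (g n)) \<longlonglongrightarrow> h s \<and>
      (h has_derivative (\<lambda>x. E s (free_generator f) * x)) (at s within {0..T})"
  proof (rule has_derivative_sequence)
    show "((\<lambda>s. E s (g n)) has_derivative (\<lambda>x. E s (free_generator (g n)) * x)) (at s within {0..T})"
      if "s \<in> {0..T}" for n s
      using DERIV_subset[OF E_deriv_bounded_local[OF g_bl[of n], of s], of "{0..T}"] that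
      by (auto simp: has_field_derivative_def)
    show "\<forall>\<^sub>F n in sequentially. \<forall>s\<in>{0..T}. \<forall>x. norm (E s (free_generator (g n)) * x - E s (free_generator f) * x) \<le> e * norm x"
      if "0 < e" for e
    proof -
      have "(\<lambda>n. real (card B) * (c * exp (- real n)) * exp (2 * a) * M) \<longlonglongrightarrow> 0" by real_asymp
      then have "\<forall>\<^sub>F n in sequentially. real (card B) * (c * exp (- real n)) * exp (2 * a) * M < e"
        using that by (rule order_tendstoD)
      then show ?thesis
      proof eventually_elim
        case (elim n)
        have "\<bar>(E s (free_generator (g n)) - E s (free_generator f)) * x\<bar> \<le> e * \<bar>x\<bar>" if "s \<in> {0..T}" for s x
          unfolding abs_mult using conv'[OF that, of n] elim by (intro mult_right_mono) auto
        then show ?case by (simp add: left_diff_distrib)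
      qed
    qed
    show "t \<in> {0..T}" by fact
    show "(\<lambda>n. E t (g n)) \<longlonglongrightarrow> E t f" by (rule lim[OF assms(2)])
  qed simp
  then obtain h where h: "\<And>s. s \<in> {0..T} \<Longrightarrow> (\<lambda>n. E s (g n)) \<longlonglongrightarrow> h s"
      "\<And>s. s \<in> {0..T} \<Longrightarrow> (h has_derivative (\<lambda>x. E s (free_generator f) * x)) (at s within {0..T})"
    by blast
  have "h s = E s f" if "s \<in> {0..T}" for s by (rule LIMSEQ_unique[OF h(1)[OF that] lim[OF that]])
  then show ?thesis
    unfolding has_field_derivative_def
    using has_derivative_transform[OF assms(2) _ h(2)[OF assms(2)]] by simp
qed

text \<open>With \<open>f s\<close> and \<open>f' s\<close> frozen, the first-order expansion in
  \<open>r\<close> is differentiated by \<open>E_deriv\<close> and the product rule. The Taylor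
  remainder is quadratic in \<open>r - s\<close>, uniformly up to a weight with finite expectation,
  and therefore has derivative 0 at \<open>s\<close>.\<close>

lemma E_deriv_time_dependent:
  fixes f f' :: "real \<Rightarrow> config \<Rightarrow> real"
  assumes s: "s \<in> {0..T}" and "0 \<le> c"
    and tame: "\<And>r. r \<in> {0..T} \<Longrightarrow> tame (f r)" "tame (f' s)"
    and taylor: "\<And>r \<zeta>. r \<in> {0..T} \<Longrightarrow> \<zeta> \<in> X0 \<Longrightarrow>
      \<bar>f r \<zeta> - f s \<zeta> - (r - s) * f' s \<zeta>\<bar> \<le> c * (r - s)\<^sup>2 * exp (c * \<bar>real_of_int (\<zeta> 0)\<bar>)"
  shows "((\<lambda>r. E r (f r)) has_real_derivative E s (f' s) + E s (free_generator (f s))) (at s within {0..T})"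
proof -
  define R where "R r = E r (f r) - E r (f s) - (r - s) * E r (f' s)" for r
  have "\<bar>R r\<bar> \<le> c * exp ((exp (2 * c) - 1) / 2 * T + c) * (r - s)\<^sup>2" if r: "r \<in> {0..T}" for r
  proof -
    have "\<bar>E r (\<lambda>\<zeta>. f r \<zeta> - f s \<zeta> - (r - s) * f' s \<zeta>)\<bar> \<le> c * (r - s)\<^sup>2 * exp ((exp (2 * c) - 1) / 2 * r + c)"
      by (rule E_growth[OF _ assms(2) taylor[OF r]]) (use r in auto)
    also have "\<dots> \<le> c * (r - s)\<^sup>2 * exp ((exp (2 * c) - 1) / 2 * T + c)"
      using r assms(2) by (intro mult_left_mono) (auto intro!: mult_left_mono)
    also have "E r (\<lambda>\<zeta>. f r \<zeta> - f s \<zeta> - (r - s) * f' s \<zeta>) = R r"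
      unfolding R_def using r s tame by (simp add: E_diff E_cmult tame_diff tame_cmult)
    finally show ?thesis by (simp add: ac_simps)
  qed
  then have R: "(R has_real_derivative 0) (at s within {0..T})"
    by (rule has_zero_derivative_of_quadratic_bound[OF s])
  have "((\<lambda>r. (E r (f s) + (r - s) * E r (f' s)) + R r) has_real_derivative E s (f' s) + E s (free_generator (f s)))
      (at s within {0..T})"
    by (rule derivative_eq_intros E_deriv[OF tame(1)[OF s] s] E_deriv[OF tame(2) s] R refl)+ simp
  then show ?thesis by (simp add: R_def)
qed

end

section \<open>First and second moments\<close>

lemma heat_symmetric: "0 \<le> s \<Longrightarrow> heat s (- x) = heat s x"
  by (simp add: heat_fourier)

lemma heat_double_deriv:
  "((\<lambda>s. heat (2 * s) x) has_real_derivative heat (2 * s) (x + 1) + heat (2 * s) (x - 1) - 2 * heat (2 * s) x) (at s within S)"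
  by (rule DERIV_cong[OF DERIV_chain'[OF DERIV_cmult_Id heat_deriv]]) (simp add: field_simps)

text \<open>\<open>slope_corr k t\<close> is the correlation of two slopes at distance \<open>k + 1\<close>. The recursion says that
  the sum over two consecutive distances is \<open>-2\<close> times the heat kernel at time \<open>2 t\<close>.\<close>

primrec slope_corr :: "nat \<Rightarrow> real \<Rightarrow> real" where
  "slope_corr 0 t = - heat (2 * t) 0"
| "slope_corr (Suc k) t = - 2 * heat (2 * t) (int k + 1) - slope_corr k t"

text \<open>At \<open>k = 0\<close> the natural subtraction makes \<open>k - 1\<close> equal to 0;
  this is exactly the reflecting boundary condition, reducing the right-hand side to the difference
  of the first two correlations. It is consistent with the recursion because the heat kernel is
  even.\<close>

lemma slope_corr_deriv:
  assumes "0 \<le> s"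
  shows "(slope_corr k has_real_derivative
      slope_corr (Suc k) s + slope_corr (k - 1) s - 2 * slope_corr k s) (at s within S)"
proof (induction k)
  case 0
  have "((\<lambda>s. - heat (2 * s) 0) has_real_derivative - (heat (2 * s) (0 + 1) + heat (2 * s) (0 - 1) - 2 * heat (2 * s) 0)) (at s within S)"
    by (intro DERIV_minus heat_double_deriv)
  then show ?case using heat_symmetric[of "2 * s" 1] assms by simp
next
  case (Suc k)
  have "(slope_corr (Suc k) has_real_derivative
      - 2 * (heat (2 * s) (int k + 1 + 1) + heat (2 * s) (int k + 1 - 1) - 2 * heat (2 * s) (int k + 1))
      - (slope_corr (Suc k) s + slope_corr (k - 1) s - 2 * slope_corr k s)) (at s within S)"
    unfolding slope_corr.simps(2)[abs_def] by (intro DERIV_diff DERIV_cmult heat_double_deriv Suc.IH[unfolded slope_corr.simps(2)])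
  moreover have "slope_corr (k - 1) s = - 2 * heat (2 * s) (int k) - slope_corr k s"
    by (cases k) (auto simp: algebra_simps)
  ultimately show ?case by (elim DERIV_cong) (simp add: algebra_simps)
qed

lemma slope_corr_bound: "0 \<le> s \<Longrightarrow> \<bar>slope_corr k s\<bar> \<le> 2 * real k + 1"
proof (induction k)
  case 0
  then show ?case using heat_nonneg[of "2 * s" 0] heat_le_1[of "2 * s" 0] by simp
next
  case (Suc k)
  then show ?case using heat_nonneg[of "2 * s" "int k + 1"] heat_le_1[of "2 * s" "int k + 1"] by (simp add: abs_le_iff)
qed

lemma slope_corr_initial: "slope_corr k 0 = (-1) ^ Suc k"
  by (induction k) (auto simp: heat_0)

section \<open>Slopes, squared heights and the generator\<close>

definition slope :: "config \<Rightarrow> int \<Rightarrow> real" where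
  "slope \<zeta> x = real_of_int (\<zeta> (x + 1)) - real_of_int (\<zeta> x)"

text \<open>In terms of slopes the dynamics is symmetric exclusion: the update at \<open>y\<close>
  exchanges the slopes at \<open>y - 1\<close> and \<open>y\<close>. This is why products of two
  slopes satisfy a closed system.\<close>

lemma slope_site_update:
  "slope (site_update \<zeta> y) x = (if y = x then slope \<zeta> (x - 1) else if y = x + 1 then slope \<zeta> (x + 1) else slope \<zeta> x)"
  by (auto simp: slope_def site_update_def laplacian_def algebra_simps)

lemma slope_cases: "\<zeta> \<in> X0 \<Longrightarrow> slope \<zeta> x = 1 \<or> slope \<zeta> x = - 1"
  using X0_step[of \<zeta> x] by (auto simp: slope_def)

lemma slope_sq: "\<zeta> \<in> X0 \<Longrightarrow> slope \<zeta> x * slope \<zeta> x = 1"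
  using slope_cases[of \<zeta> x] by auto

lemma tame_slope: "tame (\<lambda>\<zeta>. slope \<zeta> x)"
  unfolding slope_def by (intro tame_diff tame_height)

lemma free_generator_height:
  assumes "\<zeta> \<in> X0"
  shows "free_generator (\<lambda>\<zeta>. real_of_int (\<zeta> x)) \<zeta>
    = (real_of_int (\<zeta> (x + 1)) + real_of_int (\<zeta> (x - 1))) / 2 - real_of_int (\<zeta> x)"
proof -
  have "local_on {x} (\<lambda>\<zeta>. real_of_int (\<zeta> x))" by (simp add: local_on_def)
  from free_generator_local[OF _ this assms] show ?thesis
    by (simp add: site_update_def laplacian_def field_simps)
qed

lemma free_generator_height_sq:
  assumes "\<zeta> \<in> X0"
  shows "free_generator (\<lambda>\<zeta>. real_of_int (\<zeta> x) * real_of_int (\<zeta> x)) \<zeta>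
    = (real_of_int (\<zeta> (x + 1)) * real_of_int (\<zeta> (x + 1)) + real_of_int (\<zeta> (x - 1)) * real_of_int (\<zeta> (x - 1))) / 2
      - real_of_int (\<zeta> x) * real_of_int (\<zeta> x) - slope \<zeta> (x - 1) * slope \<zeta> x"
proof -
  have "local_on {x} (\<lambda>\<zeta>. real_of_int (\<zeta> x) * real_of_int (\<zeta> x))" by (simp add: local_on_def)
  note gen = free_generator_local[OF _ this assms]
  define z where "z = real_of_int (\<zeta> x)"
  define a where "a = slope \<zeta> x"
  define b where "b = slope \<zeta> (x - 1)"
  have z: "real_of_int (\<zeta> (x + 1)) = z + a" "real_of_int (\<zeta> (x - 1)) = z - b"
    by (auto simp: z_def a_def b_def slope_def)
  have "real_of_int (site_update \<zeta> x x) = z + a - b"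
    using z by (simp add: site_update_def laplacian_def z_def)
  moreover have "((z + a - b) * (z + a - b) - z * z) / 2 = ((z + a) * (z + a) + (z - b) * (z - b)) / 2 - z * z - b * a"
    by (simp add: field_simps)
  ultimately show ?thesis unfolding gen[OF finite.insertI[OF finite.emptyI]] z
    by (simp add: z_def[symmetric] a_def[symmetric] b_def[symmetric])
qed

text \<open>Only exchanges at the four ends of the two bonds matter. For adjacent bonds the exchange
  at their common site permutes the two factors and leaves the product unchanged, so two moves
  remain instead of four: the origin of the reflection.\<close>

lemma free_generator_slope_pair:
  assumes "\<zeta> \<in> X0" "x < y"
  shows "free_generator (\<lambda>\<zeta>. slope \<zeta> x * slope \<zeta> y) \<zeta> =
    (if y = x + 1 then (slope \<zeta> (x - 1) * slope \<zeta> y + slope \<zeta> x * slope \<zeta> (y + 1)) / 2 - slope \<zeta> x * slope \<zeta> y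
     else (slope \<zeta> (x - 1) * slope \<zeta> y + slope \<zeta> (x + 1) * slope \<zeta> y + slope \<zeta> x * slope \<zeta> (y - 1)
       + slope \<zeta> x * slope \<zeta> (y + 1)) / 2 - 2 * (slope \<zeta> x * slope \<zeta> y))"
proof -
  have "local_on {x, x + 1, y, y + 1} (\<lambda>\<zeta>. slope \<zeta> x * slope \<zeta> y)" by (simp add: local_on_def slope_def)
  from free_generator_local[OF _ this assms(1)] show ?thesis
    using assms(2) by (auto simp: slope_site_update algebra_simps add_divide_distrib diff_divide_distrib)
qed

lemma flat_config_neighbours:
  "real_of_int (flat_config (x + 1)) = 1 - real_of_int (flat_config x)"
  "real_of_int (flat_config (x - 1)) = 1 - real_of_int (flat_config x)"
proof -
  have "flat_config (x + 1) = 1 - flat_config x" "flat_config (x - 1) = 1 - flat_config x"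
    unfolding flat_config_def by presburger+
  then show "real_of_int (flat_config (x + 1)) = 1 - real_of_int (flat_config x)"
    "real_of_int (flat_config (x - 1)) = 1 - real_of_int (flat_config x)" by simp_all
qed

lemma flat_config_cases: "flat_config x = 0 \<or> flat_config x = 1"
  unfolding flat_config_def by presburger

lemma slope_flat: "slope flat_config x * slope flat_config (x + 1 + int k) = (-1) ^ Suc k"
proof -
  have step: "slope flat_config (z + 1) = - slope flat_config z" for z
    using flat_config_neighbours(1)[of z] flat_config_neighbours(1)[of "z + 1"] by (simp add: slope_def)
  have "slope flat_config (x + 1 + int k) = (-1) ^ Suc k * slope flat_config x"
  proof (induction k)
    case 0
    then show ?case using step[of x] by simp
  next
    case (Suc k)
    then show ?case using step[of "x + 1 + int k"] by (simp add: algebra_simps)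
  qed
  then show ?thesis using slope_sq[OF flat_config_X0, of x] by simp
qed

text \<open>The flat profile minus 1/2 alternates in sign, hence is an eigenfunction of half the
  discrete Laplacian with eigenvalue -2.\<close>

definition mean_height :: "real \<Rightarrow> int \<Rightarrow> real" where
  "mean_height t x = 1 / 2 + (real_of_int (flat_config x) - 1 / 2) * exp (- 2 * t)"

lemma mean_height_deriv:
  "((\<lambda>t. mean_height t x) has_real_derivative (mean_height t (x + 1) + mean_height t (x - 1)) / 2 - mean_height t x) (at t within S)"
proof -
  have "((\<lambda>t. mean_height t x) has_real_derivative (real_of_int (flat_config x) - 1 / 2) * (exp (- 2 * t) * (- 2))) (at t within S)"
    unfolding mean_height_def by (auto intro!: derivative_eq_intros)
  then show ?thesis
    unfolding mean_height_def flat_config_neighbours by (elim DERIV_cong) (simp add: field_simps)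
qed

lemma mean_height_bounds:
  assumes "0 \<le> t"
  shows "0 \<le> mean_height t x" "mean_height t x \<le> 1"
proof -
  have "exp (- 2 * t) \<le> 1" using assms by simp
  moreover have "0 < exp (- 2 * t)" by simp
  ultimately have "- 1 / 2 \<le> (real_of_int (flat_config x) - 1 / 2) * exp (- 2 * t)"
      "(real_of_int (flat_config x) - 1 / 2) * exp (- 2 * t) \<le> 1 / 2"
    using flat_config_cases[of x] by (auto simp del: exp_gt_zero)
  then show "0 \<le> mean_height t x" "mean_height t x \<le> 1" unfolding mean_height_def by linarith+
qed

lemma mean_height_0: "mean_height 0 x = real_of_int (flat_config x)"
  by (simp add: mean_height_def)

section \<open>Identification of the moments by uniqueness\<close>

context free_semigroup
begin

lemma E_height:
  assumes "0 \<le> t"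
  shows "E t (\<lambda>\<zeta>. real_of_int (\<zeta> x)) = mean_height t x"
proof -
  define u where "u s x = E s (\<lambda>\<zeta>. real_of_int (\<zeta> x))" for s and x :: int
  \<comment> \<open>The a priori bound from the exponential moment at rate 1, through z \<le> exp z,
    plus 1 for \<open>mean_height\<close>.\<close>
  define B where "B = exp ((exp (2 * 1) - 1) / 2 * t + 1) + (1::real)"
  have "u t x - mean_height t x = 0"
  proof (rule linear_system_unique[where D = "\<lambda>s x. u s x - mean_height s x" and T = t and B = B and C = 2
        and w = "\<lambda>_. 1" and I = UNIV
        and D' = "\<lambda>s x. ((u s (x + 1) + u s (x - 1)) / 2 - u s x) - ((mean_height s (x + 1) + mean_height s (x - 1)) / 2 - mean_height s x)"])
    fix s x assume s: "s \<in> {0..t}"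
    have "((\<lambda>s. u s x) has_real_derivative E s (free_generator (\<lambda>\<zeta>. real_of_int (\<zeta> x)))) (at s within {0..t})"
      unfolding u_def by (rule E_deriv[OF tame_height s])
    also have "E s (free_generator (\<lambda>\<zeta>. real_of_int (\<zeta> x)))
        = E s (\<lambda>\<zeta>. 1 / 2 * (real_of_int (\<zeta> (x + 1)) + real_of_int (\<zeta> (x - 1))) - real_of_int (\<zeta> x))"
      using s by (intro E_cong) (auto simp: free_generator_height)
    also have "\<dots> = 1 / 2 * (u s (x + 1) + u s (x - 1)) - u s x"
      unfolding u_def using s by (simp only: E_diff E_add E_cmult tame_height tame_add tame_cmult atLeastAtMost_iff)
    finally show "((\<lambda>s. u s x - mean_height s x) has_real_derivative
       ((u s (x + 1) + u s (x - 1)) / 2 - u s x) - ((mean_height s (x + 1) + mean_height s (x - 1)) / 2 - mean_height s x)) (at s within {0..t})"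
      by (intro DERIV_diff mean_height_deriv) simp
    have "\<bar>u s x\<bar> \<le> 1 * exp ((exp (2 * 1) - 1) / 2 * s + 1)"
      unfolding u_def
    proof (rule E_growth)
      show "\<bar>real_of_int (\<zeta> x)\<bar> \<le> 1 * exp (1 * \<bar>real_of_int (\<zeta> x)\<bar>)" for \<zeta> :: config
        using exp_ge_add_one_self[of "\<bar>real_of_int (\<zeta> x)\<bar>"] unfolding mult_1 by linarith
    qed (use s in auto)
    also have "\<dots> \<le> B - 1" using s by (auto simp: B_def intro!: mult_left_mono)
    finally show "\<bar>u s x - mean_height s x\<bar> \<le> B * 1" using mean_height_bounds[of s x] s by simp
  next
    fix s b i
    assume "\<And>j. j \<in> UNIV \<Longrightarrow> \<bar>u s j - mean_height s j\<bar> \<le> b * 1"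
    from this[of "i + 1"] this[of "i - 1"] this[of i]
    show "\<bar>((u s (i + 1) + u s (i - 1)) / 2 - u s i) - ((mean_height s (i + 1) + mean_height s (i - 1)) / 2 - mean_height s i)\<bar> \<le> 2 * b * 1"
      by (simp add: abs_le_iff field_simps)
  next
    fix i
    have "local_on {i} (\<lambda>\<zeta>. real_of_int (\<zeta> i))" by (simp add: local_on_def)
    from E_0[OF _ this] show "u 0 i - mean_height 0 i = 0"
      unfolding u_def by (simp add: mean_height_0)
  qed (use assms in \<open>auto simp: B_def\<close>)
  then show ?thesis by (simp add: u_def)
qed

text \<open>Translation invariance is never established: the unknowns are indexed by the position
  and the distance, and uniqueness forces them to agree with a candidate that does not depend on the
  position.\<close>

lemma E_slope_pair:
  assumes "0 \<le> t"
  shows "E t (\<lambda>\<zeta>. slope \<zeta> x * slope \<zeta> (x + 1 + int k)) = slope_corr k t"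
proof -
  define u where "u s x y = E s (\<lambda>\<zeta>. slope \<zeta> x * slope \<zeta> y)" for s and x y :: int
  define D where "D s i = u s (fst i) (fst i + 1 + int (snd i)) - slope_corr (snd i) s"
    for s and i :: "int \<times> nat"
  define D' where "D' s i = (case i of (x, k) \<Rightarrow>
    (if k = 0 then (u s (x - 1) (x + 1) + u s x (x + 2)) / 2 - u s x (x + 1)
     else (u s (x - 1) (x + 1 + int k) + u s (x + 1) (x + 1 + int k) + u s x (x + int k) + u s x (x + 2 + int k)) / 2
        - 2 * u s x (x + 1 + int k))
    - (slope_corr (Suc k) s + slope_corr (k - 1) s - 2 * slope_corr k s))" for s and i :: "int \<times> nat"
  have D'_0: "D' s (x, 0) = (D s (x - 1, 1) + D s (x, 1)) / 2 - D s (x, 0)" for s x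
    unfolding D_def D'_def by (simp add: field_simps del: slope_corr.simps)
  have D'_Suc: "D' s (x, Suc k) = (D s (x - 1, Suc (Suc k)) + D s (x + 1, k) + D s (x, k) + D s (x, Suc (Suc k))) / 2
      - 2 * D s (x, Suc k)" for s x k
    unfolding D_def D'_def by (simp add: field_simps del: slope_corr.simps)
  have "D t (x, k) = 0"
  \<comment> \<open>The weight follows the bound \<open>2 * k + 1\<close> on
    \<open>slope_corr\<close>; adding 1 for the product of slopes stays below twice the weight.
    Being affine in \<open>k\<close>, the weight is reproduced by the system with constant 4, at the
    boundary as well as inside.\<close>
  proof (rule linear_system_unique[where D = D and T = t and B = 2 and C = 4 and w = "\<lambda>i. 2 * real (snd i) + 1" and I = UNIV and D' = D'])
    fix s :: real and i :: "int \<times> nat" assume s: "s \<in> {0..t}"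
    obtain x k where i: "i = (x, k)" by (cases i)
    let ?f = "\<lambda>\<zeta>. slope \<zeta> x * slope \<zeta> (x + 1 + int k)"
    have tame_pair: "tame (\<lambda>\<zeta>. slope \<zeta> a * slope \<zeta> b)" for a b by (intro tame_mult tame_slope)
    have "((\<lambda>s. u s x (x + 1 + int k)) has_real_derivative E s (free_generator ?f)) (at s within {0..t})"
      unfolding u_def by (rule E_deriv[OF tame_pair s])
    also have "E s (free_generator ?f) =
      (if k = 0 then 1 / 2 * (u s (x - 1) (x + 1) + u s x (x + 2)) - u s x (x + 1)
       else 1 / 2 * (u s (x - 1) (x + 1 + int k) + u s (x + 1) (x + 1 + int k) + u s x (x + int k) + u s x (x + 2 + int k))
        - 2 * u s x (x + 1 + int k))"
    proof (cases "k = 0")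
      case True
      have "E s (free_generator ?f) = E s (\<lambda>\<zeta>. 1 / 2 * (slope \<zeta> (x - 1) * slope \<zeta> (x + 1) + slope \<zeta> x * slope \<zeta> (x + 2))
          - slope \<zeta> x * slope \<zeta> (x + 1))"
        using s True by (intro E_cong) (auto simp: free_generator_slope_pair add.assoc)
      also have "\<dots> = 1 / 2 * (u s (x - 1) (x + 1) + u s x (x + 2)) - u s x (x + 1)"
        unfolding u_def using s by (simp only: E_diff E_add E_cmult tame_pair tame_add tame_cmult atLeastAtMost_iff)
      finally show ?thesis using True by simp
    next
      case False
      have "E s (free_generator ?f) = E s (\<lambda>\<zeta>. 1 / 2 * (slope \<zeta> (x - 1) * slope \<zeta> (x + 1 + int k) + slope \<zeta> (x + 1) * slope \<zeta> (x + 1 + int k)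
          + slope \<zeta> x * slope \<zeta> (x + int k) + slope \<zeta> x * slope \<zeta> (x + 2 + int k)) - 2 * (slope \<zeta> x * slope \<zeta> (x + 1 + int k)))"
        using s False by (intro E_cong) (auto simp: free_generator_slope_pair algebra_simps)
      also have "\<dots> = 1 / 2 * (u s (x - 1) (x + 1 + int k) + u s (x + 1) (x + 1 + int k) + u s x (x + int k) + u s x (x + 2 + int k))
          - 2 * u s x (x + 1 + int k)"
        unfolding u_def using s by (simp only: E_diff E_add E_cmult tame_pair tame_add tame_cmult atLeastAtMost_iff)
      finally show ?thesis using False by simp
    qed
    finally have "((\<lambda>s. u s x (x + 1 + int k) - slope_corr k s) has_real_derivative D' s (x, k)) (at s within {0..t})"
      unfolding D'_def prod.case using s
      by (intro DERIV_cong[OF DERIV_diff[OF _ slope_corr_deriv]]) auto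
    then show "((\<lambda>s. D s i) has_real_derivative D' s i) (at s within {0..t})"
      unfolding D_def i by simp
    have "\<bar>u s x (x + 1 + int k)\<bar> \<le> 1 * exp ((exp (2 * 0) - 1) / 2 * s + 0)"
      unfolding u_def
    proof (rule E_growth)
      show "\<bar>slope \<zeta> x * slope \<zeta> (x + 1 + int k)\<bar> \<le> 1 * exp (0 * \<bar>real_of_int (\<zeta> 0)\<bar>)" if "\<zeta> \<in> X0" for \<zeta>
        using slope_cases[OF that, of x] slope_cases[OF that, of "x + 1 + int k"] by auto
    qed (use s in auto)
    then show "\<bar>D s i\<bar> \<le> 2 * (2 * real (snd i) + 1)"
      using slope_corr_bound[of s k] s abs_triangle_ineq4[of "u s x (x + 1 + int k)" "slope_corr k s"]
      unfolding D_def i by simp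
  next
    fix s b :: real and i :: "int \<times> nat"
    assume b: "\<And>j. j \<in> UNIV \<Longrightarrow> \<bar>D s j\<bar> \<le> b * (2 * real (snd j) + 1)"
    obtain x k where i: "i = (x, k)" by (cases i)
    show "\<bar>D' s i\<bar> \<le> 4 * b * (2 * real (snd i) + 1)"
    proof (cases k)
      case 0
      then show ?thesis
        using b[of "(x - 1, 1)"] b[of "(x, 1)"] b[of "(x, 0)"] unfolding i 0 D'_0 by (simp add: abs_le_iff field_simps)
    next
      case (Suc m)
      then show ?thesis
        using b[of "(x - 1, Suc (Suc m))"] b[of "(x + 1, m)"] b[of "(x, m)"] b[of "(x, Suc (Suc m))"] b[of "(x, Suc m)"]
        unfolding i Suc D'_Suc by (simp add: abs_le_iff field_simps)
    qed
  next
    fix i :: "int \<times> nat"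
    have "u 0 x y = slope flat_config x * slope flat_config y" for x y
    proof -
      have "local_on {x, x + 1, y, y + 1} (\<lambda>\<zeta>. slope \<zeta> x * slope \<zeta> y)" by (simp add: local_on_def slope_def)
      from E_0[OF _ this] show ?thesis by (simp add: u_def)
    qed
    then show "D 0 i = 0" unfolding D_def by (simp only: slope_flat slope_corr_initial diff_self)
  qed (use assms in auto)
  then show ?thesis by (simp add: D_def u_def)
qed

text \<open>By \<open>E_slope_pair\<close> the source term is \<open>heat (2 * s) 0\<close> at every
  site. Being constant in space it simply integrates in time. The homogeneous part is
  \<open>mean_height\<close> because flat heights are 0 or 1 and so equal their squares.\<close>

lemma E_height_sq:
  assumes "0 \<le> t"
  shows "E t (\<lambda>\<zeta>. real_of_int (\<zeta> x) * real_of_int (\<zeta> x)) = heat_integral t + mean_height t x"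
proof -
  define u where "u s x = E s (\<lambda>\<zeta>. real_of_int (\<zeta> x) * real_of_int (\<zeta> x))" for s and x :: int
  define v where "v s x = heat_integral s + mean_height s x" for s x
  define B where "B = 2 * exp ((exp (2 * 1) - 1) / 2 * t + 1) + t + (1::real)"
  have tame_sq: "tame (\<lambda>\<zeta>. real_of_int (\<zeta> x) * real_of_int (\<zeta> x))" for x by (intro tame_mult tame_height)
  have tame_pair: "tame (\<lambda>\<zeta>. slope \<zeta> a * slope \<zeta> b)" for a b by (intro tame_mult tame_slope)
  have hi: "0 \<le> heat_integral s" "heat_integral s \<le> s" if "0 \<le> s" for s
  proof -
    have int: "(\<lambda>s. heat (2 * s) 0) integrable_on {0..s}"
      by (intro integrable_continuous_interval continuous_on_compose2[OF heat_continuous[of UNIV]] continuous_intros) auto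
    show "0 \<le> heat_integral s" unfolding heat_integral_def
      by (rule integral_nonneg[OF int]) (auto intro: heat_nonneg)
    have "heat_integral s \<le> integral {0..s} (\<lambda>_. 1)"
      unfolding heat_integral_def by (rule integral_le[OF int]) (auto intro: heat_le_1)
    then show "heat_integral s \<le> s" using that by simp
  qed
  have "u t x - v t x = 0"
  proof (rule linear_system_unique[where D = "\<lambda>s x. u s x - v s x" and T = t and B = B and C = 2
        and w = "\<lambda>_. 1" and I = UNIV
        and D' = "\<lambda>s x. ((u s (x + 1) + u s (x - 1)) / 2 - u s x) - ((v s (x + 1) + v s (x - 1)) / 2 - v s x)"])
    fix s x assume s: "s \<in> {0..t}"
    have "((\<lambda>s. u s x) has_real_derivative E s (free_generator (\<lambda>\<zeta>. real_of_int (\<zeta> x) * real_of_int (\<zeta> x)))) (at s within {0..t})"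
      unfolding u_def by (rule E_deriv[OF tame_sq s])
    also have "E s (free_generator (\<lambda>\<zeta>. real_of_int (\<zeta> x) * real_of_int (\<zeta> x)))
        = E s (\<lambda>\<zeta>. 1 / 2 * (real_of_int (\<zeta> (x + 1)) * real_of_int (\<zeta> (x + 1)) + real_of_int (\<zeta> (x - 1)) * real_of_int (\<zeta> (x - 1)))
          - real_of_int (\<zeta> x) * real_of_int (\<zeta> x) - slope \<zeta> (x - 1) * slope \<zeta> x)"
      using s by (intro E_cong) (auto simp: free_generator_height_sq)
    also have "\<dots> = 1 / 2 * (u s (x + 1) + u s (x - 1)) - u s x - E s (\<lambda>\<zeta>. slope \<zeta> (x - 1) * slope \<zeta> x)"
      unfolding u_def using s
      by (simp only: E_diff E_add E_cmult tame_sq tame_pair tame_diff tame_add tame_cmult atLeastAtMost_iff)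
    also have "E s (\<lambda>\<zeta>. slope \<zeta> (x - 1) * slope \<zeta> x) = - heat (2 * s) 0"
      using E_slope_pair[of s "x - 1" 0] s by simp
    finally have "((\<lambda>s. u s x - v s x) has_real_derivative (1 / 2 * (u s (x + 1) + u s (x - 1)) - u s x - - heat (2 * s) 0)
        - (heat (2 * s) 0 + ((mean_height s (x + 1) + mean_height s (x - 1)) / 2 - mean_height s x))) (at s within {0..t})"
      unfolding v_def using s by (intro DERIV_diff DERIV_add mean_height_deriv heat_integral_deriv)
    then show "((\<lambda>s. u s x - v s x) has_real_derivative
       ((u s (x + 1) + u s (x - 1)) / 2 - u s x) - ((v s (x + 1) + v s (x - 1)) / 2 - v s x)) (at s within {0..t})"
      by (rule DERIV_cong) (simp add: v_def field_simps)
    have "\<bar>u s x\<bar> \<le> 2 * exp ((exp (2 * 1) - 1) / 2 * s + 1)"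
      unfolding u_def
    proof (rule E_growth)
      show "\<bar>real_of_int (\<zeta> x) * real_of_int (\<zeta> x)\<bar> \<le> 2 * exp (1 * \<bar>real_of_int (\<zeta> x)\<bar>)" for \<zeta> :: config
        using exp_lower_Taylor_quadratic[of "\<bar>real_of_int (\<zeta> x)\<bar>"] abs_ge_zero[of "real_of_int (\<zeta> x)"]
        by (simp add: power2_eq_square abs_mult)
    qed (use s in auto)
    also have "\<dots> \<le> B - t - 1" using s by (auto simp: B_def intro!: mult_left_mono)
    finally show "\<bar>u s x - v s x\<bar> \<le> B * 1" using mean_height_bounds[of s x] hi[of s] s by (simp add: v_def)
  next
    fix s b i
    assume "\<And>j. j \<in> UNIV \<Longrightarrow> \<bar>u s j - v s j\<bar> \<le> b * 1"
    from this[of "i + 1"] this[of "i - 1"] this[of i]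
    show "\<bar>((u s (i + 1) + u s (i - 1)) / 2 - u s i) - ((v s (i + 1) + v s (i - 1)) / 2 - v s i)\<bar> \<le> 2 * b * 1"
      by (simp add: abs_le_iff field_simps)
  next
    fix i
    have "local_on {i} (\<lambda>\<zeta>. real_of_int (\<zeta> i) * real_of_int (\<zeta> i))" by (simp add: local_on_def)
    from E_0[OF _ this] have "u 0 i = real_of_int (flat_config i) * real_of_int (flat_config i)"
      by (simp add: u_def)
    then show "u 0 i - v 0 i = 0"
      unfolding v_def using flat_config_cases[of i] by (auto simp: heat_integral_def mean_height_0)
  qed (use assms in \<open>auto simp: B_def\<close>)
  then show ?thesis by (simp add: u_def v_def)
qed

end

section \<open>Exponential moments\<close>

text \<open>From 1 - y \<le> exp(-y) one gets exp y - 1 \<le> y exp y, hence the left side is at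
  most y(exp y - 1). For y \<ge> 0 apply the same inequality again; for y < 0 use exp y - 1 \<ge> y.
  It makes the drift of the exponential martingale quadratic in the heat kernel.\<close>

lemma exp_minus_one_minus_le:
  fixes y :: real
  shows "exp y - 1 - y \<le> y\<^sup>2 * exp \<bar>y\<bar>"
proof -
  have mul: "exp y * exp (- y) = 1" by (simp add: exp_minus)
  have "exp y * (1 - y) \<le> exp y * exp (- y)" using exp_ge_add_one_self[of "- y"] by (intro mult_left_mono) auto
  then have up: "exp y - 1 \<le> y * exp y" unfolding mul by (simp add: algebra_simps)
  show ?thesis
  proof (cases "0 \<le> y")
    case True
    have "y * (1 + y * exp y - exp y) \<ge> 0" using up True by (intro mult_nonneg_nonneg) auto
    then have "y * (exp y - 1) \<le> y * (y * exp y)" by (simp add: algebra_simps)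
    moreover have "exp y - 1 - y \<le> y * (exp y - 1)" using up by (simp add: algebra_simps)
    ultimately show ?thesis using True by (simp add: power2_eq_square mult.assoc)
  next
    case False
    have "exp y - 1 - y \<le> y * (exp y - 1)" using up by (simp add: algebra_simps)
    also have "\<dots> \<le> y * y"
    proof (rule mult_left_mono_neg)
      show "y \<le> exp y - 1" using exp_ge_add_one_self[of y] by linarith
    qed (use False in simp)
    also have "\<dots> \<le> y * y * exp \<bar>y\<bar>" using mult_left_mono[of 1 "exp \<bar>y\<bar>" "y * y"] by simp
    finally show ?thesis by (simp add: power2_eq_square)
  qed
qed

text \<open>Discrete Green identity: the summand is the increment of the Wronskian \<open>W\<close>,
  so the sum telescopes to the two ends of the window.\<close>

lemma sum_laplacian_by_parts:
  fixes q z :: "int \<Rightarrow> real"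
  shows "(\<Sum>x\<in>{-int N..int N}. q x * (z (x + 1) - 2 * z x + z (x - 1)) - z x * (q (x + 1) - 2 * q x + q (x - 1)))
    = (q (int N) * z (int N + 1) - q (int N + 1) * z (int N))
      - (q (- int N - 1) * z (- int N) - q (- int N) * z (- int N - 1))"
proof -
  define W where "W x = q x * z (x + 1) - q (x + 1) * z x" for x
  have "(\<Sum>x\<in>{-int N..int N}. W x - W (x - 1)) = W (int N) - W (- int N - 1)"
  proof (induction N)
    case (Suc N)
    have "{-int (Suc N)..int (Suc N)} = insert (- int N - 1) (insert (int N + 1) {-int N..int N})" by auto
    moreover have shift: "- 2 - int N = - int N - 2" by simp
    ultimately have "(\<Sum>x\<in>{-int (Suc N)..int (Suc N)}. W x - W (x - 1)) = W (int N + 1) - W (- int N - 2)"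
      by (simp add: Suc shift)
    moreover have "int (Suc N) = int N + 1" "- int (Suc N) - 1 = - int N - 2" by simp_all
    ultimately show ?case by (simp only:)
  qed simp
  moreover have "q x * (z (x + 1) - 2 * z x + z (x - 1)) - z x * (q (x + 1) - 2 * q x + q (x - 1)) = W x - W (x - 1)" for x
    by (simp add: W_def algebra_simps)
  ultimately show ?thesis by (simp add: W_def)
qed

text \<open>One factor is estimated by its supremum, the other contributes total mass at most
  1.\<close>

lemma heat_sq_sum_le:
  assumes "0 < s" "\<And>x. heat s x \<le> C / sqrt s"
  shows "(\<Sum>x\<in>{-int N..int N}. (heat s x)\<^sup>2) \<le> C / sqrt s"
proof -
  have "0 \<le> C / sqrt s" using assms(2)[of 0] heat_nonneg[of s 0] assms(1) by linarith
  have "(\<Sum>x\<in>{-int N..int N}. (heat s x)\<^sup>2) \<le> (\<Sum>x\<in>{-int N..int N}. C / sqrt s * heat s x)"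
    using mult_right_mono[OF assms(2) heat_nonneg[of s]] assms(1) by (intro sum_mono) (simp add: power2_eq_square)
  also have "\<dots> \<le> C / sqrt s * 1"
    unfolding sum_distrib_left[symmetric] using \<open>0 \<le> C / sqrt s\<close> assms(1)
    by (intro mult_left_mono heat_sum_le_1) auto
  finally show ?thesis by simp
qed

lemma tame_exp_linear:
  assumes "finite I" "\<And>x. x \<in> I \<Longrightarrow> \<bar>a x\<bar> \<le> B" "0 \<le> B"
  shows "tame (\<lambda>\<zeta>. exp (\<Sum>x\<in>I. a x * real_of_int (\<zeta> x)))"
proof (rule tameI[OF assms(1)])
  show "local_on I (\<lambda>\<zeta>. exp (\<Sum>x\<in>I. a x * real_of_int (\<zeta> x)))"
    unfolding local_on_def by (intro ballI impI arg_cong[of _ _ exp] sum.cong) auto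
  fix \<zeta> assume z: "\<zeta> \<in> X0"
  let ?h = "\<bar>real_of_int (\<zeta> 0)\<bar>"
  have "(\<Sum>x\<in>I. a x * real_of_int (\<zeta> x)) \<le> (\<Sum>x\<in>I. B * (?h + \<bar>real_of_int x\<bar>))"
  proof (rule sum_mono)
    fix x assume "x \<in> I"
    have "a x * real_of_int (\<zeta> x) \<le> \<bar>a x\<bar> * \<bar>real_of_int (\<zeta> x)\<bar>" unfolding abs_mult[symmetric] by (rule abs_ge_self)
    also have "\<dots> \<le> B * (?h + \<bar>real_of_int x\<bar>)"
      using X0_height_le[OF z, of x] assms(2)[OF \<open>x \<in> I\<close>] assms(3) by (intro mult_mono) linarith+
    finally show "a x * real_of_int (\<zeta> x) \<le> B * (?h + \<bar>real_of_int x\<bar>)" .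
  qed
  also have "\<dots> = (\<Sum>x\<in>I. B * \<bar>real_of_int x\<bar>) + B * real (card I) * ?h"
    by (simp add: distrib_left sum.distrib)
  finally show "\<bar>exp (\<Sum>x\<in>I. a x * real_of_int (\<zeta> x))\<bar> \<le> exp (\<Sum>x\<in>I. B * \<bar>real_of_int x\<bar>) * exp (B * real (card I) * ?h)"
    by (simp add: exp_add[symmetric])
qed

text \<open>An update at \<open>y\<close> adds \<open>a y * laplacian \<zeta> y\<close> to the
  exponent, so it multiplies the whole exponential and the factor comes out of the
  generator.\<close>

lemma free_generator_exp_linear:
  assumes "finite I" "\<zeta> \<in> X0"
  shows "free_generator (\<lambda>\<zeta>. exp (\<Sum>x\<in>I. a x * real_of_int (\<zeta> x))) \<zeta> =
    exp (\<Sum>x\<in>I. a x * real_of_int (\<zeta> x)) * ((\<Sum>x\<in>I. exp (a x * real_of_int (laplacian \<zeta> x)) - 1) / 2)"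
proof -
  have loc: "local_on I (\<lambda>\<zeta>. exp (\<Sum>x\<in>I. a x * real_of_int (\<zeta> x)))"
    unfolding local_on_def by (intro ballI impI arg_cong[of _ _ exp] sum.cong) auto
  have "(\<Sum>x\<in>I. a x * real_of_int (site_update \<zeta> y x)) = (\<Sum>x\<in>I. a x * real_of_int (\<zeta> x)) + a y * real_of_int (laplacian \<zeta> y)"
    if "y \<in> I" for y
  proof -
    have "(\<Sum>x\<in>I. a x * real_of_int (site_update \<zeta> y x)) =
        (\<Sum>x\<in>I. a x * real_of_int (\<zeta> x) + (if x = y then a y * real_of_int (laplacian \<zeta> y) else 0))"
      by (intro sum.cong) (auto simp: site_update_def distrib_left)
    then show ?thesis using that assms(1) by (simp add: sum.distrib)
  qed
  then show ?thesis
    unfolding free_generator_local[OF assms(1) loc assms(2)]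
    by (simp add: exp_add sum_distrib_left right_diff_distrib cong: sum.cong)
qed

text \<open>First-order Taylor formula; \<open>f\<close> lists the first derivatives of
  \<open>exp (m u)\<close>. The second one is at most \<open>exp Q * (Q * Q + Q)\<close>, and Q^2 +
  Q \<le> 2 exp Q.\<close>

lemma exp_taylor_bound:
  fixes m m' m'' :: "real \<Rightarrow> real"
  assumes "convex S" "s \<in> S" "r \<in> S" "0 \<le> Q"
    and m: "\<And>u. u \<in> S \<Longrightarrow> (m has_real_derivative m' u) (at u within S)"
    and m': "\<And>u. u \<in> S \<Longrightarrow> (m' has_real_derivative m'' u) (at u within S)"
    and bounds: "\<And>u. u \<in> S \<Longrightarrow> \<bar>m u\<bar> \<le> Q \<and> \<bar>m' u\<bar> \<le> Q \<and> \<bar>m'' u\<bar> \<le> Q"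
  shows "\<bar>exp (m r) - exp (m s) - (r - s) * (exp (m s) * m' s)\<bar> \<le> 2 * exp (2 * Q) * (r - s)\<^sup>2"
proof -
  define f where "f i u = (if i = 0 then exp (m u) else if i = 1 then exp (m u) * m' u
      else exp (m u) * (m' u * m' u + m'' u))" for i :: nat and u
  have "norm (f 0 r - (\<Sum>i\<le>1. f i s * (r - s) ^ i / fact i)) \<le> (2 * exp (2 * Q)) * norm (r - s) ^ Suc 1 / fact 1"
  proof (rule field_Taylor[OF assms(1)])
    show "(f i has_real_derivative f (Suc i) u) (at u within S)" if "u \<in> S" "i \<le> 1" for i u
    proof -
      have "((\<lambda>u. exp (m u)) has_real_derivative exp (m u) * m' u) (at u within S)"
        using m[OF that(1)] by (auto intro!: derivative_eq_intros)
      moreover have "((\<lambda>u. exp (m u) * m' u) has_real_derivative exp (m u) * (m' u * m' u + m'' u)) (at u within S)"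
        using m[OF that(1)] m'[OF that(1)] by (auto intro!: derivative_eq_intros simp: algebra_simps)
      moreover have "i = 0 \<or> i = 1" using that(2) by auto
      ultimately show ?thesis unfolding f_def by auto
    qed
    show "norm (f (Suc 1) u) \<le> 2 * exp (2 * Q)" if "u \<in> S" for u
    proof -
      have "\<bar>m' u * m' u + m'' u\<bar> \<le> Q * Q + Q"
        using bounds[OF that] abs_triangle_ineq[of "m' u * m' u" "m'' u"] mult_mono[of "\<bar>m' u\<bar>" Q "\<bar>m' u\<bar>" Q] assms(4)
        unfolding abs_mult by linarith
      also have "\<dots> \<le> 2 * exp Q"
        using exp_lower_Taylor_quadratic[OF assms(4)] assms(4) by (simp add: power2_eq_square field_simps)
      finally have "norm (f (Suc 1) u) \<le> exp Q * (2 * exp Q)"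
        unfolding f_def using bounds[OF that] by (auto simp: abs_mult intro!: mult_mono)
      then show ?thesis by (simp add: exp_double power2_eq_square)
    qed
  qed (use assms in auto)
  then show ?thesis by (simp add: f_def power2_eq_square algebra_simps abs_mult_self_eq)
qed

context free_semigroup
begin

lemma E_exp_linear_deriv:
  fixes a a' a'' :: "real \<Rightarrow> int \<Rightarrow> real"
  assumes I: "finite I" and s: "s \<in> {0..T}" and B: "0 \<le> B"
    and a: "\<And>r x. r \<in> {0..T} \<Longrightarrow> ((\<lambda>r. a r x) has_real_derivative a' r x) (at r within {0..T})"
    and a': "\<And>r x. r \<in> {0..T} \<Longrightarrow> ((\<lambda>r. a' r x) has_real_derivative a'' r x) (at r within {0..T})"
    and bounds: "\<And>r x. r \<in> {0..T} \<Longrightarrow> \<bar>a r x\<bar> \<le> B \<and> \<bar>a' r x\<bar> \<le> B \<and> \<bar>a'' r x\<bar> \<le> B"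
  shows "((\<lambda>r. E r (\<lambda>\<zeta>. exp (\<Sum>x\<in>I. a r x * real_of_int (\<zeta> x)))) has_real_derivative
      E s (\<lambda>\<zeta>. exp (\<Sum>x\<in>I. a s x * real_of_int (\<zeta> x)) *
        ((\<Sum>x\<in>I. a' s x * real_of_int (\<zeta> x)) + (\<Sum>x\<in>I. exp (a s x * real_of_int (laplacian \<zeta> x)) - 1) / 2)))
      (at s within {0..T})"
proof -
  define f where "f r \<zeta> = exp (\<Sum>x\<in>I. a r x * real_of_int (\<zeta> x))" for r and \<zeta> :: config
  define f' where "f' r \<zeta> = f r \<zeta> * (\<Sum>x\<in>I. a' r x * real_of_int (\<zeta> x))" for r and \<zeta> :: config
  define Q where "Q = B * (\<Sum>x\<in>I. 1 + \<bar>real_of_int x\<bar>)"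
  \<comment> \<open>The exponent and its two time derivatives are at most \<open>Q * (1 + h)\<close>
    for height modulus \<open>h\<close> at 0. Then \<open>2 * exp (2 * Q * (1 + h))\<close> equals
    \<open>c * exp (2 * Q * h)\<close>, and \<open>2 * Q \<le> c\<close> lets \<open>c\<close> serve
    as rate too.\<close>
  define c where "c = 2 * exp (2 * Q)"
  have Q: "0 \<le> Q" unfolding Q_def using B by (intro mult_nonneg_nonneg sum_nonneg) auto
  have tame_f: "tame (f r)" if "r \<in> {0..T}" for r
    unfolding f_def by (rule tame_exp_linear[OF I _ B]) (use bounds that in auto)
  have tame_f': "tame (f' s)"
    unfolding f'_def using tame_f[OF s] I by (intro tame_mult tame_sum tame_cmult tame_height) auto
  have linear_bound: "\<bar>\<Sum>x\<in>I. b x * real_of_int (\<zeta> x)\<bar> \<le> Q * (1 + \<bar>real_of_int (\<zeta> 0)\<bar>)"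
    if "\<zeta> \<in> X0" "\<And>x. \<bar>b x\<bar> \<le> B" for b \<zeta>
  proof -
    have "\<bar>\<Sum>x\<in>I. b x * real_of_int (\<zeta> x)\<bar> \<le> (\<Sum>x\<in>I. B * ((1 + \<bar>real_of_int x\<bar>) * (1 + \<bar>real_of_int (\<zeta> 0)\<bar>)))"
    proof (rule order.trans[OF sum_abs sum_mono])
      fix x
      have "\<bar>real_of_int (\<zeta> x)\<bar> \<le> \<bar>real_of_int (\<zeta> 0)\<bar> + \<bar>real_of_int x\<bar>"
        using X0_height_le[OF that(1), of x] by linarith
      also have "\<dots> \<le> (1 + \<bar>real_of_int x\<bar>) * (1 + \<bar>real_of_int (\<zeta> 0)\<bar>)" by (simp add: algebra_simps)
      finally show "\<bar>b x * real_of_int (\<zeta> x)\<bar> \<le> B * ((1 + \<bar>real_of_int x\<bar>) * (1 + \<bar>real_of_int (\<zeta> 0)\<bar>))"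
        unfolding abs_mult using that(2)[of x] B by (intro mult_mono) auto
    qed
    then show ?thesis unfolding Q_def by (simp add: sum_distrib_left sum_distrib_right mult.assoc)
  qed
  have "((\<lambda>r. E r (f r)) has_real_derivative E s (f' s) + E s (free_generator (f s))) (at s within {0..T})"
  proof (rule E_deriv_time_dependent[where f = f and f' = f' and c = c, OF s _ tame_f tame_f'])
    show "0 \<le> c" by (simp add: c_def)
    fix r \<zeta> assume r: "r \<in> {0..T}" and z: "\<zeta> \<in> X0"
    let ?h = "\<bar>real_of_int (\<zeta> 0)\<bar>"
    have "\<bar>f r \<zeta> - f s \<zeta> - (r - s) * f' s \<zeta>\<bar> \<le> 2 * exp (2 * (Q * (1 + ?h))) * (r - s)\<^sup>2"
      unfolding f_def f'_def
    proof (rule exp_taylor_bound[where S = "{0..T}" and m'' = "\<lambda>r. \<Sum>x\<in>I. a'' r x * real_of_int (\<zeta> x)"])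
      fix u assume u: "u \<in> {0..T}"
      show "((\<lambda>r. \<Sum>x\<in>I. a r x * real_of_int (\<zeta> x)) has_real_derivative (\<Sum>x\<in>I. a' u x * real_of_int (\<zeta> x))) (at u within {0..T})"
        by (intro DERIV_sum DERIV_cmult_right a u)
      show "((\<lambda>r. \<Sum>x\<in>I. a' r x * real_of_int (\<zeta> x)) has_real_derivative (\<Sum>x\<in>I. a'' u x * real_of_int (\<zeta> x))) (at u within {0..T})"
        by (intro DERIV_sum DERIV_cmult_right a' u)
      show "\<bar>\<Sum>x\<in>I. a u x * real_of_int (\<zeta> x)\<bar> \<le> Q * (1 + ?h) \<and> \<bar>\<Sum>x\<in>I. a' u x * real_of_int (\<zeta> x)\<bar> \<le> Q * (1 + ?h)
          \<and> \<bar>\<Sum>x\<in>I. a'' u x * real_of_int (\<zeta> x)\<bar> \<le> Q * (1 + ?h)"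
        using bounds[OF u] by (intro conjI linear_bound z) auto
    qed (use r s Q in auto)
    also have "2 * exp (2 * (Q * (1 + ?h))) = c * exp (2 * Q * ?h)"
      by (simp add: c_def exp_add[symmetric] algebra_simps)
    also have "\<dots> * (r - s)\<^sup>2 \<le> c * exp (c * ?h) * (r - s)\<^sup>2"
    proof -
      have "2 * Q \<le> c" using exp_ge_add_one_self[of "2 * Q"] exp_gt_zero[of "2 * Q"] unfolding c_def by linarith
      then have "2 * Q * ?h \<le> c * ?h" by (intro mult_right_mono) auto
      then show ?thesis using \<open>0 \<le> c\<close> by (intro mult_right_mono mult_left_mono) auto
    qed
    finally show "\<bar>f r \<zeta> - f s \<zeta> - (r - s) * f' s \<zeta>\<bar> \<le> c * (r - s)\<^sup>2 * exp (c * ?h)" by (simp add: ac_simps)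
  qed
  also have "E s (f' s) + E s (free_generator (f s)) = E s (\<lambda>\<zeta>. f' s \<zeta> + free_generator (f s) \<zeta>)"
    using s tame_f[OF s] tame_f' by (intro E_add[symmetric] tame_free_generator) auto
  also have "\<dots> = E s (\<lambda>\<zeta>. f s \<zeta> * ((\<Sum>x\<in>I. a' s x * real_of_int (\<zeta> x))
      + (\<Sum>x\<in>I. exp (a s x * real_of_int (laplacian \<zeta> x)) - 1) / 2))"
    using s by (intro E_cong) (simp_all add: f'_def free_generator_exp_linear[OF I, of _ "a s", folded f_def] distrib_left)
  finally show ?thesis unfolding f_def .
qed

text \<open>The martingale is cut off to the sites \<open>\<bar>x\<bar> \<le> N\<close> to be a local function; summation by parts turns
  the resulting drift into the boundary terms that make up the summand vanishing as \<open>N\<close> grows.\<close>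

lemma exp_moment_sharp_truncated:
  fixes l C :: real and N :: nat
  assumes t: "0 < t" and C: "\<And>s x. 0 < s \<Longrightarrow> heat s x \<le> C / sqrt s"
  shows "E t (\<lambda>\<zeta>. exp (l * real_of_int (\<zeta> 0))) \<le>
    exp (4 * l\<^sup>2 * exp (2 * \<bar>l\<bar>) * C * sqrt t) *
      (exp \<bar>l\<bar> + 2 * \<bar>l\<bar> * exp (2 * t) * exp (\<bar>l\<bar> * exp (2 * t)) * exp ((exp (2 * (1 + \<bar>l\<bar>)) - 1) / 2 * t + (1 + \<bar>l\<bar>))
        * ((real N + 1) * exp (- real N)) * t)"
proof -
  define I where "I = {-int N..int N}"
  \<comment> \<open>The backward heat kernel: its time derivative cancels the first-order part of
    the generator up to the edge of the window, and at \<open>s = t\<close> it is a point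
    mass.\<close>
  define q where "q s x = heat (t - s) x" for s x
  define lap where "lap p x = (p (x + 1) + p (x - 1)) / 2 - p x" for p :: "int \<Rightarrow> real" and x
  define a where "a s x = l * q s x" for s x
  define a1 where "a1 s x = l * - lap (q s) x" for s x
  define a2 where "a2 s x = l * lap (lap (q s)) x" for s x
  define f where "f s \<zeta> = exp (\<Sum>x\<in>I. a s x * real_of_int (\<zeta> x))" for s and \<zeta> :: config
  define D where "D s \<zeta> = (\<Sum>x\<in>I. a1 s x * real_of_int (\<zeta> x)) + (\<Sum>x\<in>I. exp (a s x * real_of_int (laplacian \<zeta> x)) - 1) / 2"
    for s and \<zeta> :: config
  \<comment> \<open>Half, from the jump rate, of 4 l^2 exp(2|l|) C, where 4 is the square of the
    largest Laplacian. In \<open>b\<close> and \<open>e\<close> below, \<open>b\<close> collects the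
    edge error times the bound on \<open>f\<close>, and \<open>e\<close> is its expectation
    bound.\<close>
  define c where "c = 2 * l\<^sup>2 * exp (2 * \<bar>l\<bar>) * C"
  define b where "b = 2 * \<bar>l\<bar> * exp (2 * t) * exp (\<bar>l\<bar> * exp (2 * t)) * ((real N + 1) * exp (- real N))"
  define e where "e = b * exp ((exp (2 * (1 + \<bar>l\<bar>)) - 1) / 2 * t + (1 + \<bar>l\<bar>))"
  have fin: "finite I" by (simp add: I_def)
  have q01: "0 \<le> q s x" "q s x \<le> 1" if "s \<in> {0..t}" for s x
    using that by (auto simp: q_def heat_nonneg heat_le_1)
  have dq: "((\<lambda>s. q s x) has_real_derivative - lap (q s) x) (at s within S)" for s x S
  proof -
    have "((\<lambda>s. t - s) has_real_derivative - 1) (at s within S)" by (auto intro!: derivative_eq_intros)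
    from DERIV_chain'[OF this heat_deriv, of x] show ?thesis by (simp add: q_def lap_def)
  qed
  have lap_bound: "\<bar>lap p x\<bar> \<le> 2 * K" if "\<And>x. \<bar>p x\<bar> \<le> K" for p x K
    using that[of x] that[of "x + 1"] that[of "x - 1"] by (simp add: lap_def abs_le_iff field_simps)
  have "\<bar>q s x\<bar> \<le> 1" if "s \<in> {0..t}" for s x using q01[OF that] by simp
  then have lap1: "\<bar>lap (q s) x\<bar> \<le> 2" and lap2: "\<bar>lap (lap (q s)) x\<bar> \<le> 4" if "s \<in> {0..t}" for s x
    using lap_bound[of "q s" 1] lap_bound[of "lap (q s)" 2] that by auto
  have du: "((\<lambda>s. E s (f s)) has_real_derivative E s (\<lambda>\<zeta>. f s \<zeta> * D s \<zeta>)) (at s within {0..t})" if s: "s \<in> {0..t}" for s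
    unfolding f_def D_def
  \<comment> \<open>As \<open>0 \<le> q \<le> 1\<close> and each \<open>lap\<close> at most doubles
    a supremum bound, 4 covers \<open>q\<close> and its first two time derivatives.\<close>
  proof (rule E_exp_linear_deriv[OF fin s, where B = "\<bar>l\<bar> * 4" and a'' = a2])
    show "((\<lambda>r. a r x) has_real_derivative a1 r x) (at r within {0..t})" for r x
      unfolding a_def a1_def by (intro DERIV_cmult dq)
    have "((\<lambda>r. lap (q r) x) has_real_derivative - lap (lap (q r)) x) (at r within {0..t})" for r x
    proof -
      have "((\<lambda>r. (q r (x + 1) + q r (x - 1)) / 2 - q r x) has_real_derivative
          (- lap (q r) (x + 1) + - lap (q r) (x - 1)) / 2 - - lap (q r) x) (at r within {0..t})"
        by (intro DERIV_diff DERIV_cdivide DERIV_add dq)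
      moreover have "(- lap (q r) (x + 1) + - lap (q r) (x - 1)) / 2 - - lap (q r) x = - lap (lap (q r)) x"
        unfolding lap_def[of "lap (q r)"] by (simp add: field_simps)
      moreover have "(\<lambda>r. lap (q r) x) = (\<lambda>r. (q r (x + 1) + q r (x - 1)) / 2 - q r x)" by (simp add: lap_def)
      ultimately show ?thesis by (simp only:)
    qed
    from DERIV_cmult[OF DERIV_minus[OF this]]
    show "((\<lambda>r. a1 r x) has_real_derivative a2 r x) (at r within {0..t})" for r x
      unfolding a1_def a2_def by simp
    show "\<bar>a r x\<bar> \<le> \<bar>l\<bar> * 4 \<and> \<bar>a1 r x\<bar> \<le> \<bar>l\<bar> * 4 \<and> \<bar>a2 r x\<bar> \<le> \<bar>l\<bar> * 4" if "r \<in> {0..t}" for r x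
      unfolding a_def a1_def a2_def abs_mult using q01[OF that, of x] lap1[OF that, of x] lap2[OF that, of x]
      by (intro conjI mult_left_mono) auto
  qed auto
  have tame_f: "tame (f s)" if "s \<in> {0..t}" for s
    unfolding f_def
  proof (rule tame_exp_linear[OF fin, where B = "\<bar>l\<bar>"])
    show "\<bar>a s x\<bar> \<le> \<bar>l\<bar>" for x
      unfolding a_def abs_mult using q01[OF that, of x] by (intro mult_left_le) auto
  qed simp
  \<comment> \<open>Uniform in \<open>N\<close>: the height at \<open>x\<close> is split into the
    height at 0, weighted by mass at most 1, and a distance controlled by the exponential moment of
    the kernel.\<close>
  have f_bound: "f s \<zeta> \<le> exp (\<bar>l\<bar> * exp (2 * t)) * exp (\<bar>l\<bar> * \<bar>real_of_int (\<zeta> 0)\<bar>)"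
    if s: "s \<in> {0..t}" and z: "\<zeta> \<in> X0" for s \<zeta>
  proof -
    let ?h = "\<bar>real_of_int (\<zeta> 0)\<bar>"
    have "(\<Sum>x\<in>I. a s x * real_of_int (\<zeta> x)) \<le> (\<Sum>x\<in>I. \<bar>l\<bar> * (q s x * ?h + q s x * exp \<bar>real_of_int x\<bar>))"
    proof (rule sum_mono)
      fix x
      have "\<bar>real_of_int (\<zeta> x)\<bar> \<le> ?h + exp \<bar>real_of_int x\<bar>"
        using X0_height_le[OF z, of x] exp_ge_add_one_self[of "\<bar>real_of_int x\<bar>"] by linarith
      then have "\<bar>l\<bar> * (q s x * \<bar>real_of_int (\<zeta> x)\<bar>) \<le> \<bar>l\<bar> * (q s x * (?h + exp \<bar>real_of_int x\<bar>))"
        using q01[OF s] by (intro mult_left_mono) auto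
      moreover have "a s x * real_of_int (\<zeta> x) \<le> \<bar>l\<bar> * (q s x * \<bar>real_of_int (\<zeta> x)\<bar>)"
        using abs_ge_self[of "a s x * real_of_int (\<zeta> x)"] q01(1)[OF s, of x] by (simp add: a_def abs_mult mult.assoc)
      ultimately show "a s x * real_of_int (\<zeta> x) \<le> \<bar>l\<bar> * (q s x * ?h + q s x * exp \<bar>real_of_int x\<bar>)"
        by (simp add: distrib_left)
    qed
    also have "\<dots> = \<bar>l\<bar> * ((\<Sum>x\<in>I. q s x) * ?h + (\<Sum>x\<in>I. q s x * exp \<bar>real_of_int x\<bar>))"
      by (simp add: sum_distrib_left[symmetric] sum.distrib sum_distrib_right[symmetric])
    also have "\<dots> \<le> \<bar>l\<bar> * (1 * ?h + exp (2 * t))"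
    proof (intro mult_left_mono add_mono mult_right_mono)
      show "(\<Sum>x\<in>I. q s x) \<le> 1" unfolding q_def I_def using s by (intro heat_sum_le_1) auto
      have "(\<Sum>x\<in>I. q s x * exp \<bar>real_of_int x\<bar>) \<le> exp (2 * (t - s))"
        unfolding q_def I_def using s by (intro heat_exp_sum) auto
      also have "\<dots> \<le> exp (2 * t)" using s by simp
      finally show "(\<Sum>x\<in>I. q s x * exp \<bar>real_of_int x\<bar>) \<le> exp (2 * t)" .
    qed auto
    finally show ?thesis unfolding f_def by (simp add: exp_add[symmetric] algebra_simps)
  qed
  have D_bound: "D s \<zeta> \<le> c / sqrt (t - s) + 2 * \<bar>l\<bar> * exp (2 * t) * ((real N + 1) * exp (- real N)) * exp \<bar>real_of_int (\<zeta> 0)\<bar>"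
    if s: "s \<in> {0<..<t}" and z: "\<zeta> \<in> X0" for s \<zeta>
  proof -
    let ?h = "\<bar>real_of_int (\<zeta> 0)\<bar>"
    let ?L = "\<lambda>x. real_of_int (laplacian \<zeta> x)"
    let ?z = "\<lambda>x. real_of_int (\<zeta> x)"
    have s': "s \<in> {0..t}" using s by auto
    \<comment> \<open>Adding and subtracting the linear term of the exponential leaves a quadratic
      remainder and a sum to which the Green identity applies.\<close>
    have D_eq: "D s \<zeta> = (\<Sum>x\<in>I. exp (a s x * ?L x) - 1 - a s x * ?L x) / 2
       + l / 2 * (\<Sum>x\<in>I. q s x * (?z (x + 1) - 2 * ?z x + ?z (x - 1)) - ?z x * (q s (x + 1) - 2 * q s x + q s (x - 1)))"
      unfolding D_def sum_distrib_left sum_divide_distrib sum.distrib[symmetric]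
      by (intro sum.cong) (auto simp: a_def a1_def lap_def laplacian_def field_simps)
    have "(\<Sum>x\<in>I. exp (a s x * ?L x) - 1 - a s x * ?L x) \<le> (\<Sum>x\<in>I. 4 * l\<^sup>2 * exp (2 * \<bar>l\<bar>) * (q s x)\<^sup>2)"
    proof (rule sum_mono)
      fix x
      have L: "\<bar>?L x\<bar> \<le> 2" "(?L x)\<^sup>2 \<le> 4" using X0_laplacian[OF z, of x] by auto
      have "\<bar>a s x * ?L x\<bar> \<le> (\<bar>l\<bar> * 1) * 2"
        unfolding a_def abs_mult using L q01[OF s', of x] by (intro mult_mono) auto
      then have "exp \<bar>a s x * ?L x\<bar> \<le> exp (2 * \<bar>l\<bar>)" by simp
      moreover have "(a s x * ?L x)\<^sup>2 \<le> (l\<^sup>2 * (q s x)\<^sup>2) * 4"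
        unfolding a_def power_mult_distrib using L by (intro mult_left_mono) auto
      ultimately have "(a s x * ?L x)\<^sup>2 * exp \<bar>a s x * ?L x\<bar> \<le> (l\<^sup>2 * (q s x)\<^sup>2) * 4 * exp (2 * \<bar>l\<bar>)"
        by (intro mult_mono) auto
      then show "exp (a s x * ?L x) - 1 - a s x * ?L x \<le> 4 * l\<^sup>2 * exp (2 * \<bar>l\<bar>) * (q s x)\<^sup>2"
        using exp_minus_one_minus_le[of "a s x * ?L x"] by (simp add: ac_simps)
    qed
    also have "\<dots> \<le> 4 * l\<^sup>2 * exp (2 * \<bar>l\<bar>) * (C / sqrt (t - s))"
      unfolding sum_distrib_left[symmetric] q_def I_def using s C
      by (intro mult_left_mono heat_sq_sum_le) auto
    finally have first: "(\<Sum>x\<in>I. exp (a s x * ?L x) - 1 - a s x * ?L x) / 2 \<le> c / sqrt (t - s)"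
      by (simp add: c_def)
    define W where "W = exp (2 * t) * exp (- real N) * ((real N + 1) * exp ?h)"
    \<comment> \<open>At the ends of the window the kernel is of order exp(-N), while heights there
      grow at most linearly in \<open>N\<close>.\<close>
    have edge: "\<bar>q s x * ?z y\<bar> \<le> W" if "real N \<le> \<bar>real_of_int x\<bar>" "\<bar>real_of_int y\<bar> \<le> real N + 1" for x y
    proof -
      have "q s x \<le> exp (2 * (t - s)) * exp (- \<bar>real_of_int x\<bar>)" unfolding q_def using s by (intro heat_le_exp) auto
      also have "\<dots> \<le> exp (2 * t) * exp (- real N)" using s that(1) by (intro mult_mono) auto
      finally have "q s x \<le> exp (2 * t) * exp (- real N)" .
      moreover have "\<bar>?z y\<bar> \<le> (real N + 1) * exp ?h"
      proof -
        have "\<bar>?z y\<bar> \<le> ?h + (real N + 1)" using X0_height_le[OF z, of y] that(2) by linarith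
        also have "\<dots> \<le> (real N + 1) * (1 + ?h)" by (simp add: algebra_simps)
        also have "\<dots> \<le> (real N + 1) * exp ?h" by (intro mult_left_mono) (auto simp: exp_ge_add_one_self)
        finally show ?thesis .
      qed
      ultimately show ?thesis
        unfolding W_def abs_mult using q01(1)[OF s', of x] by (intro mult_mono) auto
    qed
    have "\<bar>(q s (int N) * ?z (int N + 1) - q s (int N + 1) * ?z (int N))
        - (q s (- int N - 1) * ?z (- int N) - q s (- int N) * ?z (- int N - 1))\<bar> \<le> 4 * W"
      using edge[of "int N" "int N + 1"] edge[of "int N + 1" "int N"] edge[of "- int N - 1" "- int N"] edge[of "- int N" "- int N - 1"]
      by (simp add: abs_le_iff)
    then have "\<bar>l / 2 * (\<Sum>x\<in>I. q s x * (?z (x + 1) - 2 * ?z x + ?z (x - 1)) - ?z x * (q s (x + 1) - 2 * q s x + q s (x - 1)))\<bar>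
        \<le> \<bar>l / 2\<bar> * (4 * W)"
      unfolding I_def sum_laplacian_by_parts[of "q s" ?z] abs_mult by (intro mult_left_mono) auto
    also have "\<dots> = 2 * \<bar>l\<bar> * exp (2 * t) * ((real N + 1) * exp (- real N)) * exp ?h" by (simp add: W_def)
    finally show ?thesis unfolding D_eq using first by linarith
  qed
  \<comment> \<open>The function \<open>- (2 * c * sqrt (t - s))\<close> is a primitive of the
    singular rate; its increment \<open>2 * c * sqrt t\<close> is the source of the diffusive square
    root.\<close>
  have "E t (f t) \<le> exp ((\<lambda>s. - (2 * c * sqrt (t - s))) t - (\<lambda>s. - (2 * c * sqrt (t - s))) 0) * (E 0 (f 0) + e * t)"
  proof (rule gronwall[where u = "\<lambda>s. E s (f s)" and k = "\<lambda>s. c / sqrt (t - s)"])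
    have c: "0 \<le> c"
    proof -
      have "0 \<le> C / sqrt 1" using C[of 1 0] heat_nonneg[of 1 0] by linarith
      then show ?thesis by (simp add: c_def)
    qed
    then show "0 \<le> c / sqrt (t - s)" if "s \<in> {0<..<t}" for s using that by simp
    show "0 \<le> e" by (simp add: e_def b_def)
    show "((\<lambda>s. - (2 * c * sqrt (t - s))) has_real_derivative c / sqrt (t - s)) (at s)" if "s \<in> {0<..<t}" for s
      using that by (auto intro!: derivative_eq_intros simp: field_simps)
    show "continuous_on {0..t} (\<lambda>s. - (2 * c * sqrt (t - s)))" by (intro continuous_intros)
    show "((\<lambda>s. E s (f s)) has_real_derivative E s (\<lambda>\<zeta>. f s \<zeta> * D s \<zeta>)) (at s within {0..t})" if "s \<in> {0..t}" for s
      by (rule du[OF that])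
    show "E s (\<lambda>\<zeta>. f s \<zeta> * D s \<zeta>) \<le> c / sqrt (t - s) * E s (f s) + e" if s: "s \<in> {0<..<t}" for s
    proof -
      have s': "s \<in> {0..t}" "0 \<le> s" using s by auto
      let ?g = "\<lambda>\<zeta>. b * exp ((1 + \<bar>l\<bar>) * \<bar>real_of_int (\<zeta> 0)\<bar>)"
      have tame_g: "tame ?g"
        by (rule tameI[of "{0}" _ "\<bar>b\<bar>" "1 + \<bar>l\<bar>"]) (auto simp: local_on_def abs_mult)
      have tame_D: "tame (D s)"
      proof -
        \<comment> \<open>The Laplacian is written as a linear functional of three heights so that
          \<open>tame_exp_linear\<close> applies.\<close>
        have "(\<Sum>y\<in>{x - 1, x, x + 1}. (if y = x then - 2 else 1) * a s x * real_of_int (\<zeta> y))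
            = a s x * real_of_int (laplacian \<zeta> x)" for x \<zeta>
          by (simp add: laplacian_def algebra_simps)
        moreover have "tame (\<lambda>\<zeta>. exp (\<Sum>y\<in>{x - 1, x, x + 1}. (if y = x then - 2 else 1) * a s x * real_of_int (\<zeta> y)))" for x
          by (rule tame_exp_linear[where B = "2 * \<bar>a s x\<bar>"]) (auto simp: abs_mult)
        ultimately have "tame (\<lambda>\<zeta>. exp (a s x * real_of_int (laplacian \<zeta> x)))" for x by (simp only:)
        then have "tame (\<lambda>\<zeta>. (\<Sum>x\<in>I. a1 s x * real_of_int (\<zeta> x)) + 1 / 2 * (\<Sum>x\<in>I. exp (a s x * real_of_int (laplacian \<zeta> x)) - 1))"
          by (intro tame_add tame_cmult tame_sum fin tame_height tame_diff tame_const)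
        then show ?thesis by (simp add: D_def[abs_def])
      qed
      have "E s (\<lambda>\<zeta>. f s \<zeta> * D s \<zeta>) \<le> E s (\<lambda>\<zeta>. c / sqrt (t - s) * f s \<zeta> + ?g \<zeta>)"
      proof (rule E_mono[OF s'(2) tame_mult[OF tame_f[OF s'(1)] tame_D] tame_add[OF tame_cmult[OF tame_f[OF s'(1)]] tame_g]])
        fix \<zeta> assume z: "\<zeta> \<in> X0"
        let ?h = "\<bar>real_of_int (\<zeta> 0)\<bar>"
        let ?r = "2 * \<bar>l\<bar> * exp (2 * t) * ((real N + 1) * exp (- real N)) * exp ?h"
        have "f s \<zeta> * D s \<zeta> \<le> f s \<zeta> * (c / sqrt (t - s) + ?r)"
          using D_bound[OF s z] by (intro mult_left_mono) (auto simp: f_def)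
        then have "f s \<zeta> * D s \<zeta> \<le> c / sqrt (t - s) * f s \<zeta> + f s \<zeta> * ?r"
          unfolding distrib_left[of "f s \<zeta>" "c / sqrt (t - s)" ?r] mult.commute[of "f s \<zeta>" "c / sqrt (t - s)"] .
        moreover have "f s \<zeta> * ?r \<le> exp (\<bar>l\<bar> * exp (2 * t)) * exp (\<bar>l\<bar> * ?h) * ?r"
          using f_bound[OF s'(1) z] by (intro mult_right_mono) auto
        moreover have "exp (\<bar>l\<bar> * exp (2 * t)) * exp (\<bar>l\<bar> * ?h) * ?r = ?g \<zeta>"
        proof -
          have "exp ((1 + \<bar>l\<bar>) * ?h) = exp ?h * exp (\<bar>l\<bar> * ?h)" by (simp add: distrib_right exp_add)
          then show ?thesis by (simp only: b_def ac_simps)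
        qed
        ultimately show "f s \<zeta> * D s \<zeta> \<le> c / sqrt (t - s) * f s \<zeta> + ?g \<zeta>"
          by linarith
      qed
      also have "\<dots> = c / sqrt (t - s) * E s (f s) + E s ?g"
        by (simp only: E_add[OF s'(2) tame_cmult[OF tame_f[OF s'(1)]] tame_g] E_cmult)
      also have "E s ?g \<le> e"
      proof -
        have "E s ?g \<le> b * exp ((exp (2 * (1 + \<bar>l\<bar>)) - 1) / 2 * s + (1 + \<bar>l\<bar>))"
          unfolding E_cmult by (intro mult_left_mono exp_moment(2)) (use s' in \<open>auto simp: b_def\<close>)
        also have "\<dots> \<le> e"
          unfolding e_def using s' by (intro mult_left_mono) (auto simp: b_def intro!: mult_left_mono)
        finally show ?thesis .
      qed
      finally show ?thesis by simp
    qed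
  qed (use t in auto)
  also have "\<dots> = exp (2 * c * sqrt t) * (E 0 (f 0) + e * t)" by simp
  also have "E 0 (f 0) \<le> exp \<bar>l\<bar>"
  proof -
    have "local_on I (f 0)" unfolding f_def local_on_def by (intro ballI impI arg_cong[of _ _ exp] sum.cong) auto
    then have "E 0 (f 0) = f 0 flat_config" by (rule E_0[OF fin])
    moreover have "(\<Sum>x\<in>I. a 0 x * real_of_int (flat_config x)) \<le> \<bar>l\<bar> * (\<Sum>x\<in>I. q 0 x)"
      unfolding sum_distrib_left
    proof (rule sum_mono)
      fix x
      have "\<bar>a 0 x * real_of_int (flat_config x)\<bar> \<le> \<bar>l\<bar> * q 0 x * 1"
        unfolding a_def abs_mult using q01[of 0 x] t by (intro mult_mono) (auto simp: flat_config_def)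
      then show "a 0 x * real_of_int (flat_config x) \<le> \<bar>l\<bar> * q 0 x" by simp
    qed
    moreover have "\<bar>l\<bar> * (\<Sum>x\<in>I. q 0 x) \<le> \<bar>l\<bar> * 1"
      unfolding q_def I_def using t by (intro mult_left_mono heat_sum_le_1) auto
    ultimately show ?thesis unfolding f_def by simp
  qed
  also have "E t (f t) = E t (\<lambda>\<zeta>. exp (l * real_of_int (\<zeta> 0)))"
  proof -
    have "(\<Sum>x\<in>I. a t x * real_of_int (\<zeta> x)) = (\<Sum>x\<in>I. if x = 0 then l * real_of_int (\<zeta> 0) else 0)" for \<zeta> :: config
      by (intro sum.cong) (auto simp: a_def q_def heat_0)
    then show ?thesis by (simp add: f_def[abs_def] fin I_def)
  qed
  finally show ?thesis by (simp add: c_def e_def b_def ac_simps)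
qed

text \<open>At fixed \<open>t\<close> and \<open>l\<close> the window grows; the error constant
  \<open>B\<close>, although doubly exponential in \<open>t\<close>, does not involve
  \<open>N\<close> and is killed by the factor exp(-N).\<close>

lemma exp_moment_sharp:
  "\<exists>C\<ge>0. \<forall>t>0. \<forall>l. E t (\<lambda>\<zeta>. exp (l * real_of_int (\<zeta> 0))) \<le> exp (C * l\<^sup>2 * exp (2 * \<bar>l\<bar>) * sqrt t + \<bar>l\<bar>)"
proof -
  obtain C where C: "0 \<le> C" "\<And>s x. 0 < s \<Longrightarrow> heat s x \<le> C / sqrt s"
    using heat_le_inverse_sqrt by blast
  have "E t (\<lambda>\<zeta>. exp (l * real_of_int (\<zeta> 0))) \<le> exp (4 * C * l\<^sup>2 * exp (2 * \<bar>l\<bar>) * sqrt t + \<bar>l\<bar>)" if t: "0 < t" for t l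
  proof -
    define A where "A = exp (4 * l\<^sup>2 * exp (2 * \<bar>l\<bar>) * C * sqrt t)"
    define B where "B = 2 * \<bar>l\<bar> * exp (2 * t) * exp (\<bar>l\<bar> * exp (2 * t)) * exp ((exp (2 * (1 + \<bar>l\<bar>)) - 1) / 2 * t + (1 + \<bar>l\<bar>))"
    have "(\<lambda>N. (real N + 1) * exp (- real N)) \<longlonglongrightarrow> 0" by real_asymp
    then have "(\<lambda>N. A * (exp \<bar>l\<bar> + B * ((real N + 1) * exp (- real N)) * t)) \<longlonglongrightarrow> A * (exp \<bar>l\<bar> + B * 0 * t)"
      by (intro tendsto_intros)
    then have "E t (\<lambda>\<zeta>. exp (l * real_of_int (\<zeta> 0))) \<le> A * (exp \<bar>l\<bar> + B * 0 * t)"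
      by (rule LIMSEQ_le_const) (use exp_moment_sharp_truncated[OF t C(2), of l] in \<open>auto simp: A_def B_def\<close>)
    then show ?thesis by (simp add: A_def exp_add ac_simps)
  qed
  then show ?thesis using C(1) by (intro exI[of _ "4 * C"]) auto
qed

end

lemma tame_exp_abs_height: "tame (\<lambda>\<zeta>. exp \<bar>real_of_int (\<zeta> x) / c\<bar>)"
proof (rule tameI[of "{x}"])
  show "local_on {x} (\<lambda>\<zeta>. exp \<bar>real_of_int (\<zeta> x) / c\<bar>)" by (simp add: local_on_def)
  fix \<zeta> assume "\<zeta> \<in> X0"
  then have "\<bar>real_of_int (\<zeta> x)\<bar> \<le> \<bar>real_of_int (\<zeta> 0)\<bar> + \<bar>real_of_int x\<bar>"
    using X0_height_le[of \<zeta> x] by linarith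
  then have "\<bar>inverse c\<bar> * \<bar>real_of_int (\<zeta> x)\<bar> \<le> \<bar>inverse c\<bar> * (\<bar>real_of_int (\<zeta> 0)\<bar> + \<bar>real_of_int x\<bar>)"
    by (rule mult_left_mono) simp
  moreover have "\<bar>real_of_int (\<zeta> x) / c\<bar> = \<bar>inverse c\<bar> * \<bar>real_of_int (\<zeta> x)\<bar>"
    by (simp add: divide_inverse abs_mult)
  ultimately show "\<bar>exp \<bar>real_of_int (\<zeta> x) / c\<bar>\<bar> \<le> exp (\<bar>inverse c\<bar> * \<bar>real_of_int x\<bar>) * exp (\<bar>inverse c\<bar> * \<bar>real_of_int (\<zeta> 0)\<bar>)"
    by (simp add: exp_add[symmetric] distrib_left)
qed simp

context free_semigroup
begin

text \<open>With l = t^(-1/4) the product l^2 sqrt t is 1 and l is at most its value at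
  \<open>t0\<close>; both signs of \<open>l\<close> control the modulus. No bound uniform down to
  time 0 can hold: height 2 at the origin has probability of order t, whereas exp(2 t^(-1/4))
  outgrows every power of 1/t.\<close>

lemma scaled_exp_moment_bound:
  assumes "0 < t0"
  shows "\<exists>B\<ge>0. \<forall>t\<ge>t0. E t (\<lambda>\<zeta>. exp \<bar>real_of_int (\<zeta> 0) / t powr (1 / 4)\<bar>) \<le> B"
proof -
  obtain C where C: "0 \<le> C"
    "\<And>t l. 0 < t \<Longrightarrow> E t (\<lambda>\<zeta>. exp (l * real_of_int (\<zeta> 0))) \<le> exp (C * l\<^sup>2 * exp (2 * \<bar>l\<bar>) * sqrt t + \<bar>l\<bar>)"
    using exp_moment_sharp by blast
  define l0 where "l0 = t0 powr - (1 / 4)"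
  have "E t (\<lambda>\<zeta>. exp \<bar>real_of_int (\<zeta> 0) / t powr (1 / 4)\<bar>) \<le> 2 * exp (C * exp (2 * l0) + l0)" if t: "t \<ge> t0" for t
  proof -
    define l where "l = t powr - (1 / 4)"
    have "0 < t" using assms t by simp
    have l: "0 \<le> l" "l \<le> l0"
      using t assms by (auto simp: l_def l0_def intro!: powr_mono2')
    have "l\<^sup>2 * sqrt t = 1"
    proof -
      have "l\<^sup>2 = t powr (- (1 / 2))" unfolding l_def power2_eq_square powr_add[symmetric] by simp
      moreover have "sqrt t = t powr (1 / 2)" using \<open>0 < t\<close> by (simp add: powr_half_sqrt)
      moreover have "t powr (- (1 / 2)) * t powr (1 / 2) = 1" using \<open>0 < t\<close> unfolding powr_add[symmetric] by simp
      ultimately show ?thesis by (simp only:)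
    qed
    moreover have "C * l\<^sup>2 * exp (2 * l) * sqrt t = C * exp (2 * l) * (l\<^sup>2 * sqrt t)" by (simp only: ac_simps)
    ultimately have "C * l\<^sup>2 * exp (2 * l) * sqrt t = C * exp (2 * l)" by (simp only: mult_1_right)
    also have "\<dots> \<le> C * exp (2 * l0)" using C(1) l by (intro mult_left_mono) auto
    finally have expo: "exp (C * l\<^sup>2 * exp (2 * l) * sqrt t + l) \<le> exp (C * exp (2 * l0) + l0)" using l by simp
    have tame: "tame (\<lambda>\<zeta>. exp (k * real_of_int (\<zeta> 0)))" for k
      using tame_exp_linear[of "{0}" "\<lambda>_. k" "\<bar>k\<bar>"] by simp
    have "E t (\<lambda>\<zeta>. exp \<bar>real_of_int (\<zeta> 0) / t powr (1 / 4)\<bar>)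
        \<le> E t (\<lambda>\<zeta>. exp (l * real_of_int (\<zeta> 0)) + exp ((- l) * real_of_int (\<zeta> 0)))"
    proof (rule E_mono[OF less_imp_le[OF \<open>0 < t\<close>] tame_exp_abs_height tame_add[OF tame tame]])
      fix \<zeta> :: config
      have "real_of_int (\<zeta> 0) / t powr (1 / 4) = l * real_of_int (\<zeta> 0)"
        unfolding l_def powr_minus divide_inverse by (rule mult.commute)
      then show "exp \<bar>real_of_int (\<zeta> 0) / t powr (1 / 4)\<bar> \<le> exp (l * real_of_int (\<zeta> 0)) + exp ((- l) * real_of_int (\<zeta> 0))"
        by (simp add: abs_if)
    qed
    also have "\<dots> = E t (\<lambda>\<zeta>. exp (l * real_of_int (\<zeta> 0))) + E t (\<lambda>\<zeta>. exp ((- l) * real_of_int (\<zeta> 0)))"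
      using \<open>0 < t\<close> by (intro E_add tame) auto
    also have "\<dots> \<le> exp (C * exp (2 * l0) + l0) + exp (C * exp (2 * l0) + l0)"
    proof (rule add_mono)
      show "E t (\<lambda>\<zeta>. exp (l * real_of_int (\<zeta> 0))) \<le> exp (C * exp (2 * l0) + l0)"
        using order.trans[OF C(2)[OF \<open>0 < t\<close>, of l, unfolded abs_of_nonneg[OF l(1)]] expo] .
      show "E t (\<lambda>\<zeta>. exp ((- l) * real_of_int (\<zeta> 0))) \<le> exp (C * exp (2 * l0) + l0)"
        using order.trans[OF C(2)[OF \<open>0 < t\<close>, of "- l", unfolded abs_minus_cancel power2_minus abs_of_nonneg[OF l(1)]] expo] .
    qed
    finally show ?thesis by simp
  qed
  then show ?thesis by (intro exI[of _ "2 * exp (C * exp (2 * l0) + l0)"]) auto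
qed

end

section \<open>From the process to the theorem\<close>

text \<open>The Markov property at time 0 equates a conditional expectation with
  \<open>measure (P t z) B\<close> almost surely, because the start is almost surely
  \<open>z\<close>. Taking expectations removes the conditioning and leaves the one-time
  law.\<close>

lemma markov_process_law:
  assumes markov: "markov_process M S P Z" and start: "AE \<omega> in M. Z 0 \<omega> = z" and "0 \<le> t" and z: "z \<in> space S"
  shows "distr M S (Z t) = P t z"
proof -
  interpret prob_space M using markov by (simp add: markov_process_def)
  have Z: "Z r \<in> M \<rightarrow>\<^sub>M S" if "0 \<le> r" for r using markov that by (simp add: markov_process_def)
  have "P t \<in> S \<rightarrow>\<^sub>M prob_algebra S"
    using markov assms(3) by (simp add: markov_process_def transition_semigroup_def)
  from measurable_space[OF this z] have P: "prob_space (P t z)" "sets (P t z) = sets S"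
    by (auto simp: space_prob_algebra)
  interpret P: prob_space "P t z" by (rule P(1))
  interpret D: prob_space "distr M S (Z t)" by (rule prob_space_distr[OF Z[OF assms(3)]])
  define F where "F = past M S Z 0"
  have gen: "(\<Union>r\<in>{0..0}. {Z r -` B \<inter> space M |B. B \<in> sets S}) \<subseteq> sets M"
    using measurable_sets[OF Z[of 0]] by auto
  then have "subalgebra M F"
    unfolding subalgebra_def F_def past_def
    using sets.sigma_sets_subset[OF gen] sets.space_closed[of M] by (auto simp: space_measure_of_conv)
  then interpret finite_measure_subalgebra M F by unfold_locales
  show ?thesis
  proof (rule measure_eqI)
    fix B assume "B \<in> sets (distr M S (Z t))"
    then have B: "B \<in> sets S" by simp
    let ?A = "Z t -` B \<inter> space M"
    have A: "?A \<in> sets M" by (rule measurable_sets[OF Z[OF assms(3)] B])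
    have "\<forall>s\<ge>0. \<forall>t\<ge>0. \<forall>B\<in>sets S. AE \<omega> in M.
        real_cond_exp M (past M S Z s) (indicat_real (Z (s + t) -` B \<inter> space M)) \<omega> = measure (P t (Z s \<omega>)) B"
      using markov unfolding markov_process_def by blast
    from this[rule_format, of 0 t B]
    have "AE \<omega> in M. real_cond_exp M F (indicat_real ?A) \<omega> = measure (P t (Z 0 \<omega>)) B"
      using B assms(3) by (simp add: F_def)
    with start have "AE \<omega> in M. real_cond_exp M F (indicat_real ?A) \<omega> = measure (P t z) B"
      by eventually_elim simp
    then have "(\<integral>\<omega>. real_cond_exp M F (indicat_real ?A) \<omega> \<partial>M) = (\<integral>\<omega>. measure (P t z) B \<partial>M)"
      by (intro integral_cong_AE) auto
    moreover have "(\<integral>\<omega>. real_cond_exp M F (indicat_real ?A) \<omega> \<partial>M) = measure M ?A"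
    proof -
      have "integrable M (indicat_real ?A)"
        using A by (intro integrable_real_indicator) (auto simp: emeasure_eq_measure)
      then show ?thesis using A by (simp add: real_cond_exp_int(2))
    qed
    ultimately have "measure (distr M S (Z t)) B = measure (P t z) B"
      by (simp add: measure_distr[OF Z[OF assms(3)] B] prob_space)
    then show "emeasure (distr M S (Z t)) B = emeasure (P t z) B"
      by (simp add: P.emeasure_eq_measure D.emeasure_eq_measure)
  qed (simp add: P(2))
qed

theorem lemma58:
  fixes M :: "'a measure" and Z :: "real \<Rightarrow> 'a \<Rightarrow> int \<Rightarrow> int"
  assumes "free_process M Z"
    and "AE \<omega> in M. Z 0 \<omega> = flat_config"
  shows
    "((\<lambda>t. prob_space.variance M (\<lambda>\<omega>. real_of_int (Z t \<omega> 0)) / sqrt t)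
        \<longlongrightarrow> 1 / sqrt pi) at_top \<and>
     (\<forall>t0>0. (SUP t\<in>{t0..}. \<integral>\<^sup>+\<omega>. ennreal (exp \<bar>real_of_int (Z t \<omega> 0) / t powr (1 / 4)\<bar>) \<partial>M) < \<infinity>) \<and>
     (\<exists>c::real. \<forall>K>0. \<forall>\<^sub>F t in at_top.
        measure M {\<omega> \<in> space M. \<bar>real_of_int (Z t \<omega> 0)\<bar> > K * t powr (1 / 4) * ln t}
          \<le> c * t powr (- K))"
proof -
  obtain P where markov: "markov_process M X0_space P Z" and generator: "has_free_generator P"
    using assms(1) by (auto simp: free_process_def)
  interpret prob_space M using markov by (simp add: markov_process_def)
  interpret free_semigroup P
    by unfold_locales (use markov generator in \<open>auto simp: markov_process_def\<close>)
  have Z: "Z t \<in> M \<rightarrow>\<^sub>M X0_space" if "0 \<le> t" for t using markov that by (simp add: markov_process_def)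
  have law: "distr M X0_space (Z t) = P t flat_config" if "0 \<le> t" for t
    by (rule markov_process_law[OF markov assms(2) that]) (simp add: space_X0_space flat_config_X0)
  have tame_measurable: "f \<in> borel_measurable X0_space" if "tame f" for f
    using that local_on_measurable by (auto simp: tame_def)
  have expectation_E: "integrable M (\<lambda>\<omega>. f (Z t \<omega>))" "expectation (\<lambda>\<omega>. f (Z t \<omega>)) = E t f" if "0 \<le> t" "tame f" for f t
    using tame_integrable[OF that(2,1)] integrable_distr[OF Z[OF that(1)], of f]
      integral_distr[OF Z[OF that(1)] tame_measurable[OF that(2)]] law[OF that(1)]
    by (auto simp: E_def)

  have variance: "variance (\<lambda>\<omega>. real_of_int (Z t \<omega> 0)) = heat_integral t + (mean_height t 0 - (mean_height t 0)\<^sup>2)"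
    if "0 \<le> t" for t
  proof -
    have sq: "tame (\<lambda>\<zeta>. real_of_int (\<zeta> 0) * real_of_int (\<zeta> 0))" by (intro tame_mult tame_height)
    have "variance (\<lambda>\<omega>. real_of_int (Z t \<omega> 0)) =
        expectation (\<lambda>\<omega>. (real_of_int (Z t \<omega> 0))\<^sup>2) - (expectation (\<lambda>\<omega>. real_of_int (Z t \<omega> 0)))\<^sup>2"
      using expectation_E(1)[OF that tame_height] expectation_E(1)[OF that sq]
      by (intro variance_eq) (auto simp: power2_eq_square)
    also have "\<dots> = heat_integral t + mean_height t 0 - (mean_height t 0)\<^sup>2"
      using expectation_E(2)[OF that tame_height, of 0] expectation_E(2)[OF that sq]
      by (simp add: E_height E_height_sq that power2_eq_square)
    finally show ?thesis by simp
  qed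
  \<comment> \<open>The mean lies in [0, 1], so its contribution to the variance is bounded and
    disappears after division by \<open>sqrt t\<close>.\<close>
  have "((\<lambda>t. (mean_height t 0 - (mean_height t 0)\<^sup>2) / sqrt t) \<longlongrightarrow> 0) at_top"
  proof (rule Lim_null_comparison)
    show "\<forall>\<^sub>F t in at_top. norm ((mean_height t 0 - (mean_height t 0)\<^sup>2) / sqrt t) \<le> 1 / sqrt t"
      using eventually_gt_at_top[of 0]
    proof eventually_elim
      case (elim t)
      have m: "0 \<le> mean_height t 0" "mean_height t 0 \<le> 1" using mean_height_bounds[of t 0] elim by auto
      then have "(mean_height t 0)\<^sup>2 \<le> mean_height t 0" by (simp add: power2_eq_square mult_left_le)
      then have "\<bar>mean_height t 0 - (mean_height t 0)\<^sup>2\<bar> \<le> 1" using m zero_le_power2[of "mean_height t 0"] by linarith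
      then show ?case using elim by (simp add: abs_divide divide_right_mono)
    qed
    show "((\<lambda>t. 1 / sqrt t) \<longlongrightarrow> 0) at_top" by real_asymp
  qed
  from tendsto_add[OF heat_integral_asymptotics this]
  have "((\<lambda>t. heat_integral t / sqrt t + (mean_height t 0 - (mean_height t 0)\<^sup>2) / sqrt t) \<longlongrightarrow> 1 / sqrt pi) at_top"
    by simp
  moreover have "\<forall>\<^sub>F t in at_top. heat_integral t / sqrt t + (mean_height t 0 - (mean_height t 0)\<^sup>2) / sqrt t
      = variance (\<lambda>\<omega>. real_of_int (Z t \<omega> 0)) / sqrt t"
    using eventually_ge_at_top[of 0] by eventually_elim (simp only: variance add_divide_distrib)
  ultimately have part1: "((\<lambda>t. variance (\<lambda>\<omega>. real_of_int (Z t \<omega> 0)) / sqrt t) \<longlongrightarrow> 1 / sqrt pi) at_top"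
    by (rule Lim_transform_eventually)

  note tame_exp = tame_exp_abs_height[of 0]
  have part2: "(SUP t\<in>{t0..}. \<integral>\<^sup>+\<omega>. ennreal (exp \<bar>real_of_int (Z t \<omega> 0) / t powr (1 / 4)\<bar>) \<partial>M) < \<infinity>"
    if t0: "0 < t0" for t0 :: real
  proof -
    obtain B where B: "\<And>t. t0 \<le> t \<Longrightarrow> E t (\<lambda>\<zeta>. exp \<bar>real_of_int (\<zeta> 0) / t powr (1 / 4)\<bar>) \<le> B"
      using scaled_exp_moment_bound[OF t0] by blast
    have "(\<integral>\<^sup>+\<omega>. ennreal (exp \<bar>real_of_int (Z t \<omega> 0) / t powr (1 / 4)\<bar>) \<partial>M) \<le> ennreal B" if "t \<in> {t0..}" for t
    proof -
      have t: "0 \<le> t" "t0 \<le> t" using that t0 by auto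
      have "(\<integral>\<^sup>+\<omega>. ennreal (exp \<bar>real_of_int (Z t \<omega> 0) / t powr (1 / 4)\<bar>) \<partial>M)
          = ennreal (expectation (\<lambda>\<omega>. exp \<bar>real_of_int (Z t \<omega> 0) / t powr (1 / 4)\<bar>))"
        by (intro nn_integral_eq_integral expectation_E(1)[OF t(1) tame_exp]) auto
      also have "\<dots> \<le> ennreal B"
        unfolding expectation_E(2)[OF t(1) tame_exp] by (intro ennreal_leI B t(2))
      finally show ?thesis .
    qed
    then have "(SUP t\<in>{t0..}. \<integral>\<^sup>+\<omega>. ennreal (exp \<bar>real_of_int (Z t \<omega> 0) / t powr (1 / 4)\<bar>) \<partial>M) \<le> ennreal B"
      by (rule SUP_least)
    then show ?thesis by (rule order.strict_trans1) simp
  qed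

  \<comment> \<open>The constant of the tail bound is this exponential moment bound for times at
    least 1; it is fixed before \<open>K\<close>, hence the same for all \<open>K\<close>.\<close>
  obtain B where B: "\<And>t. 1 \<le> t \<Longrightarrow> E t (\<lambda>\<zeta>. exp \<bar>real_of_int (\<zeta> 0) / t powr (1 / 4)\<bar>) \<le> B"
    using scaled_exp_moment_bound[of 1] by auto
  have part3: "measure M {\<omega> \<in> space M. \<bar>real_of_int (Z t \<omega> 0)\<bar> > K * t powr (1 / 4) * ln t} \<le> B * t powr (- K)"
    if "1 \<le> t" for K t
  proof -
    let ?A = "{\<omega> \<in> space M. \<bar>real_of_int (Z t \<omega> 0)\<bar> > K * t powr (1 / 4) * ln t}"
    let ?X = "\<lambda>\<omega>. exp \<bar>real_of_int (Z t \<omega> 0) / t powr (1 / 4)\<bar>"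
    have t: "0 \<le> t" "0 < t" using that by auto
    have [measurable]: "(\<lambda>\<omega>. real_of_int (Z t \<omega> 0)) \<in> borel_measurable M"
      using expectation_E(1)[OF t(1) tame_height[of 0]] by (rule borel_measurable_integrable)
    have A: "?A \<in> sets M" by measurable
    have "measure M ?A = expectation (indicat_real ?A)" using A by simp
    also have "\<dots> \<le> expectation (\<lambda>\<omega>. ?X \<omega> * t powr (- K))"
    proof (rule integral_mono)
      show "integrable M (indicat_real ?A)"
        using A by (intro integrable_real_indicator) (auto simp: emeasure_eq_measure)
      show "integrable M (\<lambda>\<omega>. ?X \<omega> * t powr (- K))"
        by (intro integrable_mult_left expectation_E(1)[OF t(1) tame_exp])
      fix \<omega>
      show "indicat_real ?A \<omega> \<le> ?X \<omega> * t powr (- K)"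
      proof (cases "\<omega> \<in> ?A")
        case True
        then have "K * ln t \<le> \<bar>real_of_int (Z t \<omega> 0) / t powr (1 / 4)\<bar>"
          using t by (simp add: abs_divide pos_le_divide_eq mult.commute mult.left_commute)
        \<comment> \<open>On the event the exponential is at least exp(K ln t) = t^K, so multiplying
          by \<open>t powr (- K)\<close> dominates the indicator.\<close>
        then have "exp (K * ln t) * t powr (- K) \<le> ?X \<omega> * t powr (- K)" by (intro mult_right_mono) auto
        then show ?thesis using True t by (simp add: powr_def exp_add[symmetric])
      qed simp
    qed
    also have "\<dots> = E t (\<lambda>\<zeta>. exp \<bar>real_of_int (\<zeta> 0) / t powr (1 / 4)\<bar>) * t powr (- K)"
      by (simp only: integral_mult_left_zero expectation_E(2)[OF t(1) tame_exp])
    also have "\<dots> \<le> B * t powr (- K)" using B[OF that] by (intro mult_right_mono) auto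
    finally show ?thesis .
  qed
  have "\<forall>K>0. \<forall>\<^sub>F t in at_top.
        measure M {\<omega> \<in> space M. \<bar>real_of_int (Z t \<omega> 0)\<bar> > K * t powr (1 / 4) * ln t} \<le> B * t powr (- K)"
    using part3 by (intro allI impI eventually_mono[OF eventually_ge_at_top[of 1]])
  then show ?thesis using part1 part2 by blast
qed

end
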